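(* Let $p$ be a prime, let $q$ be a power of $p$, and let $d\geq 4$ be an integer with $2d=q+1$. Let $\mathcal{C}_d: y^d=\varphi_d(x)$ over a field of characteristic $p$, where $\varphi_d$ is the $d$-th Chebyshev polynomial. Then the automorphism group $G$ of $\mathcal{C}_d$ has order $6d^2$ and has a normal abelian subgroup $H\cong\mathbb{Z}/d\mathbb{Z}\times\mathbb{Z}/d\mathbb{Z}$ of order $d^2$ such that $G/H\cong S_3$.
   Context: The $d$-th Chebyshev polynomial $\varphi_d(X)$ over a field $k$ is the unique monic polynomial with $\varphi_d(t+t^{-1})=t^d+t^{-d}$ in $k[t,t^{-1}]$. $\mathcal{C}_d$ denotes the closure in $\mathbb{P}^2$ of the affine curve $y^d=\varphi_d(x)$, a smooth plane curve. The automorphism group consists of the automorphisms defined over a fixed algebraic closure $\overline{k}$ of the base field. A power of $p$ means $p^r$ with $r\geq 1$. *)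

theory Defs
  imports
    "HOL-Computational_Algebra.Computational_Algebra"
    "HOL-Algebra.Algebraic_Closure_Type"
    "HOL-Algebra.Bij"
    "HOL-Algebra.Coset"
    "HOL-Algebra.Elementary_Groups"
    "HOL-Algebra.Sym_Groups"
begin

section \<open>Chebyshev polynomials\<close>

text \<open>The ring \<open>k[t, 1/t]\<close> is regarded as a subring of the formal Laurent series \<open>k((t))\<close>.
  The lemma \<open>chebyshev_ex1\<close> below justifies the definite description for \<open>d > 0\<close>.
  (For \<open>d = 0\<close> the equation forces the constant 2, which is not monic.)\<close>

definition is_chebyshev :: "nat \<Rightarrow> 'k::field poly \<Rightarrow> bool" where
  "is_chebyshev d \<phi> \<longleftrightarrow> Polynomial.lead_coeff \<phi> = 1 \<and>
     poly (map_poly fls_const \<phi>) (fls_X + fls_X_inv) = fls_X ^ d + fls_X_inv ^ d"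

definition chebyshev :: "nat \<Rightarrow> 'k::field poly" where
  "chebyshev d = (THE \<phi>. is_chebyshev d \<phi>)"

lemma fls_const_poly_diff:
  fixes p q :: "'k::field poly"
  shows "map_poly fls_const (p - q) = map_poly fls_const p - map_poly fls_const q"
  by (rule poly_eqI) (simp add: coeff_map_poly fls_minus_const)

lemma chebyshev_exists_aux:
  "\<exists>(p :: 'k::field poly) (q :: 'k poly). Polynomial.degree p = n + 2 \<and> is_chebyshev (n + 2) p \<and>
     Polynomial.degree q = n + 1 \<and> is_chebyshev (n + 1) q"
proof (induction n)
  case 0
  have inv: "(fls_X :: 'k fls) * fls_X_inv = 1"
    by (simp add: fls_X_times_conv_shift)
  have c2: "fls_const (-2 :: 'k) = -2"
  proof -
    have "fls_const (-2 :: 'k) + (fls_const 1 + fls_const 1) = 0"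
      by (simp del: fls_const_1 add: fls_plus_const)
    then have "fls_const (-2 :: 'k) + 2 = 0" by simp
    then show ?thesis by (simp only: add_eq_0_iff2)
  qed
  have "(fls_X + fls_X_inv :: 'k fls) * (fls_X + fls_X_inv) =
      fls_X ^ 2 + fls_X_inv ^ 2 + 2 * (fls_X * fls_X_inv)"
    by (simp add: power2_eq_square algebra_simps)
  then have "is_chebyshev 2 ([:-2, 0, 1:] :: 'k poly)"
    by (simp add: is_chebyshev_def map_poly_pCons c2 inv)
  moreover have "is_chebyshev 1 ([:0, 1:] :: 'k poly)"
    by (simp add: is_chebyshev_def map_poly_pCons)
  ultimately show ?case
    by - (rule exI[of _ "[:-2, 0, 1:]"], rule exI[of _ "[:0, 1:]"], simp add: numeral_2_eq_2)
next
  case (Suc n)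
  then obtain p q :: "'k poly" where
    p: "Polynomial.degree p = n + 2" "is_chebyshev (n + 2) p" and
    q: "Polynomial.degree q = n + 1" "is_chebyshev (n + 1) q"
    by blast
  define r where "r = pCons 0 p - q"
  have p0: "p \<noteq> 0" using p by auto
  have dr: "Polynomial.degree r = n + 3"
    unfolding r_def using p q p0
    by (subst diff_conv_add_uminus, subst Polynomial.degree_add_eq_left) auto
  have inv: "(fls_X :: 'k fls) * fls_X_inv = 1"
    by (simp add: fls_X_times_conv_shift)
  have "Polynomial.coeff q (n + 3) = 0"
    using q by (intro Polynomial.coeff_eq_0) simp
  then have "Polynomial.coeff r (n + 3) = Polynomial.coeff p (n + 2)"
    unfolding r_def by (simp add: numeral_3_eq_3 numeral_2_eq_2)
  then have lr: "Polynomial.lead_coeff r = 1"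
    using dr p by (simp add: is_chebyshev_def)
  have a: "x * y = 1 \<Longrightarrow> (x + y) * (x ^ (n + 2) + y ^ (n + 2)) - (x ^ (n + 1) + y ^ (n + 1))
      = x ^ (n + 3) + y ^ (n + 3)" for x y :: "'k fls"
  proof -
    assume xy: "x * y = 1"
    have "(x + y) * (x ^ (n + 2) + y ^ (n + 2)) =
      x ^ (n + 3) + y ^ (n + 3) + (x * y) * (x ^ (n + 1) + y ^ (n + 1))"
      by (simp add: algebra_simps numeral_3_eq_3 numeral_2_eq_2)
    then show ?thesis by (simp add: xy)
  qed
  have "poly (map_poly fls_const r) (fls_X + fls_X_inv) = fls_X ^ (n + 3) + fls_X_inv ^ (n + 3)"
    using p q a[OF inv]
    by (simp add: r_def fls_const_poly_diff map_poly_pCons is_chebyshev_def)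
  then have "is_chebyshev (n + 3) r"
    using lr by (simp add: is_chebyshev_def)
  then show ?case
    using p dr by - (rule exI[of _ r], rule exI[of _ p], simp add: numeral_3_eq_3)
qed

lemma poly_fls_X_plus_inv_nonzero:
  fixes p :: "'k::field poly"
  assumes "p \<noteq> 0"
  defines "T \<equiv> fls_X + fls_X_inv :: 'k fls"
  shows "poly (map_poly fls_const p) T \<noteq> 0 \<and>
    fls_subdegree (poly (map_poly fls_const p) T) = - int (Polynomial.degree p)"
  using assms(1)
proof (induction p)
  case (pCons a p)
  have T: "fls_subdegree T = -1" "T \<noteq> 0"
  proof -
    show "fls_subdegree T = -1"
      unfolding T_def by (subst fls_subdegree_add_eq2) auto
    then show "T \<noteq> 0" by auto
  qed
  show ?case
  proof (cases "p = 0")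
    case True
    then show ?thesis using pCons by (simp add: map_poly_pCons fls_const_nonzero)
  next
    case False
    define e where "e = T * poly (map_poly fls_const p) T"
    have e: "e \<noteq> 0" "fls_subdegree e = - 1 - int (Polynomial.degree p)"
      using pCons.IH[OF False] T by (auto simp: e_def)
    have "fls_subdegree (fls_const a + e) = fls_subdegree e"
    proof (cases "a = 0")
      case False
      then show ?thesis using e by (intro fls_subdegree_add_eq2) auto
    qed simp
    moreover from this have "fls_const a + e \<noteq> 0"
      using e by auto
    ultimately show ?thesis
      using False e by (simp add: map_poly_pCons e_def)
  qed
qed simp

lemma chebyshev_ex1:
  assumes "d > 0"
  shows "\<exists>!\<phi> :: 'k::field poly. is_chebyshev d \<phi>"
proof -
  obtain n where n: "d = n + 1"
    using assms by (metis Suc_eq_plus1 gr0_conv_Suc)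
  have "\<exists>\<phi> :: 'k poly. is_chebyshev d \<phi>"
    unfolding n using chebyshev_exists_aux[of n, where 'k = 'k] by blast
  moreover have "\<phi> = \<psi>" if "is_chebyshev d \<phi>" "is_chebyshev d \<psi>" for \<phi> \<psi> :: "'k poly"
    using that poly_fls_X_plus_inv_nonzero[of "\<phi> - \<psi>"]
    by (auto simp: is_chebyshev_def fls_const_poly_diff)
  ultimately show ?thesis by blast
qed

lemma is_chebyshev_chebyshev:
  "d > 0 \<Longrightarrow> is_chebyshev d (chebyshev d :: 'k::field poly)"
  unfolding chebyshev_def by (rule theI') (rule chebyshev_ex1)


section \<open>The projective plane and its Zariski topology\<close>

type_synonym 'a triple = "'a \<times> 'a \<times> 'a"
type_synonym 'a point = "'a triple set"

text \<open>The point with given homogeneous coordinates is the set of all its homogeneous coordinate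
  vectors.\<close>

definition proj :: "'a::field triple \<Rightarrow> 'a point" where
  "proj = (\<lambda>(x, y, z). {(c * x, c * y, c * z) | c. c \<noteq> 0})"

definition P2 :: "'a::field point set" where
  "P2 = proj ` (UNIV - {(0, 0, 0)})"

text \<open>\<open>form n a\<close> is the homogeneous polynomial of degree \<open>n\<close> in which the monomial
  \<open>x^i y^j z^(n-i-j)\<close> has coefficient \<open>a i j\<close>; coefficients with \<open>i + j > n\<close> are ignored.\<close>

definition form :: "nat \<Rightarrow> (nat \<Rightarrow> nat \<Rightarrow> 'a::field) \<Rightarrow> 'a triple \<Rightarrow> 'a" where
  "form n a = (\<lambda>(x, y, z). \<Sum>i\<le>n. \<Sum>j\<le>n - i. a i j * x ^ i * y ^ j * z ^ (n - i - j))"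

definition vanishes_at :: "nat \<Rightarrow> (nat \<Rightarrow> nat \<Rightarrow> 'a::field) \<Rightarrow> 'a point \<Rightarrow> bool" where
  "vanishes_at n a P \<longleftrightarrow> (\<forall>v\<in>P. form n a v = 0)"

definition zariski_closure :: "'a::field point set \<Rightarrow> 'a point set" where
  "zariski_closure S =
     {P \<in> P2. \<forall>n a. (\<forall>Q\<in>S. vanishes_at n a Q) \<longrightarrow> vanishes_at n a P}"

definition zariski_open :: "'a::field point set \<Rightarrow> bool" where
  "zariski_open U \<longleftrightarrow> U \<subseteq> P2 \<and> zariski_closure (P2 - U) = P2 - U"


section \<open>Automorphisms of a projective plane curve\<close>

text \<open>The next two definitions are the classical ones for a variety given by its set of points over
  an algebraically closed field: a morphism \<open>C \<rightarrow> C\<close> is a map that near every point is given by three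
  forms of the same degree without common zero, and an automorphism is a bijective morphism whose
  inverse is a morphism. As in \<^const>\<open>BijGroup\<close>, maps are \<^const>\<open>undefined\<close> outside \<open>C\<close>.\<close>

definition curve_morphism :: "'a::alg_closed_field point set \<Rightarrow> ('a point \<Rightarrow> 'a point) \<Rightarrow> bool" where
  "curve_morphism C f \<longleftrightarrow> f ` C \<subseteq> C \<and>
     (\<forall>P\<in>C. \<exists>U n a b c. zariski_open U \<and> P \<in> U \<and>
        (\<forall>Q\<in>U \<inter> C. \<forall>v\<in>Q. (form n a v, form n b v, form n c v) \<noteq> (0, 0, 0) \<and>
           f Q = proj (form n a v, form n b v, form n c v)))"

definition Aut :: "'a::alg_closed_field point set \<Rightarrow> ('a point \<Rightarrow> 'a point) monoid" where
  "Aut C = (BijGroup C)\<lparr>carrier :=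
     {f \<in> Bij C. curve_morphism C f \<and> curve_morphism C (restrict (inv_into C f) C)}\<rparr>"


section \<open>The curves\<close>

text \<open>The set of points, over the algebraic closure of the base field \<open>k\<close>, of the closure in the
  projective plane of the affine curve \<open>y^d = \<phi>(x)\<close>, where \<open>\<phi>\<close> is the \<open>d\<close>-th Chebyshev
  polynomial over \<open>k\<close>. The argument of type \<open>k itself\<close> carries the base field.\<close>

definition chebyshev_curve :: "'k::field itself \<Rightarrow> nat \<Rightarrow> 'k alg_closure point set" where
  "chebyshev_curve _ d =
     zariski_closure {proj (x, y, 1) | x y. y ^ d = poly (map_poly to_ac (chebyshev d :: 'k poly)) x}"

end

theory Submission
  imports Defs
begin

text \<open>Since \<open>2d = q + 1\<close>, the Frobenius map gives \<open>2\<phi>_d(x) = (x + 2)^d + (x - 2)^d\<close>, so that the curve is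
  projectively equivalent to the Fermat curve \<open>X^d + Y^d + Z^d = 0\<close>. The monomial maps form a group of
  automorphisms of order \<open>6d^2\<close>, and it remains to see that there are no others.

  Moving the flex \<open>P = (0:1:\<epsilon>)\<close>, \<open>\<epsilon>^d = -1\<close>, to infinity gives the affine curve
  \<open>x^d = g(z) = (z + 1)^d - z^d\<close>, on which \<open>x\<close> and \<open>z\<close> have poles of order \<open>d - 1\<close> and \<open>d\<close> at \<open>P\<close> and
  \<open>x^i z^j\<close>, \<open>i < d\<close>, have pairwise different pole orders. If an automorphism fixes \<open>P\<close>, it acts on the
  coordinate ring. The images of \<open>x\<close> and \<open>z\<close> again satisfy the equation of the curve, so their pole orders are
  \<open>m(d - 1)\<close> and \<open>md\<close>; they generate the ring, so \<open>m = 1\<close>. Hence the automorphism is affine linear, and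
  comparing coefficients shows that it is monomial.

  If an automorphism maps \<open>P\<close> to \<open>Q = (a, b)\<close>, there is a function \<open>h\<close> whose only pole is \<open>Q\<close> and has
  order \<open>d - 1\<close>. Write \<open>h = (\<Sum>i<d. x^i r_i(z)) / (z - b)^N\<close>. Regularity of \<open>h\<close> at the conjugate points
  \<open>(\<zeta>a, b)\<close> and Fourier inversion over \<open>\<zeta>\<close> give \<open>x r_{i+1} \<equiv> r_i\<close> modulo \<open>(z - b)^N\<close> at \<open>Q\<close>, whereas
  regularity at \<open>P\<close> bounds the degrees of the \<open>r_i\<close> by \<open>N - i\<close>. For \<open>i = d - 2\<close> this forces \<open>x\<close> to be a
  linear function of \<open>z\<close> up to order 3 at \<open>Q\<close>, so that \<open>Q\<close> is a flex, and monomial maps move it back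
  to \<open>P\<close>.\<close>

section \<open>Evaluation of polynomials in two variables\<close>

text \<open>The nonvanishing of \<open>d\<close>, \<open>d - 1\<close> and \<open>d choose 3\<close>
  in the field keeps the group small: if \<open>d - 1\<close> were a power of the characteristic,
  the Fermat curve would be Hermitian, every point would be a flex and there would be more
  automorphisms. Since 2d = q + 1, one has d = 1/2 and d - 1 = -1/2 in characteristic p; the third
  value needs extra care for p = 3. The obstacle is that an automorphism is given only locally, by
  forms of unknown degree. The choice of a flex removes it: the tangent line there meets the curve
  nowhere else, so its complement omits a single point, and regular functions on that complement are
  polynomials in x and z. All statements about poles and zeros rest on one device. An identity that
  holds at all but finitely many points of the curve says that its equation divides a polynomial,
  and therefore persists when any series solution of the equation is substituted: a Laurent series
  at infinity, power series at affine points with x nonzero.\<close>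

locale coef_hom =
  fixes h :: "'a::comm_ring_1 \<Rightarrow> 'b::comm_ring_1"
  assumes zero: "h 0 = 0" and one: "h 1 = 1"
    and add: "h (a + b) = h a + h b" and mult: "h (a * b) = h a * h b"
begin

lemma minus: "h (- a) = - h a"
  using add[of a "- a"] zero by (simp add: eq_neg_iff_add_eq_0 add.commute)

lemma diff: "h (a - b) = h a - h b"
  using add[of a "- b"] minus by simp

lemma power: "h (a ^ n) = h a ^ n"
  by (induction n) (simp_all add: one mult)

lemma sum: "h (sum f A) = (\<Sum>x\<in>A. h (f x))"
  by (induction A rule: infinite_finite_induct) (simp_all add: zero add)

lemma prod: "h (prod f A) = (\<Prod>x\<in>A. h (f x))"
  by (induction A rule: infinite_finite_induct) (simp_all add: one mult)

lemma of_nat: "h (of_nat n) = of_nat n"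
  by (induction n) (simp_all add: zero one add)

lemma map_poly_add: "map_poly h (p + q) = map_poly h p + map_poly h q"
  by (rule poly_eqI) (simp add: coeff_map_poly zero add)

lemma map_poly_smult: "map_poly h (smult a q) = smult (h a) (map_poly h q)"
  by (rule poly_eqI) (simp add: coeff_map_poly zero mult)

lemma map_poly_mult: "map_poly h (p * q) = map_poly h p * map_poly h q"
  by (induction p) (simp_all add: map_poly_pCons zero map_poly_add map_poly_smult)

text \<open>Closure under evaluation settles the case of two variables: applied first to z and then
  to x, it gives one set of rules for values in the field, in power series and in Laurent
  series.\<close>

lemma coef_hom_poly: "coef_hom (\<lambda>p. poly (map_poly h p) x)"
  by unfold_locales (simp_all add: one zero map_poly_add map_poly_mult map_poly_1')

end

lemma coef_hom_id: "coef_hom (\<lambda>c. c)"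
  by unfold_locales simp_all

lemma coef_hom_fls_const: "coef_hom (fls_const :: 'a::comm_ring_1 \<Rightarrow> 'a fls)"
  by unfold_locales (simp_all add: fls_plus_const fls_const_mult_const)

lemma coef_hom_fps_const: "coef_hom (fps_const :: 'a::comm_ring_1 \<Rightarrow> 'a fps)"
  by unfold_locales simp_all

text \<open>Polynomials in \<open>x\<close> and \<open>z\<close> are elements of \<open>k[z][x]\<close>; \<open>x\<close> is the outer variable.\<close>

definition ev :: "('a::comm_ring_1 \<Rightarrow> 'b::comm_ring_1) \<Rightarrow> 'b \<Rightarrow> 'b \<Rightarrow> 'a poly poly \<Rightarrow> 'b" where
  "ev h u v p = poly (map_poly (\<lambda>c. poly (map_poly h c) v) p) u"

lemma coef_hom_ev:
  assumes "coef_hom h"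
  shows "coef_hom (ev h u v)"
  unfolding ev_def[abs_def] by (intro coef_hom.coef_hom_poly assms)

definition xx :: "'a::comm_ring_1 poly poly" where "xx = [:0, 1:]"
definition zz :: "'a::comm_ring_1 poly poly" where "zz = [:[:0, 1:]:]"
definition cc :: "'a::comm_ring_1 \<Rightarrow> 'a poly poly" where "cc c = [:[:c:]:]"

context coef_hom
begin

lemma ev_simps [simp]:
  "ev h u v 0 = 0" "ev h u v 1 = 1"
  "ev h u v (p + q) = ev h u v p + ev h u v q"
  "ev h u v (p - q) = ev h u v p - ev h u v q"
  "ev h u v (- p) = - ev h u v p"
  "ev h u v (p * q) = ev h u v p * ev h u v q"
  "ev h u v (p ^ n) = ev h u v p ^ n"
  "ev h u v (sum f A) = (\<Sum>x\<in>A. ev h u v (f x))"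
  "ev h u v (prod f A) = (\<Prod>x\<in>A. ev h u v (f x))"
  "ev h u v (of_nat k) = of_nat k"
proof -
  interpret e: coef_hom "ev h u v"
    by (rule coef_hom_ev) unfold_locales
  show "ev h u v 0 = 0" "ev h u v 1 = 1"
  "ev h u v (p + q) = ev h u v p + ev h u v q"
  "ev h u v (p - q) = ev h u v p - ev h u v q"
  "ev h u v (- p) = - ev h u v p"
  "ev h u v (p * q) = ev h u v p * ev h u v q"
  "ev h u v (p ^ n) = ev h u v p ^ n"
  "ev h u v (sum f A) = (\<Sum>x\<in>A. ev h u v (f x))"
  "ev h u v (prod f A) = (\<Prod>x\<in>A. ev h u v (f x))"
  "ev h u v (of_nat k) = of_nat k"
    by (rule e.zero e.one e.add e.diff e.minus e.mult e.power e.sum e.prod e.of_nat)+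
qed

lemma ev_const [simp]: "ev h u v [:c:] = poly (map_poly h c) v"
  by (simp add: ev_def map_poly_pCons zero)

lemma ev_smult [simp]: "ev h u v (smult c p) = poly (map_poly h c) v * ev h u v p"
  using ev_simps(6)[of u v "[:c:]" p] by simp

lemma ev_gens [simp]: "ev h u v xx = u" "ev h u v zz = v" "ev h u v (cc c) = h c"
  unfolding xx_def zz_def cc_def
  by (simp_all add: ev_def map_poly_pCons zero one map_poly_1')

lemma ev_altdef: "ev h u v p = (\<Sum>i\<le>Polynomial.degree p. poly (map_poly h (poly.coeff p i)) v * u ^ i)"
proof -
  let ?h = "\<lambda>c. poly (map_poly h c) v"
  have "Polynomial.degree (map_poly ?h p) \<le> Polynomial.degree p"
    by (rule map_poly_degree_leq)
  then show ?thesis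
    unfolding ev_def
    by (subst poly_altdef, intro sum.mono_neutral_cong_left)
       (auto intro!: le_degree simp: coeff_map_poly zero)
qed

end

text \<open>Newton iteration: for a \<noteq> 0 the derivative d * a^(d - 1) of Y^d is invertible, so
  each coefficient of the root solves a linear equation once the earlier ones are known.\<close>

lemma hensel_root:
  fixes G :: "'a::field fps"
  assumes a: "a ^ d = fps_nth G 0" "a \<noteq> 0" and d: "of_nat d \<noteq> (0::'a)"
  shows "\<exists>Y. fps_nth Y 0 = a \<and> Y ^ d = G"
proof -
  have "d > 0" using d by (cases d) auto
  define P where "P = (\<lambda>(y :: 'a fps) n. fps_nth y 0 = a \<and> (\<forall>i\<le>n. fps_nth (y ^ d) i = fps_nth G i))"
  have step: "\<exists>y'. P y' (Suc n) \<and> (\<forall>i\<le>n. fps_nth y' i = fps_nth y i)" if y: "P y n" for y n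
  proof -
    \<comment> \<open>Adding c * X^(n + 1) changes coefficient n + 1 of the d-th power by d * a^(d -
      1) * c; this \<open>c\<close> makes up the difference.\<close>
    define c where "c = (fps_nth G (Suc n) - fps_nth (y ^ d) (Suc n)) / (of_nat d * a ^ (d - 1))"
    define u where "u = fps_const c * fps_X ^ Suc n"
    have u: "fps_nth (u * w) i = (if i < Suc n then 0 else c * fps_nth w (i - Suc n))" for w i
    proof -
      have "u * w = fps_const c * (fps_X ^ Suc n * w)" by (simp only: u_def mult.assoc)
      then show ?thesis by (simp only: fps_mult_left_const_nth fps_X_power_mult_nth) simp
    qed
    \<comment> \<open>Taylor expansion to first order; the term with u^2 starts too late to affect
      coefficient n + 1.\<close>
    have P: "\<exists>w. (y + u) ^ k = y ^ k + of_nat k * y ^ (k - 1) * u + u ^ 2 * w" for k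
    proof (induction k)
      case (Suc k)
      then obtain w where w: "(y + u) ^ k = y ^ k + of_nat k * y ^ (k - 1) * u + u ^ 2 * w" by blast
      have k: "of_nat k * y ^ k = of_nat k * y ^ (k - 1) * y"
        by (cases k) (simp_all add: mult_ac)
      have "(y + u) ^ Suc k = (y ^ k + of_nat k * y ^ (k - 1) * u + u ^ 2 * w) * (y + u)"
        by (simp only: power_Suc2 w)
      also have "\<dots> = y ^ Suc k + (of_nat k * y ^ (k - 1) * y + y ^ k) * u
          + u ^ 2 * (of_nat k * y ^ (k - 1) + w * y + u * w)"
        by (simp add: algebra_simps power2_eq_square)
      also have "of_nat k * y ^ (k - 1) * y + y ^ k = of_nat (Suc k) * y ^ (Suc k - 1)"
        by (subst k[symmetric]) (simp add: algebra_simps)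
      finally show ?case by blast
    qed (auto intro: exI[of _ 0])
    obtain w where w: "(y + u) ^ d = y ^ d + of_nat d * y ^ (d - 1) * u + u ^ 2 * w"
      using P by blast
    have "(y + u) ^ d = y ^ d + u * (fps_const (of_nat d) * y ^ (d - 1) + u * w)"
      unfolding w by (simp add: algebra_simps power2_eq_square fps_of_nat)
    then have e: "fps_nth ((y + u) ^ d) i = fps_nth (y ^ d) i +
        (if i < Suc n then 0 else c * fps_nth (fps_const (of_nat d) * y ^ (d - 1) + u * w) (i - Suc n))" for i
      by (simp only: fps_add_nth u)
    have y0: "fps_nth (y ^ (d - 1)) 0 = a ^ (d - 1)"
      using y by (simp add: P_def fps_power_zeroth)
    have u0: "fps_nth u 0 = 0" by (simp add: u_def)
    have "fps_nth ((y + u) ^ d) i = fps_nth G i" if "i \<le> Suc n" for i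
      using that y a d by (cases "i = Suc n") (auto simp: e P_def c_def y0 u0 fps_power_zeroth)
    moreover have "fps_nth (y + u) i = fps_nth y i" if "i \<le> n" for i
      using u[of 1 i] that by simp
    ultimately show ?thesis
      using y by (intro exI[of _ "y + u"]) (auto simp: P_def)
  qed
  have "P (fps_const a) 0"
    using a by (simp add: P_def fps_const_power)
  then obtain f where f: "\<And>n. P (f n) n \<and> (\<forall>i\<le>n. fps_nth (f (Suc n)) i = fps_nth (f n) i)"
    using dependent_nat_choice[of "\<lambda>n y. P y n" "\<lambda>n y y'. \<forall>i\<le>n. fps_nth y' i = fps_nth y i"] step
    by (metis le0)
  \<comment> \<open>Diagonal limit: the approximation \<open>f n\<close> is final up to coefficient
    n.\<close>
  define Y where "Y = Abs_fps (\<lambda>n. fps_nth (f n) n)"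
  have stab: "fps_nth (f (n + k)) i = fps_nth (f n) i" if "i \<le> n" for n k i
    using f that by (induction k) auto
  have Yf: "fps_nth Y i = fps_nth (f n) i" if "i \<le> n" for i n
    using stab[of i i "n - i"] that by (simp add: Y_def)
  have pw: "fps_nth (Y ^ k) i = fps_nth (f n ^ k) i" if "i \<le> n" for i n k
    using that
  proof (induction k arbitrary: i)
    case (Suc k)
    then show ?case
      by (simp add: fps_mult_nth Yf[of _ n])
  qed simp
  have "Y ^ d = G"
    by (rule fps_ext, subst pw[OF order_refl]) (use f in \<open>auto simp: P_def\<close>)
  moreover have "fps_nth Y 0 = a"
    using f by (simp add: Y_def P_def)
  ultimately show ?thesis by blast
qed

section \<open>The affine curve and its expansion at infinity\<close>

text \<open>Over a finite field the product of all X - a, increased by 1, would be a nonconstant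
  polynomial without roots.\<close>

lemma infinite_UNIV_alg_closed: "infinite (UNIV :: 'a::alg_closed_field set)"
proof
  assume fin: "finite (UNIV :: 'a set)"
  define p where "p = (\<Prod>a\<in>(UNIV :: 'a set). [:-a, 1:]) + 1"
  have "poly p x = 1" for x
    using fin by (auto simp: p_def poly_prod)
  moreover have "Polynomial.degree p > 0"
  proof (rule ccontr)
    assume "\<not> Polynomial.degree p > 0"
    then obtain c where c: "p = [:c:]" by (auto elim: degree_eq_zeroE)
    have "(\<Prod>a\<in>(UNIV :: 'a set). [:-a, 1:]) = [:c:] - 1"
      using c by (simp add: p_def eq_diff_eq)
    then have "(\<Prod>a\<in>(UNIV :: 'a set). [:-a, 1:]) = [:c - 1:]"
      by (simp add: one_pCons)
    moreover have "Polynomial.degree (\<Prod>a\<in>(UNIV :: 'a set). [:-a, 1:]) = card (UNIV :: 'a set)"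
      by (subst degree_prod_eq_sum_degree) auto
    ultimately show False
      using fin by (simp add: card_eq_0_iff)
  qed
  ultimately show False
    using alg_closed_imp_poly_has_root[of p] by auto
qed

text \<open>X^n - c is separable: a double root would be a root of n * X^(n - 1), hence 0, and 0 is
  no root because c \<noteq> 0.\<close>

lemma card_nth_roots:
  fixes c :: "'a::alg_closed_field"
  assumes c: "c \<noteq> 0" and n: "of_nat n \<noteq> (0::'a)"
  shows "card {x. x ^ n = c} = n"
proof -
  have "n > 0" using n by (cases n) auto
  define p where "p = Polynomial.monom 1 n - [:c:]"
  have cp: "poly.coeff p i = (if i = n then 1 else 0) - (if i = 0 then c else 0)" for i
    by (auto simp: p_def coeff_pCons split: nat.split)
  have deg: "Polynomial.degree p = n"
    using \<open>n > 0\<close> by (intro antisym degree_le le_degree) (auto simp: cp)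
  have lc: "Polynomial.lead_coeff p = 1"
    using \<open>n > 0\<close> by (simp add: deg cp)
  have "p \<noteq> 0" using lc by auto
  have pv: "poly p x = x ^ n - c" for x by (simp add: p_def poly_monom)
  obtain A where A: "size A = Polynomial.degree p" "p = smult (Polynomial.lead_coeff p) (\<Prod>x\<in>#A. [:-x, 1:])"
    using alg_closed_imp_factorization[OF \<open>p \<noteq> 0\<close>] by blast
  have pA: "p = (\<Prod>x\<in>#A. [:-x, 1:])" using A lc by simp
  have le1: "count A x \<le> 1" for x
  proof (rule ccontr)
    assume "\<not> count A x \<le> 1"
    then have "{#x, x#} \<subseteq># A"
      by (simp add: subseteq_mset_def)
    then obtain B where B: "A = {#x, x#} + B" unfolding mset_subset_eq_exists_conv by blast
    have pd: "poly (pderiv ([:-x, 1:] * ([:-x, 1:] * q))) x = 0" for q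
    proof -
      have x0: "poly [:-x, 1:] x = 0" by simp
      show ?thesis unfolding pderiv_mult poly_mult poly_add x0 by (simp only: mult_zero_left add_0)
    qed
    have p2: "p = [:-x, 1:] * ([:-x, 1:] * (\<Prod>x\<in>#B. [:-x, 1:]))"
      unfolding pA B by (simp only: image_mset_union image_mset_add_mset prod_mset.union prod_mset.add_mset
          image_mset_empty prod_mset.empty mult_1_right mult.assoc)
    have "poly p x = 0" unfolding p2 by (simp only: poly_mult) simp
    moreover have "poly (pderiv p) x = 0" unfolding p2 by (rule pd)
    moreover have "poly (pderiv p) x = of_nat n * x ^ (n - 1)"
      by (simp add: p_def pderiv_diff pderiv_monom poly_monom)
    ultimately have "x ^ n = c" "x = 0"
      using n by (simp_all add: pv)
    then show False using c \<open>n > 0\<close> by (simp add: power_0_left)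
  qed
  have roots: "{x. x ^ n = c} = set_mset A"
  proof -
    have "poly p x = 0 \<longleftrightarrow> x \<in># A" for x
      unfolding pA by (induction A) auto
    then show ?thesis by (auto simp: pv)
  qed
  have "size A = (\<Sum>x\<in>set_mset A. count A x)" by (simp add: size_multiset_overloaded_eq)
  also have "\<dots> = (\<Sum>x\<in>set_mset A. 1)"
  proof (rule sum.cong)
    fix x assume "x \<in># A"
    then have "count A x \<ge> 1" by simp
    then show "count A x = 1" using le1[of x] by linarith
  qed simp
  finally have "size A = card (set_mset A)" by (simp only: card_eq_sum)
  then show ?thesis unfolding roots using A(1) deg by argo
qed

lemma poly_eq_0_if_many_roots:
  fixes p :: "'a::idom poly"
  assumes "finite B" "card B > Polynomial.degree p" "\<And>x. x \<in> B \<Longrightarrow> poly p x = 0"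
  shows "p = 0"
proof (rule ccontr)
  assume "p \<noteq> 0"
  then have "card B \<le> card {x. poly p x = 0}"
    using assms poly_roots_finite by (intro card_mono) auto
  then show False
    using assms card_poly_roots_bound[OF \<open>p \<noteq> 0\<close>] by simp
qed

text \<open>The unique summand of least order contributes a leading coefficient that nothing can
  cancel.\<close>

lemma fls_sum_distinct_subdegrees:
  fixes f :: "'i \<Rightarrow> 'a::comm_ring_1 fls"
  assumes "finite I" "I \<noteq> {}" "\<And>i. i \<in> I \<Longrightarrow> f i \<noteq> 0" "inj_on (\<lambda>i. fls_subdegree (f i)) I"
  shows "sum f I \<noteq> 0 \<and> (\<exists>i\<in>I. fls_subdegree (sum f I) = fls_subdegree (f i)) \<and>
    (\<forall>i\<in>I. fls_subdegree (sum f I) \<le> fls_subdegree (f i))"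
proof -
  define n where "n = Min ((\<lambda>i. fls_subdegree (f i)) ` I)"
  have "n \<in> (\<lambda>i. fls_subdegree (f i)) ` I"
    unfolding n_def using assms by (intro Min_in) auto
  then obtain i where i: "i \<in> I" "fls_subdegree (f i) = n" by auto
  have le: "n \<le> fls_subdegree (f j)" if "j \<in> I" for j
    unfolding n_def using assms that by (intro Min_le) auto
  have lt: "n < fls_subdegree (f j)" if "j \<in> I - {i}" for j
    using le[of j] i assms(4) that by (force simp: inj_on_def order_less_le)
  have s: "sum f I = f i + sum f (I - {i})"
    using assms i by (intro sum.remove) auto
  have nth: "fls_nth (sum f J) k = (\<Sum>j\<in>J. fls_nth (f j) k)" for J k
    by (induction J rule: infinite_finite_induct) auto
  have r0: "fls_nth (sum f (I - {i})) k = 0" if "k \<le> n" for k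
    unfolding nth using lt that by (intro sum.neutral ballI fls_eq0_below_subdegree) force
  have nz: "fls_nth (sum f I) n \<noteq> 0"
    using assms(3)[OF i(1)] i(2) r0 unfolding s by auto
  moreover have "fls_nth (sum f I) k = 0" if "k < n" for k
    using r0[of k] i(2) that unfolding s by auto
  ultimately have "fls_subdegree (sum f I) = n"
    by (intro fls_subdegree_eqI) auto
  then show ?thesis using nz i le by force
qed

lemma fls_subdegree_poly:
  fixes V :: "'a::field fls"
  assumes V: "fls_subdegree V < 0" and "c \<noteq> 0"
  shows "poly (map_poly fls_const c) V \<noteq> 0 \<and>
    fls_subdegree (poly (map_poly fls_const c) V) = int (Polynomial.degree c) * fls_subdegree V"
  using assms(2)
proof (induction c)
  case (pCons a c)
  have V0: "V \<noteq> 0" using V by auto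
  show ?case
  proof (cases "c = 0")
    case True
    then show ?thesis using pCons by (simp add: map_poly_pCons fls_const_nonzero)
  next
    case False
    define e where "e = V * poly (map_poly fls_const c) V"
    have e: "e \<noteq> 0" "fls_subdegree e = (1 + int (Polynomial.degree c)) * fls_subdegree V"
      using pCons.IH[OF False] V0 by (auto simp: e_def algebra_simps)
    have neg: "fls_subdegree e < 0"
      using V unfolding e(2) by (intro mult_pos_neg) auto
    have "fls_subdegree (fls_const a + e) = fls_subdegree e"
    proof (cases "a = 0")
      case False
      then show ?thesis using e neg by (intro fls_subdegree_add_eq2) auto
    qed simp
    moreover from this neg have "fls_const a + e \<noteq> 0"
      by auto
    ultimately show ?thesis
      using False e by (simp add: map_poly_pCons e_def)
  qed
qed simp

interpretation id_hom: coef_hom "\<lambda>c. c" by (rule coef_hom_id)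
interpretation fls_hom: coef_hom "fls_const :: 'a::comm_ring_1 \<Rightarrow> 'a fls" by (rule coef_hom_fls_const)
interpretation fps_hom: coef_hom "fps_const :: 'a::comm_ring_1 \<Rightarrow> 'a fps" by (rule coef_hom_fps_const)

abbreviation bev :: "'a::comm_ring_1 \<Rightarrow> 'a \<Rightarrow> 'a poly poly \<Rightarrow> 'a" where
  "bev \<equiv> ev (\<lambda>c. c)"

lemma bev_altdef: "bev x z p = poly (map_poly (\<lambda>c. poly c z) p) x"
  by (simp add: ev_def map_poly_idI)

text \<open>The parameter \<open>eps\<close> selects the flex (0 : 1 : eps) that is moved to
  infinity. That \<open>d\<close> is nonzero gives separability and d-th roots of series;
  \<open>d - 1\<close> gives curvature away from the flexes; \<open>d choose 3\<close> is needed for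
  the last coefficient in \<open>affine_linear_automorphism\<close>.\<close>

locale fermat =
  fixes d :: nat and eps :: "'a::alg_closed_field"
  assumes d4: "d \<ge> 4" and eps: "eps ^ d = -1"
    and d_nz: "of_nat d \<noteq> (0::'a)" and d1_nz: "of_nat (d - 1) \<noteq> (0::'a)"
    and d3_nz: "of_nat (d choose 3) \<noteq> (0::'a)"
begin

text \<open>The Fermat equation with the tangent line at the flex as line at infinity: it arises
  from the coordinates (x, z, eps * (z + 1)) because eps^d = -1. That line meets the curve in the
  flex only, so exactly one point is missing.\<close>

definition A :: "('a \<times> 'a) set" where "A = {(x, z). x ^ d + z ^ d = (z + 1) ^ d}"

definition gp :: "'a poly" where "gp = [:1, 1:] ^ d - [:0, 1:] ^ d"

definition FF :: "'a poly poly" where "FF = xx ^ d + zz ^ d - (zz + 1) ^ d"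

text \<open>Normal forms for the coordinate ring: \<open>FF\<close> is monic of degree d in x, so
  each residue class has one such representative.\<close>

definition reduced :: "'a poly poly \<Rightarrow> bool" where
  "reduced r \<longleftrightarrow> (\<forall>i\<ge>d. poly.coeff r i = 0)"

lemma FF_altdef: "FF = Polynomial.monom 1 d - [:gp:]"
proof -
  have h: "coef_hom (\<lambda>c :: 'a poly. [:c:])" by unfold_locales simp_all
  have "(zz :: 'a poly poly) ^ d = [:[:0, 1:] ^ d:]" "(zz + 1 :: 'a poly poly) ^ d = [:[:1, 1:] ^ d:]"
    by (simp_all add: coef_hom.power[OF h] zz_def one_pCons)
  then show ?thesis
    by (simp add: FF_def gp_def xx_def monom_altdef)
qed

lemma FF_coeff: "poly.coeff FF i = (if i = d then 1 else if i = 0 then - gp else 0)"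
  using d4 by (auto simp: FF_altdef coeff_pCons split: nat.split)

lemma ev_FF: "coef_hom h \<Longrightarrow> ev h u v FF = u ^ d + v ^ d - (v + 1) ^ d"
  by (simp add: FF_def coef_hom.ev_simps coef_hom.ev_gens)

lemma poly_gp: "poly gp z = (z + 1) ^ d - z ^ d"
  by (simp add: gp_def poly_power add.commute)

lemma A_iff: "(x, z) \<in> A \<longleftrightarrow> x ^ d = poly gp z"
  by (auto simp: A_def poly_gp algebra_simps)

lemma gp_nz: "gp \<noteq> 0"
proof
  assume "gp = 0"
  then have "poly.coeff gp (d - 1) = 0" by simp
  moreover have "poly.coeff gp (d - 1) = of_nat d"
    using d4 binomial_symmetric[of 1 d] by (simp add: gp_def coeff_linear_poly_power)
  ultimately show False using d_nz by simp
qed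

text \<open>Division with remainder works over k[z], which is not a field, because \<open>FF\<close>
  is monic in x.\<close>

lemma normal_form: "\<exists>r s. p = r + FF * s \<and> reduced r"
proof (induction p)
  case 0
  show ?case by (rule exI[of _ 0], rule exI[of _ 0]) (simp add: reduced_def)
next
  case (pCons a p)
  then obtain r s where rs: "p = r + FF * s" "reduced r" by blast
  \<comment> \<open>Multiplication by x pushes only the term c * x^(d - 1) out of range, and
    subtracting c * \<open>FF\<close> replaces the resulting x^d by g(z).\<close>
  define c where "c = poly.coeff r (d - 1)"
  define r' where "r' = [:a:] + pCons 0 r - [:c:] * FF"
  have "pCons a p = r' + FF * (pCons 0 s + [:c:])"
    using rs by (simp add: r'_def algebra_simps)
  moreover have "reduced r'"
    unfolding reduced_def
  proof safe
    fix i assume "i \<ge> d"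
    with d4 obtain j where j: "i = Suc j" by (cases i) auto
    have "poly.coeff r' (Suc j) = poly.coeff r j - c * poly.coeff FF (Suc j)"
      by (simp add: r'_def)
    also have "\<dots> = 0"
    proof (cases "i = d")
      case True
      then have "d - 1 = j" "Suc j = d" using j by simp_all
      then show ?thesis by (simp only: FF_coeff c_def simp_thms if_True) simp
    next
      case False
      then have "poly.coeff r j = 0" "Suc j \<noteq> d"
        using rs(2) j \<open>i \<ge> d\<close> by (auto simp: reduced_def)
      then show ?thesis by (simp only: FF_coeff nat.simps if_False) simp
    qed
    finally show "poly.coeff r' i = 0" by (simp only: j)
  qed
  ultimately show ?case by blast
qed

text \<open>Over all but finitely many z the fibre has d points, whereas r has degree less than d in
  x, so all its coefficients vanish at z; a coefficient with infinitely many zeros is 0. The set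
  \<open>B\<close> makes room for points where a function is not defined.\<close>

lemma reduced_vanish:
  assumes r: "reduced r" and B: "finite B" and van: "\<And>x z. (x, z) \<in> A - B \<Longrightarrow> bev x z r = 0"
  shows "r = 0"
proof -
  define Bz where "Bz = snd ` B \<union> {z. poly gp z = 0}"
  have finB: "finite Bz"
    using B gp_nz poly_roots_finite by (auto simp: Bz_def)
  have "poly (poly.coeff r i) z = 0" if z: "z \<notin> Bz" for i z
  proof -
    let ?r = "map_poly (\<lambda>c. poly c z) r"
    have g: "poly gp z \<noteq> 0" using z by (simp add: Bz_def)
    have "?r = 0"
    proof (rule poly_eq_0_if_many_roots)
      have c: "card {x. x ^ d = poly gp z} = d"
        using g d_nz by (rule card_nth_roots)
      then show "finite {x. x ^ d = poly gp z}"
        using d4 by (metis card.infinite not_numeral_le_zero)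
      have "Polynomial.degree ?r \<le> d - 1"
        using r by (intro degree_le) (auto simp: coeff_map_poly reduced_def)
      then show "Polynomial.degree ?r < card {x. x ^ d = poly gp z}"
        using c d4 by simp
      show "poly ?r x = 0" if "x \<in> {x. x ^ d = poly gp z}" for x
        using van[of x z] that z by (force simp: A_iff Bz_def bev_altdef)
    qed
    then have "poly.coeff ?r i = 0" by simp
    then show ?thesis by (simp add: coeff_map_poly)
  qed
  then have "- Bz \<subseteq> {z. poly (poly.coeff r i) z = 0}" for i by auto
  moreover have "infinite (- Bz)"
    using finB infinite_UNIV_alg_closed by (simp add: Compl_eq_Diff_UNIV)
  ultimately have "infinite {z. poly (poly.coeff r i) z = 0}" for i
    by (meson finite_subset)
  then have "poly.coeff r i = 0" for i
    using poly_roots_finite by blast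
  then show ?thesis by (simp add: poly_eq_iff)
qed

lemma dvd_vanish: "FF dvd p \<Longrightarrow> coef_hom h \<Longrightarrow> u ^ d + v ^ d = (v + 1) ^ d \<Longrightarrow> ev h u v p = 0"
  by (auto simp: dvd_def coef_hom.ev_simps ev_FF)

lemma vanish_imp_dvd:
  assumes "finite B" "\<And>x z. (x, z) \<in> A - B \<Longrightarrow> bev x z p = 0"
  shows "FF dvd p"
proof -
  obtain r s where p: "p = r + FF * s" "reduced r" using normal_form by blast
  have "bev x z r = 0" if "(x, z) \<in> A - B" for x z
    using assms(2)[OF that] that by (auto simp: p ev_FF[OF coef_hom_id] A_def)
  then have "r = 0" using assms(1) p(2) by (intro reduced_vanish)
  then show ?thesis using p by simp
qed

text \<open>The transfer principle: what holds at the points of the curve holds for every solution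
  of its equation in any commutative ring receiving the field, in particular for series.\<close>

lemma vanish_ev:
  assumes "finite B" "\<And>x z. (x, z) \<in> A - B \<Longrightarrow> bev x z p = 0"
    and "coef_hom h" "u ^ d + v ^ d = (v + 1) ^ d"
  shows "ev h u v p = 0"
  using dvd_vanish vanish_imp_dvd assms by metis

text \<open>Modulo d the weight is -i.\<close>

lemma weight_inj:
  assumes "i < d" "i' < d" "i * (d - 1) + d * j = i' * (d - 1) + d * j'"
  shows "i = i'"
proof -
  obtain e where e: "d = Suc e" using d4 by (cases d) auto
  have "i' + d * (i + j) = i + d * (i' + j')"
    using assms(3) by (simp add: e algebra_simps)
  then have "(i' + d * (i + j)) mod d = (i + d * (i' + j')) mod d" by simp
  then show ?thesis using assms by simp
qed

text \<open>The summands for different i have different orders by \<open>weight_inj\<close>, so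
  leading terms cannot cancel. The factor m is carried along for the series to which an automorphism
  sends the standard expansion; that it equals 1 is a result, not an input.\<close>

lemma ev_fls_subdegree:
  fixes U V :: "'a fls"
  assumes m: "m > 0" and U: "fls_subdegree U = - int (m * (d - 1))"
    and V: "fls_subdegree V = - int (m * d)" and r: "reduced r" "r \<noteq> 0"
  defines "w \<equiv> \<lambda>i. i * (d - 1) + d * Polynomial.degree (poly.coeff r i)"
  shows "ev fls_const U V r \<noteq> 0 \<and>
    (\<exists>i<d. poly.coeff r i \<noteq> 0 \<and> fls_subdegree (ev fls_const U V r) = - int (m * w i)) \<and>
    (\<forall>i. poly.coeff r i \<noteq> 0 \<longrightarrow> fls_subdegree (ev fls_const U V r) \<le> - int (m * w i))"
proof -
  have Un: "U \<noteq> 0" using U m d4 by auto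
  have Vn: "fls_subdegree V < 0" using V m d4 by simp
  define f where "f = (\<lambda>i. poly (map_poly fls_const (poly.coeff r i)) V * U ^ i)"
  define I where "I = {i. i < d \<and> poly.coeff r i \<noteq> 0}"
  have I: "i \<in> I \<longleftrightarrow> poly.coeff r i \<noteq> 0" for i
    using r by (auto simp: I_def reduced_def intro: not_le_imp_less)
  have s: "ev fls_const U V r = sum f I"
    unfolding fls_hom.ev_altdef f_def
    by (rule sum.mono_neutral_right) (auto simp: I le_degree)
  have f0: "f i \<noteq> 0" "fls_subdegree (f i) = - int (m * w i)" if "i \<in> I" for i
  proof -
    note c = fls_subdegree_poly[OF Vn, of "poly.coeff r i"]
    show "f i \<noteq> 0" using c that Un by (simp add: f_def I)
    have "fls_subdegree (f i) = int (Polynomial.degree (poly.coeff r i)) * fls_subdegree V + int i * fls_subdegree U"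
      using c that Un by (simp add: f_def I fls_subdegree_pow)
    also have "\<dots> = - int (m * w i)"
      unfolding U V w_def by (simp only: of_nat_mult of_nat_add distrib_left minus_add_distrib mult_minus_right mult_ac add.commute)
    finally show "fls_subdegree (f i) = - int (m * w i)" .
  qed
  have "Polynomial.degree r \<in> I" using r(2) by (simp add: I)
  then have "I \<noteq> {}" by blast
  have "inj_on (\<lambda>i. fls_subdegree (f i)) I"
    using m weight_inj by (auto simp: inj_on_def f0 I_def w_def simp del: of_nat_mult of_nat_add)
  moreover have "finite I" by (simp add: I_def)
  ultimately have *: "sum f I \<noteq> 0 \<and> (\<exists>i\<in>I. fls_subdegree (sum f I) = fls_subdegree (f i)) \<and>
      (\<forall>i\<in>I. fls_subdegree (sum f I) \<le> fls_subdegree (f i))"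
    using \<open>I \<noteq> {}\<close> f0(1) by (intro fls_sum_distinct_subdegrees)
  then obtain i where "i \<in> I" "fls_subdegree (sum f I) = - int (m * w i)"
    using f0(2) by auto
  moreover from this(1) have "i < d" "poly.coeff r i \<noteq> 0" by (simp_all add: I_def)
  moreover have "fls_subdegree (sum f I) \<le> - int (m * w j)" if "poly.coeff r j \<noteq> 0" for j
    using * f0(2)[of j] I[of j] that by auto
  ultimately show ?thesis using * unfolding s by blast
qed

text \<open>With z = t^(-d) the equation becomes x^d = t^(-d * d) * ((1 + t^d)^d - 1). A factor t^d
  splits off, and the cofactor \<open>G\<close>, a geometric sum, has constant term d and hence a
  d-th root; so x has order -(d - 1).\<close>

lemma infinity_exists:
  "\<exists>U V :: 'a fls. fls_subdegree U = - int (d - 1) \<and> fls_subdegree V = - int d \<and> U ^ d + V ^ d = (V + 1) ^ d"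
proof -
  define T :: "'a fps" where "T = fps_X ^ d"
  define G where "G = (\<Sum>i<d. (1 + T) ^ i)"
  have TG: "T * G = (1 + T) ^ d - 1"
    unfolding G_def by (subst power_diff_1_eq) simp
  have T0: "fps_nth T 0 = 0" using d4 by (simp add: T_def fps_X_power_nth)
  have G0: "fps_nth G 0 = of_nat d"
    by (simp add: G_def fps_sum_nth fps_power_zeroth T0)
  obtain a :: 'a where a: "a ^ d = of_nat d"
    using nth_root_exists[of d "of_nat d"] d4 by auto
  have "a \<noteq> 0" using a d_nz d4 by (auto simp: power_0_left)
  then obtain Y where Y: "fps_nth Y 0 = a" "Y ^ d = G"
    using hensel_root[of a d G] a G0 d_nz by auto
  define V :: "'a fls" where "V = fls_X_inv ^ d"
  define U where "U = fls_X_inv ^ (d - 1) * fps_to_fls Y"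
  have VT: "V * fps_to_fls T = 1"
    by (simp add: V_def T_def fps_to_fls_power fls_X_inv_times_conv_shift flip: power_mult_distrib)
  have Y0: "Y \<noteq> 0" "subdegree Y = 0" using Y \<open>a \<noteq> 0\<close> by auto
  have "fls_subdegree U = - int (d - 1)"
    using Y0 by (simp add: U_def fls_subdegree_fls_to_fps)
  moreover have "fls_subdegree V = - int d" by (simp add: V_def)
  moreover have "U ^ d + V ^ d = (V + 1) ^ d"
  proof -
    have "V ^ d = V ^ (d - 1) * V" using d4 by (metis power_minus_mult not_numeral_le_zero gr0I)
    then have "V ^ d * fps_to_fls T = V ^ (d - 1)" using VT by (simp add: mult.assoc)
    moreover have "U ^ d = V ^ (d - 1) * fps_to_fls G"
    proof -
      have "U ^ d = (fls_X_inv ^ (d - 1)) ^ d * fps_to_fls (Y ^ d)"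
        unfolding U_def by (simp only: power_mult_distrib fps_to_fls_power)
      also have "(fls_X_inv ^ (d - 1)) ^ d = V ^ (d - 1)"
        unfolding V_def by (simp only: power_mult[symmetric] mult.commute)
      finally show ?thesis by (simp only: Y(2))
    qed
    ultimately have "U ^ d = V ^ d * fps_to_fls (T * G)"
      by (simp add: fls_times_fps_to_fls mult.assoc)
    also have "\<dots> = V ^ d * (1 + fps_to_fls T) ^ d - V ^ d"
      unfolding TG by (simp add: fps_to_fls_power right_diff_distrib)
    also have "V ^ d * (1 + fps_to_fls T) ^ d = (V + 1) ^ d"
      using VT by (simp add: algebra_simps flip: power_mult_distrib)
    finally show ?thesis by simp
  qed
  ultimately show ?thesis by blast
qed

text \<open>Primality: substituting the expansion at infinity embeds the coordinate ring into a
  field of Laurent series.\<close>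

lemma FF_dvd_mult: "FF dvd p * q \<longleftrightarrow> FF dvd p \<or> FF dvd q"
proof
  assume pq: "FF dvd p * q"
  obtain U V :: "'a fls" where UV: "fls_subdegree U = - int (d - 1)" "fls_subdegree V = - int d"
    "U ^ d + V ^ d = (V + 1) ^ d"
    using infinity_exists by blast
  have "ev fls_const U V (p * q) = 0"
    using pq UV(3) dvd_vanish coef_hom_fls_const by blast
  then have "ev fls_const U V p = 0 \<or> ev fls_const U V q = 0" by simp
  moreover have "FF dvd p" if "ev fls_const U V p = 0" for p
  proof -
    obtain r s where p: "p = r + FF * s" "reduced r" using normal_form by blast
    then have "ev fls_const U V r = 0"
      using that UV by (simp add: ev_FF[OF coef_hom_fls_const])
    then have "r = 0"
      using ev_fls_subdegree[of 1 U V r] UV p by auto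
    then show ?thesis using p by simp
  qed
  ultimately show "FF dvd p \<or> FF dvd q" by blast
qed auto

end

section \<open>Regular functions\<close>

text \<open>The polynomials t with F dividing t * R form an ideal, generated by an element of least
  degree. The generator divides F, and by the local condition it vanishes at no root of F, so it is
  constant.\<close>

lemma dvd_of_local_dvd:
  fixes F R :: "'a::alg_closed_field poly"
  assumes "F \<noteq> 0" and loc: "\<And>x. poly F x = 0 \<Longrightarrow> \<exists>t. poly t x \<noteq> 0 \<and> F dvd t * R"
  shows "F dvd R"
proof -
  define J where "J = {t. t \<noteq> 0 \<and> F dvd t * R}"
  have "F \<in> J" using assms by (simp add: J_def)
  then obtain j where j: "j \<in> J" and jmin: "\<And>t. t \<in> J \<Longrightarrow> Polynomial.degree j \<le> Polynomial.degree t"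
    using ex_has_least_nat[of "\<lambda>t. t \<in> J" F Polynomial.degree] by blast
  have dvdJ: "j dvd t" if "F dvd t * R" for t
  proof (rule ccontr)
    assume "\<not> j dvd t"
    then have n0: "t mod j \<noteq> 0" by (simp add: dvd_eq_mod_eq_0)
    have "t mod j * R = t * R - (t div j) * (j * R)"
      by (simp add: minus_div_mult_eq_mod[symmetric] algebra_simps)
    then have "t mod j \<in> J"
      using n0 that j by (auto simp: J_def intro!: dvd_diff dvd_mult)
    then have "Polynomial.degree j \<le> Polynomial.degree (t mod j)" by (rule jmin)
    then show False
      using degree_mod_less[of j t] n0 j by (auto simp: J_def)
  qed
  show ?thesis
  proof (cases "Polynomial.degree j = 0")
    case True
    then obtain c where "j = [:c:]" by (rule degree_eq_zeroE)
    then show ?thesis using j by (auto simp: J_def dvd_smult_iff)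
  next
    case False
    then obtain x where x: "poly j x = 0" using alg_closed_imp_poly_has_root by blast
    have "j dvd F" by (rule dvdJ) simp
    then have "poly F x = 0" using x by (auto simp: dvd_def)
    then obtain t where "poly t x \<noteq> 0" "F dvd t * R" using loc by blast
    with dvdJ[of t] x show ?thesis by (auto simp: dvd_def)
  qed
qed

section \<open>Roots of unity acting on x, norms, and denominators in z alone\<close>

context fermat
begin

definition mu :: "'a set" where "mu = {\<zeta>. \<zeta> ^ d = 1}"

lemma card_mu: "card mu = d"
  unfolding mu_def using d_nz by (intro card_nth_roots) auto

lemma finite_mu: "finite mu"
  using card_mu d4 by (metis card.infinite not_numeral_le_zero)

text \<open>X^j - 1 has at most j < d roots, while \<open>mu\<close> has d elements.\<close>

lemma mu_nontrivial:
  assumes "0 < j" "j < d"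
  shows "\<exists>\<eta>\<in>mu. \<eta> ^ j \<noteq> 1"
proof (rule ccontr)
  assume c: "\<not> ?thesis"
  define p :: "'a poly" where "p = Polynomial.monom 1 j - 1"
  have cp: "poly.coeff p i = (if i = j then 1 else 0) - (if i = 0 then 1 else 0)" for i
    by (simp add: p_def)
  have "Polynomial.degree p \<le> j" using assms by (intro degree_le) (auto simp: cp)
  then have "p = 0"
    using assms c by (intro poly_eq_0_if_many_roots[OF finite_mu]) (auto simp: card_mu p_def poly_monom)
  moreover have "poly.coeff p j = 1" using assms by (simp add: cp)
  ultimately show False by simp
qed

definition conj_x :: "'a \<Rightarrow> 'a poly poly \<Rightarrow> 'a poly poly" where
  "conj_x \<zeta> p = pcompose p [:0, [:\<zeta>:]:]"

lemma coeff_conj_x: "poly.coeff (conj_x \<zeta> p) i = smult (\<zeta> ^ i) (poly.coeff p i)"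
proof -
  have "coef_hom (\<lambda>c :: 'a. [:c:])" by unfold_locales simp_all
  then have "[:\<zeta>:] ^ i = [:\<zeta> ^ i:]" by (rule coef_hom.power[symmetric])
  then show ?thesis by (simp add: conj_x_def coeff_pcompose_linear)
qed

lemma dvd_bev: "FF dvd p \<Longrightarrow> (x, z) \<in> A \<Longrightarrow> bev x z p = 0"
  using dvd_vanish[OF _ coef_hom_id, of p x z] by (simp add: A_def)

lemma ev_conj_x:
  assumes "coef_hom h"
  shows "ev h u v (conj_x \<zeta> p) = ev h (h \<zeta> * u) v p"
proof (induction p)
  case 0
  then show ?case using assms by (simp add: conj_x_def coef_hom.ev_simps)
next
  case (pCons a p)
  have 1: "pCons a q = [:a:] + xx * q" for a q by (simp add: xx_def)
  have 2: "conj_x \<zeta> (pCons a p) = [:a:] + cc \<zeta> * xx * conj_x \<zeta> p"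
    by (simp add: conj_x_def pcompose_pCons cc_def xx_def)
  show ?case unfolding 2 using pCons assms
    by (subst 1) (simp add: coef_hom.ev_simps coef_hom.ev_gens coef_hom.ev_const mult_ac)
qed

lemma A_mu: "\<zeta> \<in> mu \<Longrightarrow> (\<zeta> * x, z) \<in> A \<longleftrightarrow> (x, z) \<in> A"
  by (simp add: A_iff mu_def power_mult_distrib)

lemma FF_dvd_prod: "finite I \<Longrightarrow> FF dvd (\<Prod>i\<in>I. f i) \<Longrightarrow> \<exists>i\<in>I. FF dvd f i"
proof (induction rule: finite_induct)
  case empty
  then have "bev x z 1 = 0" if "(x, z) \<in> A" for x z
    using that by (intro dvd_bev) simp
  moreover have "(0, (0::'a)) \<in> A \<or> (1, 0) \<in> A"
    using d4 by (auto simp: A_def power_0_left)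
  ultimately show ?case by auto
qed (auto simp: FF_dvd_mult)

text \<open>The norm from \<open>k(x,z)\<close> to \<open>k(z)\<close> is the product over the conjugates
  \<open>x \<mapsto> \<zeta>x\<close>; it only involves powers of \<open>x^d\<close>.\<close>

lemma norm_exists:
  assumes s: "\<not> FF dvd s"
  shows "\<exists>N t. N \<noteq> 0 \<and> (\<forall>(x, z)\<in>A. poly N z = bev x z (s * t))"
proof -
  define PP where "PP = (\<Prod>\<zeta>\<in>mu. conj_x \<zeta> s)"
  have "1 \<in> mu" by (simp add: mu_def)
  have conj1: "conj_x 1 s = s" by (rule poly_eqI) (simp add: coeff_conj_x)
  have PPs: "PP = s * (\<Prod>\<zeta>\<in>mu - {1}. conj_x \<zeta> s)"
    unfolding PP_def using \<open>1 \<in> mu\<close> finite_mu by (subst prod.remove[of _ 1]) (simp_all add: conj1)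
  \<comment> \<open>Replacing x by \<eta> * x merely permutes the factors; hence the exponents of x
    in the product are multiples of d.\<close>
  have inv: "conj_x \<eta> PP = PP" if eta: "\<eta> \<in> mu" for \<eta>
  proof -
    have "\<eta> \<noteq> 0" using eta d4 by (auto simp: mu_def power_0_left)
    have "conj_x \<eta> (conj_x \<zeta> s) = conj_x (\<eta> * \<zeta>) s" for \<zeta>
      by (rule poly_eqI) (simp add: coeff_conj_x power_mult_distrib)
    moreover have "conj_x \<eta> (prod f mu) = (\<Prod>\<zeta>\<in>mu. conj_x \<eta> (f \<zeta>))" for f
      by (simp add: conj_x_def pcompose_prod)
    ultimately have "conj_x \<eta> PP = (\<Prod>\<zeta>\<in>mu. conj_x (\<eta> * \<zeta>) s)"
      by (simp add: PP_def)
    also have "\<dots> = PP"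
      unfolding PP_def
      by (rule prod.reindex_bij_witness[of _ "\<lambda>\<zeta>. \<zeta> / \<eta>" "\<lambda>\<zeta>. \<eta> * \<zeta>"])
         (use eta \<open>\<eta> \<noteq> 0\<close> in \<open>auto simp: mu_def power_mult_distrib power_divide\<close>)
    finally show ?thesis .
  qed
  have coeff0: "poly.coeff PP i = 0" if i: "\<not> d dvd i" for i
  proof -
    obtain \<eta> where e: "\<eta> \<in> mu" "\<eta> ^ (i mod d) \<noteq> 1"
      using mu_nontrivial[of "i mod d"] i d4 by (auto simp: dvd_eq_mod_eq_0)
    have "\<eta> ^ i = (\<eta> ^ d) ^ (i div d) * \<eta> ^ (i mod d)"
      by (metis mult_div_mod_eq power_add power_mult)
    then have "\<eta> ^ i \<noteq> 1" using e by (simp add: mu_def)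
    moreover have "smult (\<eta> ^ i) (poly.coeff PP i) = poly.coeff PP i"
      using inv[OF e(1)] by (metis coeff_conj_x)
    then have "smult (\<eta> ^ i - 1) (poly.coeff PP i) = 0"
      by (simp add: smult_diff_left)
    ultimately show ?thesis by simp
  qed
  \<comment> \<open>On the curve x^d may be replaced by g(z).\<close>
  define N where "N = (\<Sum>i | i \<le> Polynomial.degree PP \<and> d dvd i. poly.coeff PP i * gp ^ (i div d))"
  have N: "poly N z = bev x z PP" if "(x, z) \<in> A" for x z
  proof -
    have "bev x z PP = (\<Sum>i\<le>Polynomial.degree PP. poly (poly.coeff PP i) z * x ^ i)"
      by (simp add: id_hom.ev_altdef map_poly_idI)
    also have "\<dots> = (\<Sum>i | i \<le> Polynomial.degree PP \<and> d dvd i. poly (poly.coeff PP i) z * x ^ i)"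
      by (rule sum.mono_neutral_right) (auto simp: coeff0)
    also have "\<dots> = poly N z"
      unfolding N_def poly_sum
    proof (rule sum.cong, goal_cases)
      case (2 i)
      then have "x ^ i = (x ^ d) ^ (i div d)" by (simp flip: power_mult)
      then show ?case using that by (simp add: A_iff)
    qed simp
    finally show ?thesis ..
  qed
  \<comment> \<open>If the norm were 0, primality of \<open>FF\<close> would make some conjugate of
    s vanish on the curve, and then s itself, because the curve is stable under x \<mapsto> \<zeta>
    * x.\<close>
  have "N \<noteq> 0"
  proof
    assume "N = 0"
    then have "bev x z PP = 0" if "(x, z) \<in> A" for x z using N[OF that] by simp
    then have "FF dvd PP" using vanish_imp_dvd[of "{}"] by blast
    then obtain \<zeta> where z: "\<zeta> \<in> mu" "FF dvd conj_x \<zeta> s"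
      unfolding PP_def using FF_dvd_prod[OF finite_mu] by blast
    then have z0: "\<zeta> \<noteq> 0" using d4 by (auto simp: mu_def power_0_left)
    have "bev x z s = 0" if "(x, z) \<in> A" for x z
    proof -
      have a: "(x / \<zeta>, z) \<in> A" using A_mu[OF z(1), of "x / \<zeta>" z] that z0 by simp
      have "bev (x / \<zeta>) z (conj_x \<zeta> s) = 0"
        by (rule dvd_vanish[OF z(2) coef_hom_id]) (use a in \<open>simp add: A_def\<close>)
      then show ?thesis using z0 by (simp add: ev_conj_x[OF coef_hom_id])
    qed
    then show False using s vanish_imp_dvd[of "{}"] by blast
  qed
  then show ?thesis using N unfolding PPs by blast
qed

lemma FF_not_dvd_const: "c \<noteq> 0 \<Longrightarrow> \<not> FF dvd [:c:]"
proof
  assume c: "c \<noteq> 0" and "FF dvd [:c:]"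
  then have "bev x z [:c:] = 0" if "(x, z) \<in> A" for x z
    using that by (intro dvd_bev) simp
  moreover have "reduced [:c:]"
    using d4 by (auto simp: reduced_def coeff_pCons split: nat.split)
  ultimately have "[:c:] = 0" by (intro reduced_vanish[of _ "{}"]) auto
  then show False using c by simp
qed

text \<open>At a root \<open>z\<close> of a denominator \<open>N(z)\<close> of minimal degree, the local representations force the
  numerator to vanish on the whole fibre, so that a factor can be cancelled.\<close>

lemma regular_global:
  assumes S: "S \<subseteq> A" "finite (A - S)" "S \<noteq> {}"
    and loc: "\<And>x z. (x, z) \<in> S \<Longrightarrow> \<exists>s p. bev x z s \<noteq> 0 \<and> (\<forall>(x', z')\<in>S. bev x' z' s * f x' z' = bev x' z' p)"
  shows "\<exists>N r. N \<noteq> 0 \<and> reduced r \<and> (\<forall>(x, z)\<in>S. poly N z * f x z = bev x z r) \<and>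
    (\<forall>z. poly N z = 0 \<longrightarrow> (\<exists>x. (x, z) \<in> A - S))"
proof -
  define Q where "Q = (\<lambda>N. N \<noteq> 0 \<and> (\<exists>r. \<forall>(x, z)\<in>S. poly N z * f x z = bev x z r))"
  have van: "FF dvd p" if "\<And>x z. (x, z) \<in> S \<Longrightarrow> bev x z p = 0" for p
    using that S by (intro vanish_imp_dvd[of "A - S"]) auto
  have "\<exists>N. Q N"
  proof -
    obtain x z where xz: "(x, z) \<in> S" using S(3) by auto
    then obtain s p where sp: "bev x z s \<noteq> 0" "\<forall>(x', z')\<in>S. bev x' z' s * f x' z' = bev x' z' p"
      using loc by blast
    have "\<not> FF dvd s" using sp(1) xz S dvd_bev by blast
    \<comment> \<open>The norm turns one local denominator in x and z into a global one in
      z.\<close>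
    then obtain N t where N: "N \<noteq> 0" "\<forall>(x, z)\<in>A. poly N z = bev x z (s * t)"
      using norm_exists by blast
    have "poly N z * f x z = bev x z (t * p)" if "(x, z) \<in> S" for x z
    proof -
      have "poly N z = bev x z s * bev x z t" using N(2) that S(1) by auto
      moreover have "bev x z s * f x z = bev x z p" using sp(2) that by auto
      ultimately show ?thesis by (simp add: mult_ac)
    qed
    then have "\<forall>(x, z)\<in>S. poly N z * f x z = bev x z (t * p)" by blast
    then show ?thesis using N(1) unfolding Q_def by blast
  qed
  then obtain N where N: "Q N" and Nmin: "\<And>N'. Q N' \<Longrightarrow> Polynomial.degree N \<le> Polynomial.degree N'"
    using ex_has_least_nat[of Q _ Polynomial.degree] by blast
  then obtain r0 where r0: "\<forall>(x, z)\<in>S. poly N z * f x z = bev x z r0" by (auto simp: Q_def)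
  obtain r s where r: "r0 = r + FF * s" "reduced r" using normal_form by blast
  have Nr: "poly N z * f x z = bev x z r" if "(x, z) \<in> S" for x z
  proof -
    have "bev x z (FF * s) = 0" using that S(1) by (intro dvd_bev) auto
    moreover have "poly N z * f x z = bev x z r0" using r0 that by auto
    ultimately show ?thesis unfolding r(1) by simp
  qed
  have "\<exists>x. (x, z0) \<in> A - S" if root: "poly N z0 = 0" for z0
  proof (rule ccontr)
    assume "\<nexists>x. (x, z0) \<in> A - S"
    then have fib: "(x, z0) \<in> S" if "(x, z0) \<in> A" for x using that by blast
    obtain N' where N': "N = [:-z0, 1:] * N'" using root by (auto simp: poly_eq_0_iff_dvd)
    interpret h: coef_hom "\<lambda>c. poly c z0" by unfold_locales simp_all
    \<comment> \<open>Specialization of z to z0, giving polynomials in x on the fibre.\<close>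
    define sp where "sp = map_poly (\<lambda>c. poly c z0)"
    have spm: "sp (p * q) = sp p * sp q" for p q by (simp add: sp_def h.map_poly_mult)
    have spev: "poly (sp p) x = bev x z0 p" for p x by (simp add: sp_def bev_altdef)
    have local_rel: "FF dvd s * r - [:N:] * p"
      if "\<forall>(x', z')\<in>S. bev x' z' s * f x' z' = bev x' z' p" for s p
    proof (rule van)
      fix x z assume xz: "(x, z) \<in> S"
      then have "bev x z s * f x z = bev x z p" using that by auto
      then show "bev x z (s * r - [:N:] * p) = 0"
        using Nr[OF xz] by (simp add: map_poly_idI mult.left_commute flip: Nr[OF xz])
    qed
    \<comment> \<open>At each point of the fibre some s is nonzero, and s * r is congruent to a
      multiple of N, which is 0 at z0. Gluing these local statements yields divisibility with
      multiplicities, also over branch points.\<close>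
    have "sp FF dvd sp r"
    proof (rule dvd_of_local_dvd)
      have "poly.coeff (sp FF) d = 1" by (simp add: sp_def coeff_map_poly FF_coeff)
      then show "sp FF \<noteq> 0" by auto
      fix x assume "poly (sp FF) x = 0"
      then have "(x, z0) \<in> A" by (simp add: spev ev_FF[OF coef_hom_id] A_def)
      then have "(x, z0) \<in> S" by (rule fib)
      then obtain s p where s: "bev x z0 s \<noteq> 0" "\<forall>(x', z')\<in>S. bev x' z' s * f x' z' = bev x' z' p"
        using loc by blast
      then obtain w where w: "s * r - [:N:] * p = FF * w" using local_rel[OF s(2)] unfolding dvd_def by blast
      then have "s * r = FF * w + [:N:] * p" by (simp add: algebra_simps)
      then have "sp (s * r) = sp FF * sp w + sp [:N:] * sp p"
        by (simp add: spm[symmetric]) (simp add: sp_def h.map_poly_add)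
      moreover have "sp [:N:] = 0" using root by (simp add: sp_def map_poly_pCons)
      ultimately have "sp FF dvd sp s * sp r" by (simp add: spm)
      then show "\<exists>t. poly t x \<noteq> 0 \<and> sp FF dvd t * sp r" using s(1) spev by metis
    qed
    have "sp r = 0"
    proof (rule ccontr)
      assume nz: "sp r \<noteq> 0"
      have "Polynomial.degree (sp r) < d"
        using r(2) d4 nz by (intro degree_lessI) (auto simp: sp_def coeff_map_poly reduced_def)
      moreover have "d \<le> Polynomial.degree (sp FF)"
        by (intro le_degree) (simp add: sp_def coeff_map_poly FF_coeff)
      ultimately show False using dvd_imp_degree_le[OF \<open>sp FF dvd sp r\<close> nz] by simp
    qed
    then have "poly (poly.coeff r i) z0 = 0" for i
      by (metis coeff_0 coeff_map_poly h.zero sp_def)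
    then have "[:[:-z0, 1:]:] dvd r"
      by (simp add: const_poly_dvd_iff poly_eq_0_iff_dvd)
    then obtain r' where r': "r = [:[:-z0, 1:]:] * r'" by (auto simp: dvd_def)
    \<comment> \<open>On the fibre over z0 the factor z - z0 is 0 and cannot be cancelled pointwise;
      it is cancelled in the relation modulo the prime \<open>FF\<close>.\<close>
    have "poly N' z * f x z = bev x z r'" if xz: "(x, z) \<in> S" for x z
    proof -
      obtain s p where s: "bev x z s \<noteq> 0" "\<forall>(x', z')\<in>S. bev x' z' s * f x' z' = bev x' z' p"
        using loc xz by blast
      have "s * r - [:N:] * p = [:[:-z0, 1:]:] * (s * r' - [:N':] * p)"
      proof -
        have "[:[:-z0, 1:] * N':] = [:[:-z0, 1:]:] * [:N':]" by simp
        then show ?thesis unfolding r' N' by (simp only: right_diff_distrib mult.assoc mult.left_commute)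
      qed
      then have "FF dvd [:[:-z0, 1:]:] * (s * r' - [:N':] * p)"
        using local_rel[OF s(2)] by argo
      moreover have "\<not> FF dvd [:[:-z0, 1:]:]" by (rule FF_not_dvd_const) simp
      ultimately have "FF dvd s * r' - [:N':] * p" unfolding FF_dvd_mult by blast
      then have "bev x z (s * r' - [:N':] * p) = 0"
        using xz S dvd_bev by blast
      moreover have "bev x z s * f x z = bev x z p" using s(2) xz by auto
      ultimately have "bev x z s * bev x z r' = poly N' z * (bev x z s * f x z)"
        by (simp add: map_poly_idI)
      then show ?thesis using s(1) by (simp add: mult_ac)
    qed
    then have "\<forall>(x, z)\<in>S. poly N' z * f x z = bev x z r'" by blast
    moreover have "N' \<noteq> 0" using N N' by (auto simp: Q_def)
    ultimately have "Q N'" unfolding Q_def by blast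
    then have "Polynomial.degree N \<le> Polynomial.degree N'" by (rule Nmin)
    moreover have "Polynomial.degree N = Suc (Polynomial.degree N')"
      using \<open>N' \<noteq> 0\<close> unfolding N' by (subst degree_mult_eq) auto
    ultimately show False by simp
  qed
  moreover have "\<forall>(x, z)\<in>S. poly N z * f x z = bev x z r" using Nr by blast
  moreover have "N \<noteq> 0" using N by (simp add: Q_def)
  ultimately show ?thesis using r(2) by blast
qed

end

section \<open>Substitutions, pole orders of forms at the flex, and regular functions\<close>

lemma coeff_linear_poly_power':
  fixes a b :: "'a::comm_ring_1"
  shows "poly.coeff ([:a, b:] ^ n) i = of_nat (n choose i) * b ^ i * a ^ (n - i)"
proof (cases "i \<le> n")
  case False
  have "Polynomial.degree ([:a, b:] ^ n) \<le> Polynomial.degree [:a, b:] * n" by (rule degree_power_le)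
  also have "\<dots> \<le> 1 * n" by (intro mult_le_mono1) simp
  finally show ?thesis using False by (simp add: coeff_eq_0 binomial_eq_0)
qed (simp add: coeff_linear_poly_power)

lemma poly_map_comp:
  assumes "coef_hom h" "coef_hom \<phi>"
  shows "\<phi> (poly (map_poly h c) v) = poly (map_poly (\<lambda>c. \<phi> (h c)) c) (\<phi> v)"
proof -
  interpret h: coef_hom h by fact
  interpret p: coef_hom \<phi> by fact
  show ?thesis
    by (induction c) (simp_all add: map_poly_pCons h.zero p.zero p.add p.mult)
qed

lemma (in coef_hom) ev_pCons: "ev h u v (pCons a p) = poly (map_poly h a) v + u * ev h u v p"
proof -
  have "pCons a p = [:a:] + xx * p" by (simp add: xx_def)
  then show ?thesis by simp
qed

lemma coef_hom_ev_comp: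
  assumes "coef_hom h" "coef_hom \<phi>"
  shows "\<phi> (ev h u v p) = ev (\<lambda>c. \<phi> (h c)) (\<phi> u) (\<phi> v) p"
proof -
  interpret h: coef_hom h by fact
  interpret p: coef_hom \<phi> by fact
  interpret ph: coef_hom "\<lambda>c. \<phi> (h c)"
    by unfold_locales (simp_all add: h.zero h.one h.add h.mult p.zero p.one p.add p.mult)
  show ?thesis
    by (induction p)
       (simp_all add: h.ev_pCons ph.ev_pCons p.zero p.add p.mult poly_map_comp[OF assms])
qed

lemma coef_hom_cc: "coef_hom (cc :: 'a::comm_ring_1 \<Rightarrow> 'a poly poly)"
  by unfold_locales (simp_all add: cc_def one_pCons)

lemma ev_substitute:
  assumes "coef_hom h"
  shows "ev h u v (ev cc r s w) = ev h (ev h u v r) (ev h u v s) w"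
  using coef_hom_ev_comp[OF coef_hom_cc coef_hom_ev[OF assms], of u v r s w]
  by (simp add: coef_hom.ev_gens[OF assms])

text \<open>If \<open>p\<close> is the dehomogenization of a form of degree \<open>n\<close>, then \<open>top_coeff n p\<close> is the value of
  this form at \<open>(0:1:0)\<close>.\<close>

definition tot :: "nat \<Rightarrow> 'a::comm_ring_1 poly poly \<Rightarrow> bool" where
  "tot n p \<longleftrightarrow> (\<forall>i j. i + j > n \<longrightarrow> poly.coeff (poly.coeff p i) j = 0)"

definition top_coeff :: "nat \<Rightarrow> 'a::comm_ring_1 poly poly \<Rightarrow> 'a" where
  "top_coeff n p = poly.coeff (poly.coeff p 0) n"

lemma tot_degree:
  assumes "tot n p" "poly.coeff p i \<noteq> 0"
  shows "i + Polynomial.degree (poly.coeff p i) \<le> n"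
  using assms by (force simp: tot_def not_le[symmetric])

context fermat
begin

text \<open>The identity s * f = p is required on all of S, also where s vanishes. So it can be
  transferred to series by \<open>vanish_ev\<close> without keeping track of neighbourhoods.\<close>

definition regular_on :: "('a \<times> 'a) set \<Rightarrow> ('a \<Rightarrow> 'a \<Rightarrow> 'a) \<Rightarrow> bool" where
  "regular_on S f \<longleftrightarrow> (\<forall>(x, z)\<in>S. \<exists>s p. bev x z s \<noteq> 0 \<and>
     (\<forall>(x', z')\<in>S. bev x' z' s * f x' z' = bev x' z' p))"

lemma fiber_exists: "\<exists>x. (x, z) \<in> A"
  using nth_root_exists[of d "poly gp z"] d4 by (auto simp: A_iff)

lemma finite_fiber: "finite {x. (x, z) \<in> A}"
proof -
  have "Polynomial.degree (Polynomial.monom (1::'a) d) = d" by (simp add: degree_monom_eq)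
  then have "Polynomial.degree (Polynomial.monom 1 d - [:poly gp z:]) = d"
    using d4 by (subst diff_conv_add_uminus, subst degree_add_eq_left) auto
  then have "Polynomial.monom 1 d - [:poly gp z:] \<noteq> 0" using d4 by auto
  then have "finite {x. poly (Polynomial.monom 1 d - [:poly gp z:]) x = 0}"
    by (rule poly_roots_finite)
  then show ?thesis by (simp add: A_iff poly_monom)
qed

lemma infinite_A: "infinite A" and infinite_A': "infinite {P \<in> A. snd P \<noteq> b}"
proof -
  have "UNIV - {b} \<subseteq> snd ` {P \<in> A. snd P \<noteq> b}" using fiber_exists by force
  moreover have "infinite (UNIV - {b} :: 'a set)" using infinite_UNIV_alg_closed by simp
  ultimately show "infinite {P \<in> A. snd P \<noteq> b}" by (meson finite_imageI finite_subset)
  then show "infinite A" by (rule infinite_super[rotated]) auto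
qed

text \<open>A monomial x^i z^j with i + j \<le> n has pole order at most m * (n * d - i), so order m
  * n * d can only come from z^n. Thus \<open>top_coeff\<close> detects whether a form is nonzero at
  the flex.\<close>

lemma ev_tot:
  fixes U V :: "'a fls"
  assumes m: "m > 0" and U: "fls_subdegree U = - int (m * (d - 1))"
    and V: "fls_subdegree V = - int (m * d)" and p: "tot n p"
  shows "ev fls_const U V p \<noteq> 0 \<Longrightarrow> fls_subdegree (ev fls_const U V p) \<ge> - int (m * n * d)"
    and "top_coeff n p \<noteq> 0 \<Longrightarrow>
      ev fls_const U V p \<noteq> 0 \<and> fls_subdegree (ev fls_const U V p) = - int (m * n * d)"
proof -
  have Un: "U \<noteq> 0" using U m d4 by auto
  have Vn: "fls_subdegree V < 0" using V m d4 by simp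
  define f where "f = (\<lambda>i. poly (map_poly fls_const (poly.coeff p i)) V * U ^ i)"
  have s: "ev fls_const U V p = (\<Sum>i\<le>Polynomial.degree p. f i)"
    unfolding fls_hom.ev_altdef f_def ..
  have nth: "fls_nth (sum f J) k = (\<Sum>j\<in>J. fls_nth (f j) k)" for J k
    by (induction J rule: infinite_finite_induct) auto
  have sub: "f i \<noteq> 0 \<and> fls_subdegree (f i) =
      - int (m * (d * Polynomial.degree (poly.coeff p i) + i * (d - 1)))"
    if "poly.coeff p i \<noteq> 0" for i
  proof -
    note c = fls_subdegree_poly[OF Vn, of "poly.coeff p i"]
    have "fls_subdegree (f i) = int (Polynomial.degree (poly.coeff p i)) * fls_subdegree V + int i * fls_subdegree U"
      using c that Un by (simp add: f_def fls_subdegree_pow)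
    also have "\<dots> = - int (m * (d * Polynomial.degree (poly.coeff p i) + i * (d - 1)))"
      unfolding U V by (simp only: of_nat_mult of_nat_add distrib_left minus_add_distrib mult_minus_right mult_ac)
    finally show ?thesis using c that Un by (simp add: f_def)
  qed
  have low: "fls_nth (f i) k = 0" if k: "k < - int (m * n * d) + int (m * i)" for i k
  proof (cases "poly.coeff p i = 0")
    case False
    have "i + Polynomial.degree (poly.coeff p i) \<le> n" using p False by (rule tot_degree)
    then have "d * (i + Polynomial.degree (poly.coeff p i)) \<le> n * d" by (simp add: mult.commute)
    moreover have "i * (d - 1) + i = d * i" using d4 by (cases d) auto
    ultimately have "d * Polynomial.degree (poly.coeff p i) + i * (d - 1) + i \<le> n * d"
      by (simp add: distrib_left)
    then have "m * (d * Polynomial.degree (poly.coeff p i) + i * (d - 1) + i) \<le> m * (n * d)"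
      by (rule mult_le_mono2)
    then have "int (m * (d * Polynomial.degree (poly.coeff p i) + i * (d - 1))) + int (m * i) \<le> int (m * n * d)"
      by (simp only: distrib_left mult.assoc flip: of_nat_add)
    then show ?thesis
      using sub[OF False] k by (intro fls_eq0_below_subdegree) linarith
  qed (simp add: f_def)
  have low0: "fls_nth (ev fls_const U V p) k = 0" if "k < - int (m * n * d)" for k
    unfolding s nth using that by (intro sum.neutral ballI low) (simp add: order.strict_trans2)
  show "fls_subdegree (ev fls_const U V p) \<ge> - int (m * n * d)" if "ev fls_const U V p \<noteq> 0"
    using that low0 by (intro fls_subdegree_geI)
  assume t: "top_coeff n p \<noteq> 0"
  then have c0: "poly.coeff p 0 \<noteq> 0" by (auto simp: top_coeff_def)
  have "Polynomial.degree (poly.coeff p 0) = n"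
    using tot_degree[OF p c0] t le_degree by (fastforce simp: top_coeff_def)
  then have f0: "fls_nth (f 0) (- int (m * n * d)) \<noteq> 0"
    using sub[OF c0] nth_fls_subdegree_nonzero[of "f 0"] by (simp add: mult_ac)
  have "fls_nth (ev fls_const U V p) (- int (m * n * d)) = fls_nth (f 0) (- int (m * n * d))"
    unfolding s nth
  proof (subst sum.remove[of _ 0])
    have "fls_nth (f i) (- int (m * n * d)) = 0" if "i \<noteq> 0" for i
      using that m by (intro low) simp
    then show "fls_nth (f 0) (- int (m * n * d)) +
        (\<Sum>j\<in>{..Polynomial.degree p} - {0}. fls_nth (f j) (- int (m * n * d))) = fls_nth (f 0) (- int (m * n * d))"
      by simp
  qed auto
  then have nz: "fls_nth (ev fls_const U V p) (- int (m * n * d)) \<noteq> 0" using f0 by simp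
  then show "ev fls_const U V p \<noteq> 0 \<and> fls_subdegree (ev fls_const U V p) = - int (m * n * d)"
    using low0 by (auto intro: fls_subdegree_eqI)
qed

lemma degree_gp: "Polynomial.degree gp = d - 1"
proof (intro antisym degree_le le_degree allI impI)
  show "poly.coeff gp i = 0" if "d - 1 < i" for i
    using that d4 by (cases "i = d") (simp_all add: gp_def coeff_linear_poly_power')
  show "poly.coeff gp (d - 1) \<noteq> 0"
    using d4 d_nz binomial_symmetric[of 1 d] by (simp add: gp_def coeff_linear_poly_power)
qed

text \<open>As g has degree d - 1, comparing orders in U^d = g(V) gives d * ord U = (d - 1) * ord V;
  the number m is ord U - ord V.\<close>

lemma curve_fls_subdegree:
  fixes U V :: "'a fls"
  assumes UV: "U ^ d + V ^ d = (V + 1) ^ d" and V: "fls_subdegree V < 0"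
  shows "\<exists>m>0. fls_subdegree U = - int (m * (d - 1)) \<and> fls_subdegree V = - int (m * d)"
proof -
  have "U ^ d = poly (map_poly fls_const gp) V"
  proof -
    have "poly (map_poly fls_const gp) V = ev fls_const U V [:gp:]" by simp
    also have "[:gp:] = xx ^ d - FF" by (simp add: FF_altdef monom_altdef xx_def)
    also have "ev fls_const U V (xx ^ d - FF) = U ^ d"
      using UV by (simp add: ev_FF[OF coef_hom_fls_const])
    finally show ?thesis by simp
  qed
  then have U0: "U ^ d \<noteq> 0" and e: "fls_subdegree (U ^ d) = int (d - 1) * fls_subdegree V"
    using fls_subdegree_poly[OF V gp_nz] by (simp_all add: degree_gp)
  define k where "k = fls_subdegree U - fls_subdegree V"
  have "int d * fls_subdegree U = (int d - 1) * fls_subdegree V"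
    using e d4 by (simp add: fls_subdegree_pow)
  then have 1: "fls_subdegree V = - int d * k" by (simp add: k_def algebra_simps)
  then have 2: "fls_subdegree U = - (int d - 1) * k" by (simp add: k_def algebra_simps)
  have "k > 0" using V 1 by (simp add: zero_less_mult_iff)
  then have "fls_subdegree U = - int (nat k * (d - 1))" "fls_subdegree V = - int (nat k * d)"
    using 1 2 d4 by (simp_all add: algebra_simps of_nat_diff)
  then show ?thesis using \<open>k > 0\<close> by (intro exI[of _ "nat k"]) simp
qed

text \<open>Modulo \<open>FF\<close> only reduced polynomials occur, and their orders are multiples
  of m. Finding elements with coprime orders in the ring generated by U and V will force m =
  1.\<close>

lemma ev_fls_subdegree_dvd:
  fixes U V :: "'a fls"
  assumes UV: "U ^ d + V ^ d = (V + 1) ^ d" and m: "m > 0"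
    and U: "fls_subdegree U = - int (m * (d - 1))" and V: "fls_subdegree V = - int (m * d)"
  shows "int m dvd fls_subdegree (ev fls_const U V w)"
proof -
  obtain r s where w: "w = r + FF * s" "reduced r" using normal_form by blast
  have e: "ev fls_const U V w = ev fls_const U V r"
    using UV by (simp add: w ev_FF[OF coef_hom_fls_const])
  show ?thesis
  proof (cases "r = 0")
    case False
    then show ?thesis
      using ev_fls_subdegree[OF m U V w(2)] unfolding e by auto
  qed (simp add: e)
qed

lemma regular_on_global:
  assumes "regular_on S f" "S \<subseteq> A" "finite (A - S)"
  shows "\<exists>N r. N \<noteq> 0 \<and> reduced r \<and> (\<forall>(x, z)\<in>S. poly N z * f x z = bev x z r) \<and>
    (\<forall>z. poly N z = 0 \<longrightarrow> (\<exists>x. (x, z) \<in> A - S))"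
proof (rule regular_global)
  show "S \<noteq> {}" using infinite_A assms(3) by auto
  show "\<exists>s p. bev x z s \<noteq> 0 \<and> (\<forall>(x', z')\<in>S. bev x' z' s * f x' z' = bev x' z' p)"
    if "(x, z) \<in> S" for x z
    using bspec[OF assms(1)[unfolded regular_on_def] that] by simp
qed fact+

text \<open>With no point removed, the global denominator has no zero and is constant.\<close>

lemma regular_on_A:
  assumes "regular_on A f"
  shows "\<exists>r. reduced r \<and> (\<forall>(x, z)\<in>A. f x z = bev x z r)"
proof -
  obtain N r where N: "N \<noteq> 0" "reduced r" "\<forall>(x, z)\<in>A. poly N z * f x z = bev x z r"
    "\<forall>z. poly N z = 0 \<longrightarrow> (\<exists>x. (x, z) \<in> A - A)"
    using regular_on_global[OF assms] by auto
  then have "\<not> Polynomial.degree N > 0" using alg_closed_imp_poly_has_root[of N] by auto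
  then obtain c where c: "N = [:c:]" by (auto elim: degree_eq_zeroE)
  then have "c \<noteq> 0" using N by auto
  define r' where "r' = smult [:1 / c:] r"
  have "f x z = bev x z r'" if "(x, z) \<in> A" for x z
  proof -
    have "c * f x z = bev x z r" using N(3) that by (auto simp: c)
    then show ?thesis using \<open>c \<noteq> 0\<close> by (simp add: r'_def map_poly_idI field_simps)
  qed
  moreover have "reduced r'" using N(2) by (simp add: reduced_def r'_def)
  ultimately show ?thesis by blast
qed

end

section \<open>Automorphisms fixing a flex\<close>

context fermat
begin

lemma choose2_nz: "of_nat (d choose 2) \<noteq> (0::'a)"
proof
  assume "of_nat (d choose 2) = (0::'a)"
  moreover have "even (d * (d - 1))" by (cases d) auto
  then have "2 * (d choose 2) = d * (d - 1)" by (simp add: choose_two)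
  then have "2 * of_nat (d choose 2) = (of_nat d * of_nat (d - 1) :: 'a)"
    by (metis of_nat_mult of_nat_numeral)
  ultimately show False using d_nz d1_nz by simp
qed

text \<open>Comparing the coefficients of \<open>z^(d-1)\<close>, \<open>z^(d-2)\<close>, \<open>z^(d-3)\<close> leaves only the
  identity and the reflection of \<open>z\<close>.\<close>

lemma affine_linear_automorphism:
  fixes \<alpha> \<beta> \<gamma> \<delta> e :: 'a
  assumes \<alpha>: "\<alpha> \<noteq> 0" and \<delta>: "\<delta> \<noteq> 0"
    and eq: "\<And>x z. (x, z) \<in> A \<Longrightarrow>
      (e + \<delta> * x) ^ d + (\<gamma> + \<alpha> * z + \<beta> * x) ^ d = (\<gamma> + 1 + \<alpha> * z + \<beta> * x) ^ d"
  shows "\<beta> = 0 \<and> e = 0 \<and> (\<gamma> = 0 \<and> \<alpha> = 1 \<and> \<delta> ^ d = 1 \<or> \<gamma> = -1 \<and> \<alpha> = -1 \<and> \<delta> ^ d = (-1) ^ (d - 1))"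
proof -
  \<comment> \<open>The assumed equation minus \<delta>^d times \<open>FF\<close>: this removes x^d,
    so that \<open>p\<close> is reduced and must vanish identically, not just on the curve.\<close>
  define p :: "'a poly poly" where
    "p = [:[:e:], [:\<delta>:]:] ^ d - [:[:\<delta> ^ d:]:] * xx ^ d + [:smult (\<delta> ^ d) gp:]
      + [:[:\<gamma>, \<alpha>:], [:\<beta>:]:] ^ d - [:[:\<gamma> + 1, \<alpha>:], [:\<beta>:]:] ^ d"
  have const_pow: "[:c:] ^ n = [:c ^ n:]" for c :: 'a and n
    by (induction n) (simp_all add: one_pCons)
  have xxd: "poly.coeff (xx ^ d) i = (if i = d then 1 else 0)" for i
    by (simp add: xx_def flip: monom_altdef[of 1, simplified])
  have cp: "poly.coeff p i = of_nat (d choose i) * [:\<delta> ^ i * e ^ (d - i):]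
      - (if i = d then [:\<delta> ^ d:] else 0) + (if i = 0 then smult (\<delta> ^ d) gp else 0)
      + of_nat (d choose i) * ([:\<beta> ^ i:] * ([:\<gamma>, \<alpha>:] ^ (d - i) - [:\<gamma> + 1, \<alpha>:] ^ (d - i)))" for i
  proof -
    have 1: "poly.coeff [:c:] i = (if i = 0 then c else 0)" for c :: "'a poly"
      by (simp add: coeff_pCons split: nat.split)
    show ?thesis
      unfolding p_def coeff_add coeff_diff coeff_linear_poly_power' 1
      by (simp add: xxd const_pow algebra_simps)
  qed
  have "reduced p"
    unfolding reduced_def
  proof safe
    fix i assume "d \<le> i"
    then show "poly.coeff p i = 0"
      unfolding cp using d4 by (cases "i = d") (simp_all add: binomial_eq_0)
  qed
  moreover have "bev x z p = 0" if "(x, z) \<in> A" for x z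
  proof -
    have lin: "bev x z [:q, r:] = poly q z + x * poly r z" for q r
      by (simp add: id_hom.ev_pCons map_poly_idI)
    have "bev x z p = (e + \<delta> * x) ^ d - \<delta> ^ d * x ^ d + \<delta> ^ d * poly gp z
        + (\<gamma> + \<alpha> * z + \<beta> * x) ^ d - (\<gamma> + 1 + \<alpha> * z + \<beta> * x) ^ d"
      unfolding p_def
      by (simp add: lin map_poly_idI mult.commute del: pCons_0_0) 
    then show ?thesis using eq[OF that] that by (simp add: A_iff)
  qed
  ultimately have "p = 0" by (intro reduced_vanish[of p "{}"]) auto
  then have cp0: "of_nat (d choose i) * [:\<delta> ^ i * e ^ (d - i):]
      - (if i = d then [:\<delta> ^ d:] else 0) + (if i = 0 then smult (\<delta> ^ d) gp else 0)
      + of_nat (d choose i) * ([:\<beta> ^ i:] * ([:\<gamma>, \<alpha>:] ^ (d - i) - [:\<gamma> + 1, \<alpha>:] ^ (d - i))) = 0" for i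
    unfolding cp[symmetric] \<open>p = 0\<close> by simp
  \<comment> \<open>Coefficient of x * z^(d - 2): the powers z^(d - 1) cancel and e contributes only
    to z^0, leaving -d * (d - 1) * \<alpha>^(d - 2) * \<beta>.\<close>
  have "\<beta> = 0"
  proof -
    have "of_nat d * ([:\<delta> * e ^ (d - 1):] + [:\<beta>:] * ([:\<gamma>, \<alpha>:] ^ (d - 1) - [:\<gamma> + 1, \<alpha>:] ^ (d - 1))) = 0"
      using cp0[of 1] d4 by (simp add: distrib_left)
    moreover have "of_nat d \<noteq> (0 :: 'a poly)" using d_nz by (simp add: of_nat_poly)
    ultimately have "[:\<delta> * e ^ (d - 1):] + [:\<beta>:] * ([:\<gamma>, \<alpha>:] ^ (d - 1) - [:\<gamma> + 1, \<alpha>:] ^ (d - 1)) = 0"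
      by (simp only: mult_eq_0_iff) blast
    then have "poly.coeff ([:\<delta> * e ^ (d - 1):] + [:\<beta>:] * ([:\<gamma>, \<alpha>:] ^ (d - 1) - [:\<gamma> + 1, \<alpha>:] ^ (d - 1))) (d - 2) = 0"
      by simp
    moreover have "poly.coeff [:\<delta> * e ^ (d - 1):] (d - 2) = 0"
      using d4 by (simp add: coeff_eq_0)
    moreover have "d - 1 - (d - 2) = 1" "d - 1 choose (d - 2) = d - 1"
      using d4 binomial_symmetric[of 1 "d - 1"] by (simp_all add: numeral_2_eq_2)
    ultimately have "\<beta> * (of_nat (d - 1) * \<alpha> ^ (d - 2)) = 0"
      by (simp add: coeff_linear_poly_power' algebra_simps)
    then show ?thesis using \<alpha> d1_nz by auto
  qed
  \<comment> \<open>Once \<beta> = 0, the coefficient of x^(d - 1) is d * \<delta>^(d - 1) *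
    e.\<close>
  moreover have "e = 0"
  proof -
    have "d - (d - 1) = 1" "d choose (d - 1) = d" "\<not> d \<le> 1"
      using d4 binomial_symmetric[of 1 d] by simp_all
    then have "of_nat d * [:\<delta> ^ (d - 1) * e:] = 0"
      using cp0[of "d - 1"] \<open>\<beta> = 0\<close> by (simp add: power_0_left)
    then show ?thesis using d_nz \<delta> by (auto simp: of_nat_poly)
  qed
  \<comment> \<open>The part free of x, at z^(d - k).\<close>
  moreover have main: "\<delta> ^ d * of_nat (d choose k) = of_nat (d choose k) * (\<alpha> ^ (d - k) * ((\<gamma> + 1) ^ k - \<gamma> ^ k))"
    if k: "1 \<le> k" "k < d" for k
  proof -
    have "smult (\<delta> ^ d) gp + ([:\<gamma>, \<alpha>:] ^ d - [:\<gamma> + 1, \<alpha>:] ^ d) = 0"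
      using cp0[of 0] \<open>e = 0\<close> d4 by (simp add: power_0_left one_pCons)
    then have "poly.coeff (smult (\<delta> ^ d) gp + ([:\<gamma>, \<alpha>:] ^ d - [:\<gamma> + 1, \<alpha>:] ^ d)) (d - k) = 0"
      by simp
    moreover have "d - (d - k) = k" "d choose (d - k) = d choose k" "(0::'a) ^ k = 0"
      using k binomial_symmetric[of k d] by simp_all
    ultimately show ?thesis
      by (simp add: gp_def coeff_linear_poly_power' algebra_simps)
  qed
  \<comment> \<open>For k = 1, 2, 3 the relation gives \<delta>^d = \<alpha>^(d - 1), \<alpha> = 2 *
    \<gamma> + 1 and \<alpha>^2 = 3 * \<gamma>^2 + 3 * \<gamma> + 1; together they say \<gamma> *
    (\<gamma> + 1) = 0.\<close>
  have m1: "\<delta> ^ d = \<alpha> ^ (d - 1)"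
    using main[of 1] d4 d_nz by simp
  have "\<delta> ^ d = \<alpha> ^ (d - 2) * (2 * \<gamma> + 1)"
  proof -
    have "(\<gamma> + 1) ^ 2 - \<gamma> ^ 2 = 2 * \<gamma> + 1"
      by (simp add: power2_eq_square algebra_simps)
    then show ?thesis using main[of 2] d4 choose2_nz by simp
  qed
  moreover have "\<alpha> ^ (d - 1) = \<alpha> ^ (d - 2) * \<alpha>"
  proof -
    have "d - 1 = Suc (d - 2)" using d4 by simp
    then show ?thesis by (simp only: power_Suc2)
  qed
  ultimately have \<alpha>1: "\<alpha> = 2 * \<gamma> + 1" using m1 \<alpha> by simp
  have "\<delta> ^ d = \<alpha> ^ (d - 3) * (3 * \<gamma> ^ 2 + 3 * \<gamma> + 1)"
  proof -
    have "(\<gamma> + 1) ^ 3 - \<gamma> ^ 3 = 3 * \<gamma> ^ 2 + 3 * \<gamma> + 1"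
      by (simp add: power3_eq_cube power2_eq_square algebra_simps)
    then show ?thesis using main[of 3] d4 d3_nz by simp
  qed
  moreover have "\<alpha> ^ (d - 1) = \<alpha> ^ (d - 3) * \<alpha> ^ 2"
  proof -
    have "d - 1 = d - 3 + 2" using d4 by simp
    then show ?thesis by (simp only: power_add)
  qed
  ultimately have "\<alpha> ^ 2 = 3 * \<gamma> ^ 2 + 3 * \<gamma> + 1" using m1 \<alpha> by simp
  then have "\<gamma> * (\<gamma> + 1) = 0"
    unfolding \<alpha>1 by (simp add: power2_eq_square algebra_simps)
  then have "\<gamma> = 0 \<or> \<gamma> = -1" by (simp add: eq_neg_iff_add_eq_0)
  then have "\<gamma> = 0 \<and> \<alpha> = 1 \<or> \<gamma> = -1 \<and> \<alpha> = -1" using \<alpha>1 by auto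
  then show ?thesis using m1 \<open>\<beta> = 0\<close> \<open>e = 0\<close> by auto
qed

theorem automorphism_fixing_flex:
  assumes reg: "regular_on A f" "regular_on A g" "regular_on A f'" "regular_on A g'"
    and maps: "\<And>x z. (x, z) \<in> A \<Longrightarrow> (f x z, g x z) \<in> A" "\<And>x z. (x, z) \<in> A \<Longrightarrow> (f' x z, g' x z) \<in> A"
    and inv: "\<And>x z. (x, z) \<in> A \<Longrightarrow> f' (f x z) (g x z) = x \<and> g' (f x z) (g x z) = z"
      "\<And>x z. (x, z) \<in> A \<Longrightarrow> g (f' x z) (g' x z) = z"
  shows "\<exists>\<delta>. (\<delta> ^ d = 1 \<and> (\<forall>(x, z)\<in>A. f x z = \<delta> * x \<and> g x z = z)) \<or>
    (\<delta> ^ d = (-1) ^ (d - 1) \<and> (\<forall>(x, z)\<in>A. f x z = \<delta> * x \<and> g x z = - z - 1))"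
proof -
  obtain rf where rf: "reduced rf" "\<forall>(x, z)\<in>A. f x z = bev x z rf" using regular_on_A reg(1) by blast
  obtain rg where rg: "reduced rg" "\<forall>(x, z)\<in>A. g x z = bev x z rg" using regular_on_A reg(2) by blast
  obtain sf where sf: "\<forall>(x, z)\<in>A. f' x z = bev x z sf" using regular_on_A reg(3) by blast
  obtain sg where sg: "\<forall>(x, z)\<in>A. g' x z = bev x z sg" using regular_on_A reg(4) by blast
  obtain U V :: "'a fls" where UV: "fls_subdegree U = - int (1 * (d - 1))" "fls_subdegree V = - int (1 * d)"
    "U ^ d + V ^ d = (V + 1) ^ d"
    using infinity_exists by auto
  define U' where "U' = ev fls_const U V rf"
  define V' where "V' = ev fls_const U V rg"
  have UV': "U' ^ d + V' ^ d = (V' + 1) ^ d"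
  proof -
    have "ev fls_const U V (rf ^ d + rg ^ d - (rg + 1) ^ d) = 0"
    proof (rule vanish_ev[of "{}", OF _ _ coef_hom_fls_const UV(3)])
      fix x z assume "(x, z) \<in> A - {}"
      then have xz: "(x, z) \<in> A" by simp
      have "f x z = bev x z rf" "g x z = bev x z rg" using rf(2) rg(2) xz by auto
      then show "bev x z (rf ^ d + rg ^ d - (rg + 1) ^ d) = 0"
        using maps(1)[OF xz] by (simp add: A_def)
    qed simp
    then show ?thesis by (simp add: U'_def V'_def)
  qed
  have nonconst: "\<not> (\<forall>(x, z)\<in>A. g x z = c)" for c
  proof
    assume c: "\<forall>(x, z)\<in>A. g x z = c"
    have "z = c" for z
    proof -
      obtain x where x: "(x, z) \<in> A" using fiber_exists by blast
      have "g (f' x z) (g' x z) = c" using c maps(2)[OF x] by auto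
      then show "z = c" using inv(2)[OF x] by simp
    qed
    from this[of 0] this[of 1] show False by simp
  qed
  have rg0: "rg \<noteq> 0" using nonconst[of 0] rg(2) by auto
  note wf = ev_fls_subdegree[OF zero_less_one UV(1,2), unfolded mult_1]
  \<comment> \<open>Without a pole all weights in the reduced polynomial would be 0 and g would be
    constant, although the inverse map makes it take every value.\<close>
  have "fls_subdegree V' < 0"
  proof (rule ccontr)
    assume c: "\<not> fls_subdegree V' < 0"
    have w: "i * (d - 1) + d * Polynomial.degree (poly.coeff rg i) = 0" if "poly.coeff rg i \<noteq> 0" for i
    proof -
      have "fls_subdegree V' \<le> - int (i * (d - 1) + d * Polynomial.degree (poly.coeff rg i))"
        using wf[OF rg(1) rg0] that unfolding V'_def by blast
      then show ?thesis using c by linarith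
    qed
    have z: "poly.coeff rg i = 0" if "i > 0" for i
      using w[of i] that d4 by auto
    have "Polynomial.degree (poly.coeff rg 0) = 0"
      using w[of 0] d4 by (cases "poly.coeff rg 0 = 0") auto
    then obtain c where "poly.coeff rg 0 = [:c:]" by (auto elim: degree_eq_zeroE)
    then have "rg = [:[:c:]:]"
      by (intro poly_eqI) (auto simp: coeff_pCons z split: nat.split)
    then have "bev x z rg = c" for x z by simp
    then show False using nonconst[of c] rg(2) by auto
  qed
  then obtain m where m: "m > 0" "fls_subdegree U' = - int (m * (d - 1))" "fls_subdegree V' = - int (m * d)"
    using curve_fls_subdegree[OF UV'] by blast
  \<comment> \<open>The inverse automorphism recovers the original series as polynomials in the new
    ones, so m divides both d - 1 and d.\<close>
  have backs: "ev fls_const U' V' sf = U" "ev fls_const U' V' sg = V"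
  proof -
    have *: "ev fls_const U' V' w = ev fls_const U V q"
      if "\<And>x z. (x, z) \<in> A \<Longrightarrow> bev (f x z) (g x z) w = bev x z q" for w q
    proof -
      have "ev fls_const U V (ev cc rf rg w - q) = 0"
      proof (rule vanish_ev[of "{}", OF _ _ coef_hom_fls_const UV(3)])
        fix x z assume "(x, z) \<in> A - {}"
        then have xz: "(x, z) \<in> A" by simp
        have "f x z = bev x z rf" "g x z = bev x z rg" using rf(2) rg(2) xz by auto
        then show "bev x z (ev cc rf rg w - q) = 0"
          using that[OF xz] by (simp add: ev_substitute[OF coef_hom_id])
      qed simp
      then show ?thesis by (simp add: ev_substitute[OF coef_hom_fls_const] U'_def V'_def)
    qed
    have "bev (f x z) (g x z) sf = bev x z xx" "bev (f x z) (g x z) sg = bev x z zz" if "(x, z) \<in> A" for x z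
      using sf sg maps(1)[OF that] inv(1)[OF that] by auto
    from *[OF this(1)] *[OF this(2)] show "ev fls_const U' V' sf = U" "ev fls_const U' V' sg = V"
      by simp_all
  qed
  have "int m dvd int (d - 1)" "int m dvd int d"
    using ev_fls_subdegree_dvd[OF UV' m, of sf] ev_fls_subdegree_dvd[OF UV' m, of sg] UV(1,2)
    unfolding backs by simp_all
  then have "int m dvd int d - int (d - 1)" by (intro dvd_diff)
  then have "m = 1" using d4 by (simp add: of_nat_diff)
  have sU: "fls_subdegree (ev fls_const U V rf) = - int (d - 1)" and sV: "fls_subdegree (ev fls_const U V rg) = - int d"
    using m \<open>m = 1\<close> by (simp_all add: U'_def V'_def)
  have rf0: "rf \<noteq> 0" using sU d4 by auto
  have wf_le: "i * (d - 1) + d * Polynomial.degree (poly.coeff rf i) \<le> d - 1" if "poly.coeff rf i \<noteq> 0" for i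
  proof -
    have "- int (d - 1) \<le> - int (i * (d - 1) + d * Polynomial.degree (poly.coeff rf i))"
      using wf[OF rf(1) rf0] that unfolding sU by blast
    then show ?thesis by linarith
  qed
  have wg_le: "i * (d - 1) + d * Polynomial.degree (poly.coeff rg i) \<le> d" if "poly.coeff rg i \<noteq> 0" for i
  proof -
    have "- int d \<le> - int (i * (d - 1) + d * Polynomial.degree (poly.coeff rg i))"
      using wf[OF rg(1) rg0] that unfolding sV by blast
    then show ?thesis by linarith
  qed
  \<comment> \<open>Already x^2 has pole order 2 * (d - 1) > d, so only 1, x and z can
    occur.\<close>
  have two: "2 * (d - 1) > d" using d4 by simp
  have ge2: "i * (d - 1) > d" if "i \<ge> 2" for i
    using that two by (meson less_le_trans mult_le_mono1)
  have f_hi: "poly.coeff rf i = 0" if "i \<ge> 2" for i using wf_le[of i] ge2[OF that] by fastforce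
  have g_hi: "poly.coeff rg i = 0" if "i \<ge> 2" for i using wg_le[of i] ge2[OF that] by fastforce
  have small: "d * n \<le> k \<Longrightarrow> k < d \<Longrightarrow> n = 0" for n k :: nat
    by (cases n) auto
  have f_deg: "Polynomial.degree (poly.coeff rf i) = 0" for i
    using wf_le[of i] d4 by (cases "poly.coeff rf i = 0") (auto intro: small[of _ "d - 1"])
  have g_deg1: "Polynomial.degree (poly.coeff rg 1) = 0"
    using wg_le[of 1] d4 by (cases "poly.coeff rg 1 = 0") (auto intro: small[of _ 1])
  have g_deg0: "Polynomial.degree (poly.coeff rg 0) \<le> 1"
    using wg_le[of 0] d4 by (cases "poly.coeff rg 0 = 0") auto
  obtain e where e: "poly.coeff rf 0 = [:e:]" using f_deg[of 0] by (auto elim: degree_eq_zeroE)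
  obtain \<delta> where \<delta>: "poly.coeff rf 1 = [:\<delta>:]" using f_deg[of 1] by (auto elim: degree_eq_zeroE)
  obtain \<beta> where \<beta>: "poly.coeff rg 1 = [:\<beta>:]" using g_deg1 by (auto elim: degree_eq_zeroE)
  obtain \<gamma> \<alpha> where \<gamma>: "poly.coeff rg 0 = [:\<gamma>, \<alpha>:]"
    using g_deg0 by (metis degree_eq_zeroE degree1_coeffs less_one linorder_not_le nat_less_le pCons_0_0 one_neq_zero pCons_eq_0_iff le_antisym)
  have lin: "p = [:poly.coeff p 0, poly.coeff p 1:]" if "\<And>i. i \<ge> 2 \<Longrightarrow> poly.coeff p i = 0" for p :: "'a poly poly"
  proof (rule poly_eqI)
    fix i :: nat
    consider "i = 0" | "i = 1" | j where "i = Suc (Suc j)" by (metis One_nat_def not0_implies_Suc)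
    then show "poly.coeff p i = poly.coeff [:poly.coeff p 0, poly.coeff p 1:] i"
      by cases (simp_all add: that)
  qed
  have rf': "rf = [:[:e:], [:\<delta>:]:]" using lin[OF f_hi] unfolding e \<delta> .
  have rg': "rg = [:[:\<gamma>, \<alpha>:], [:\<beta>:]:]" using lin[OF g_hi] unfolding \<gamma> \<beta> .
  have fx: "f x z = e + \<delta> * x" and gx: "g x z = \<gamma> + \<alpha> * z + \<beta> * x" if "(x, z) \<in> A" for x z
    using rf(2) rg(2) that unfolding rf' rg' by (auto simp: id_hom.ev_pCons map_poly_idI mult.commute)
  \<comment> \<open>The exact pole order is attained by some term; for \<delta> = 0 only a constant
    would be left.\<close>
  have "\<delta> \<noteq> 0"
  proof
    assume "\<delta> = 0"
    then have "\<forall>i. poly.coeff rf i \<noteq> 0 \<longrightarrow> i = 0" unfolding rf' by (auto simp: coeff_pCons split: nat.splits)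
    moreover obtain i where "poly.coeff rf i \<noteq> 0" "int (d - 1) = int (i * (d - 1) + d * Polynomial.degree (poly.coeff rf i))"
      using wf[OF rf(1) rf0] unfolding sU by auto
    ultimately show False using f_deg[of 0] d4 by auto
  qed
  \<comment> \<open>Without the term in z the pole order d would be a multiple of d - 1.\<close>
  have "\<alpha> \<noteq> 0"
  proof
    assume "\<alpha> = 0"
    then have dg: "Polynomial.degree (poly.coeff rg i) = 0" for i
      unfolding rg' by (auto simp: coeff_pCons split: nat.splits)
    obtain i where "poly.coeff rg i \<noteq> 0" "int d = int (i * (d - 1) + d * Polynomial.degree (poly.coeff rg i))"
      using wf[OF rg(1) rg0] unfolding sV by auto
    then have "d = i * (d - 1)" using dg[of i] by (simp only: mult_0_right add_0_right of_nat_eq_iff)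
    moreover have "i = 0 \<or> i = 1 \<or> i \<ge> 2" by linarith
    ultimately show False using ge2[of i] d4 by auto
  qed
  have "\<beta> = 0 \<and> e = 0 \<and> (\<gamma> = 0 \<and> \<alpha> = 1 \<and> \<delta> ^ d = 1 \<or> \<gamma> = -1 \<and> \<alpha> = -1 \<and> \<delta> ^ d = (-1) ^ (d - 1))"
  proof (rule affine_linear_automorphism[OF \<open>\<alpha> \<noteq> 0\<close> \<open>\<delta> \<noteq> 0\<close>])
    fix x z assume xz: "(x, z) \<in> A"
    show "(e + \<delta> * x) ^ d + (\<gamma> + \<alpha> * z + \<beta> * x) ^ d = (\<gamma> + 1 + \<alpha> * z + \<beta> * x) ^ d"
      using maps(1)[OF xz] fx[OF xz] gx[OF xz] by (simp add: A_def add_ac)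
  qed
  then show ?thesis using fx gx by (intro exI[of _ \<delta>]) auto
qed

end

section \<open>Expansions at an affine point\<close>

lemma poly_shift_fps:
  fixes b :: "'a::comm_ring_1"
  shows "poly (map_poly fps_const q) (fps_const b + fps_X) = fps_of_poly (pcompose q [:b, 1:])"
  by (induction q)
     (simp_all add: map_poly_pCons pcompose_pCons fps_of_poly_add fps_of_poly_mult fps_of_poly_pCons
       fps_of_poly_const distrib_right mult.commute)

context fermat
begin

text \<open>Replacing \<zeta> by \<eta> * \<zeta> leaves the sum unchanged but multiplies it by
  \<eta>^k, and some \<eta> has \<eta>^k \<noteq> 1 unless d divides k.\<close>

lemma sum_mu: "(\<Sum>\<zeta>\<in>mu. \<zeta> ^ k) = (if d dvd k then of_nat d else 0)"
proof (cases "d dvd k")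
  case True
  then have "\<zeta> ^ k = 1" if "\<zeta> \<in> mu" for \<zeta>
    using that by (auto simp: mu_def power_mult)
  then show ?thesis using True by (simp add: card_mu)
next
  case False
  then obtain \<eta> where e: "\<eta> \<in> mu" "\<eta> ^ (k mod d) \<noteq> 1"
    using mu_nontrivial[of "k mod d"] d4 by (auto simp: dvd_eq_mod_eq_0)
  have "\<eta> ^ k = (\<eta> ^ d) ^ (k div d) * \<eta> ^ (k mod d)"
    by (metis mult_div_mod_eq power_add power_mult)
  then have ne: "\<eta> ^ k \<noteq> 1" using e by (simp add: mu_def)
  have "\<eta> \<noteq> 0" using e d4 by (auto simp: mu_def power_0_left)
  have "(\<Sum>\<zeta>\<in>mu. \<zeta> ^ k) = (\<Sum>\<zeta>\<in>mu. (\<eta> * \<zeta>) ^ k)"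
    by (rule sum.reindex_bij_witness[of _ "\<lambda>\<zeta>. \<eta> * \<zeta>" "\<lambda>\<zeta>. \<zeta> / \<eta>"])
       (use e \<open>\<eta> \<noteq> 0\<close> in \<open>auto simp: mu_def power_mult_distrib power_divide\<close>)
  also have "\<dots> = \<eta> ^ k * (\<Sum>\<zeta>\<in>mu. \<zeta> ^ k)"
    by (simp only: power_mult_distrib sum_distrib_left)
  finally have "(\<Sum>\<zeta>\<in>mu. \<zeta> ^ k) = 0"
    using ne by (metis mult_cancel_right1)
  then show ?thesis using False by simp
qed

text \<open>Where a \<noteq> 0, the function z - b is a local parameter and x is the d-th root of
  g(z) with constant term a.\<close>

lemma local_branch:
  assumes "(a, b) \<in> A" "a \<noteq> 0"
  shows "\<exists>y :: 'a fps. fps_nth y 0 = a \<and> y ^ d + (fps_const b + fps_X) ^ d = (fps_const b + fps_X + 1) ^ d"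
proof -
  define G :: "'a fps" where "G = (fps_const b + fps_X + 1) ^ d - (fps_const b + fps_X) ^ d"
  have "a ^ d = fps_nth G 0"
    using assms by (simp add: G_def A_def fps_power_zeroth algebra_simps)
  then obtain y where "fps_nth y 0 = a" "y ^ d = G"
    using hensel_root[of a d G] assms d_nz by blast
  then show ?thesis by (auto simp: G_def)
qed

end

text \<open>The series \<open>y\<close> expands x in powers of z - b. The other points over b have
  the expansions \<zeta> * y, all with the same parameter, which makes Fourier inversion over
  \<open>mu\<close> possible.\<close>

locale fermat_branch = fermat d eps for d and eps :: "'a::alg_closed_field" +
  fixes a b :: 'a and y :: "'a fps"
  assumes ab: "(a, b) \<in> A" and a_nz: "a \<noteq> 0" and y0: "fps_nth y 0 = a"
    and y_curve: "y ^ d + (fps_const b + fps_X) ^ d = (fps_const b + fps_X + 1) ^ d"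
begin

definition S :: "('a \<times> 'a) set" where "S = A - {(a, b)}"

text \<open>Power series expansion at the point \<open>(\<zeta>a, b)\<close> in the parameter \<open>z - b\<close>.\<close>

definition expn :: "'a \<Rightarrow> 'a poly poly \<Rightarrow> 'a fps" where
  "expn \<zeta> = ev fps_const (fps_const \<zeta> * y) (fps_const b + fps_X)"

definition tau :: "'a poly poly" where "tau = zz - cc b"

lemma bev_tau [simp]: "bev x z tau = z - b"
  by (simp add: tau_def)

lemma expn_simps [simp]:
  "expn \<zeta> (p + q) = expn \<zeta> p + expn \<zeta> q" "expn \<zeta> (p - q) = expn \<zeta> p - expn \<zeta> q"
  "expn \<zeta> (p * q) = expn \<zeta> p * expn \<zeta> q" "expn \<zeta> (p ^ n) = expn \<zeta> p ^ n"
  "expn \<zeta> tau = fps_X" "expn \<zeta> (cc c) = fps_const c" "expn \<zeta> zz = fps_const b + fps_X" "expn \<zeta> 1 = 1"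
  by (simp_all add: expn_def tau_def)

lemma expn_vanish:
  assumes "\<zeta> \<in> mu" "\<And>x z. (x, z) \<in> S \<Longrightarrow> bev x z p = 0"
  shows "expn \<zeta> p = 0"
  unfolding expn_def
proof (rule vanish_ev[of "{(a, b)}", OF _ _ coef_hom_fps_const])
  have "(fps_const \<zeta> * y) ^ d = y ^ d"
    using assms(1) by (simp add: power_mult_distrib fps_const_power mu_def)
  then show "(fps_const \<zeta> * y) ^ d + (fps_const b + fps_X) ^ d = (fps_const b + fps_X + 1) ^ d"
    using y_curve by simp
qed (use assms(2) in \<open>auto simp: S_def\<close>)

lemma expn_nth_0: "fps_nth (expn \<zeta> p) 0 = bev (\<zeta> * a) b p"
proof -
  have "coef_hom (\<lambda>f :: 'a fps. fps_nth f 0)" by unfold_locales simp_all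
  from coef_hom_ev_comp[OF coef_hom_fps_const this, of "fps_const \<zeta> * y" "fps_const b + fps_X" p]
  show ?thesis by (simp add: expn_def y0)
qed

text \<open>Taylor expansion of r_i(z) at b. It is still a polynomial, so lower bounds on its
  exponents from Q and upper bounds from infinity can be played off against each other.\<close>

definition coeff_at :: "'a poly poly \<Rightarrow> nat \<Rightarrow> 'a fps" where
  "coeff_at r i = fps_of_poly (pcompose (poly.coeff r i) [:b, 1:])"

lemma expn_reduced:
  assumes "reduced r"
  shows "expn \<zeta> r = (\<Sum>i<d. coeff_at r i * (fps_const (\<zeta> ^ i) * y ^ i))"
proof -
  have "expn \<zeta> r = (\<Sum>i\<le>Polynomial.degree r. coeff_at r i * (fps_const (\<zeta> ^ i) * y ^ i))"
    by (simp add: expn_def fps_hom.ev_altdef poly_shift_fps coeff_at_def power_mult_distrib fps_const_power)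
  also have "\<dots> = (\<Sum>i<d. coeff_at r i * (fps_const (\<zeta> ^ i) * y ^ i))"
  proof (rule sum.mono_neutral_cong)
    show "coeff_at r i * (fps_const (\<zeta> ^ i) * y ^ i) = 0" if "i \<in> {..Polynomial.degree r} - {..<d}" for i
      using that assms by (simp add: coeff_at_def reduced_def)
    show "coeff_at r i * (fps_const (\<zeta> ^ i) * y ^ i) = 0" if "i \<in> {..<d} - {..Polynomial.degree r}" for i
      using that by (simp add: coeff_at_def coeff_eq_0)
  qed auto
  finally show ?thesis .
qed

text \<open>Discrete Fourier inversion over the conjugate points: only the point \<open>\<zeta> = 1\<close> contributes a
  principal part.\<close>

lemma coefficients_from_pole:
  assumes r: "reduced r" and reg: "\<And>\<zeta>. \<zeta> \<in> mu - {1} \<Longrightarrow> fps_X ^ N dvd expn \<zeta> r" and i: "i < d"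
  shows "fps_X ^ N dvd fps_const (of_nat d) * (coeff_at r i * y ^ i) - expn 1 r"
proof -
  have one: "1 \<in> mu" by (simp add: mu_def)
  \<comment> \<open>The weight \<zeta>^(d - i) stands for \<zeta>^(-i).\<close>
  have "(\<Sum>\<zeta>\<in>mu. fps_const (\<zeta> ^ (d - i)) * expn \<zeta> r)
      = (\<Sum>\<zeta>\<in>mu. \<Sum>j<d. coeff_at r j * y ^ j * fps_const (\<zeta> ^ (d - i + j)))"
    unfolding expn_reduced[OF r] sum_distrib_left
    by (intro sum.cong refl) (simp add: power_add mult_ac flip: fps_const_mult)
  also have "\<dots> = (\<Sum>j<d. coeff_at r j * y ^ j * fps_const (\<Sum>\<zeta>\<in>mu. \<zeta> ^ (d - i + j)))"
    by (subst sum.swap) (simp add: sum_distrib_left fps_hom.sum)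
  also have "\<dots> = (\<Sum>j<d. if j = i then coeff_at r j * y ^ j * fps_const (of_nat d) else 0)"
  proof (intro sum.cong refl)
    fix j assume j: "j \<in> {..<d}"
    have "d dvd d - i + j \<longleftrightarrow> j = i"
    proof
      assume "d dvd d - i + j"
      then obtain k where k: "d - i + j = d * k" by (rule dvdE)
      have "0 < d * k" "d * k < d * 2" unfolding k[symmetric] using i j by auto
      then have "k = 1" using d4 by simp
      then show "j = i" using k i by simp
    qed (use i in simp)
    then show "coeff_at r j * y ^ j * fps_const (\<Sum>\<zeta>\<in>mu. \<zeta> ^ (d - i + j)) =
        (if j = i then coeff_at r j * y ^ j * fps_const (of_nat d) else 0)"
      by (simp add: sum_mu)
  qed
  also have "\<dots> = fps_const (of_nat d) * (coeff_at r i * y ^ i)"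
    using i by (simp add: mult_ac)
  finally have e: "(\<Sum>\<zeta>\<in>mu. fps_const (\<zeta> ^ (d - i)) * expn \<zeta> r) = fps_const (of_nat d) * (coeff_at r i * y ^ i)" .
  have "(\<Sum>\<zeta>\<in>mu. fps_const (\<zeta> ^ (d - i)) * expn \<zeta> r) =
      expn 1 r + (\<Sum>\<zeta>\<in>mu - {1}. fps_const (\<zeta> ^ (d - i)) * expn \<zeta> r)"
    using one finite_mu by (subst sum.remove[of _ 1]) simp_all
  then have "fps_const (of_nat d) * (coeff_at r i * y ^ i) - expn 1 r =
      (\<Sum>\<zeta>\<in>mu - {1}. fps_const (\<zeta> ^ (d - i)) * expn \<zeta> r)"
    unfolding e by simp
  also have "fps_X ^ N dvd \<dots>"
    using reg by (intro dvd_sum dvd_mult) auto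
  finally show ?thesis .
qed

text \<open>The global denominator can vanish only below the removed point, so after splitting off
  the power of z - b a constant remains.\<close>

lemma pole_form:
  assumes "regular_on S f"
  shows "\<exists>n r. reduced r \<and> (\<forall>(x, z)\<in>S. (z - b) ^ n * f x z = bev x z r)"
proof -
  have "S \<subseteq> A" by (auto simp: S_def)
  moreover have "finite (A - S)" by (rule finite_subset[of _ "{(a, b)}"]) (auto simp: S_def)
  ultimately obtain N r where N: "N \<noteq> 0" "reduced r" "\<forall>(x, z)\<in>S. poly N z * f x z = bev x z r"
    and roots: "\<forall>z. poly N z = 0 \<longrightarrow> (\<exists>x. (x, z) \<in> A - S)"
    using regular_on_global[OF assms] by blast
  obtain q where q: "N = [:-b, 1:] ^ Polynomial.order b N * q" "\<not> [:-b, 1:] dvd q"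
    using order_decomp[OF N(1)] by blast
  have "poly q z \<noteq> 0" for z
  proof
    assume "poly q z = 0"
    moreover from this have "poly N z = 0" by (subst q(1)) simp
    then have "z = b" using roots by (auto simp: S_def)
    ultimately show False using q(2) by (simp add: poly_eq_0_iff_dvd)
  qed
  then have "\<not> Polynomial.degree q > 0" using alg_closed_imp_poly_has_root[of q] by auto
  then obtain c where c: "q = [:c:]" by (auto elim: degree_eq_zeroE)
  then have "c \<noteq> 0" using q by auto
  define r' where "r' = smult [:1 / c:] r"
  have "(z - b) ^ Polynomial.order b N * f x z = bev x z r'" if "(x, z) \<in> S" for x z
  proof -
    have "poly N z * f x z = bev x z r" using N(3) that by auto
    moreover have "poly N z = (z - b) ^ Polynomial.order b N * c" by (subst q(1)) (simp add: c poly_power)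
    ultimately show ?thesis using \<open>c \<noteq> 0\<close> by (simp add: r'_def map_poly_idI field_simps)
  qed
  moreover have "reduced r'" using N(2) by (simp add: reduced_def r'_def)
  ultimately show ?thesis by blast
qed

lemma pole_form_raise:
  assumes "reduced r" "\<forall>(x, z)\<in>S. (z - b) ^ n * f x z = bev x z r" "n \<le> N"
  shows "\<exists>r. reduced r \<and> (\<forall>(x, z)\<in>S. (z - b) ^ N * f x z = bev x z r)"
proof (intro exI conjI ballI)
  let ?r = "smult ([:-b, 1:] ^ (N - n)) r"
  show "reduced ?r" using assms(1) by (simp add: reduced_def)
  have N: "(z - b) ^ N = (z - b) ^ (N - n) * (z - b) ^ n" for z
    using assms(3) by (simp flip: power_add)
  show "case P of (x, z) \<Rightarrow> (z - b) ^ N * f x z = bev x z ?r" if "P \<in> S" for P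
    using assms(2) that by (auto simp: N map_poly_idI poly_power mult.assoc)
qed

text \<open>At (\<zeta> * a, b) the denominator s is a unit among power series, so s * r = (z - b)^N
  * p can be divided by it.\<close>

lemma regular_at_conjugates:
  assumes f: "regular_on S f" and r: "\<forall>(x, z)\<in>S. (z - b) ^ N * f x z = bev x z r" and \<zeta>: "\<zeta> \<in> mu - {1}"
  shows "fps_X ^ N dvd expn \<zeta> r"
proof -
  have "(\<zeta> * a, b) \<in> S" using \<zeta> ab a_nz A_mu by (simp add: S_def)
  then obtain s p where s: "bev (\<zeta> * a) b s \<noteq> 0" "\<forall>(x', z')\<in>S. bev x' z' s * f x' z' = bev x' z' p"
    using f by (fastforce simp: regular_on_def)
  have "expn \<zeta> (s * r - tau ^ N * p) = 0"
  proof (rule expn_vanish)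
    fix x z assume xz: "(x, z) \<in> S"
    have "bev x z s * f x z = bev x z p" "(z - b) ^ N * f x z = bev x z r" using s(2) r xz by auto
    then show "bev x z (s * r - tau ^ N * p) = 0" by (simp add: mult.left_commute flip: \<open>_ = bev x z r\<close> \<open>_ = bev x z p\<close>)
  qed (use \<zeta> in simp)
  then have e: "expn \<zeta> s * expn \<zeta> r = fps_X ^ N * expn \<zeta> p" by simp
  have "fps_nth (expn \<zeta> s) 0 \<noteq> 0" using s(1) by (simp add: expn_nth_0)
  then have "inverse (expn \<zeta> s) * expn \<zeta> s = 1" by (rule inverse_mult_eq_1)
  then have "expn \<zeta> r = inverse (expn \<zeta> s) * expn \<zeta> s * expn \<zeta> r"
    by simp
  also have "\<dots> = fps_X ^ N * (inverse (expn \<zeta> s) * expn \<zeta> p)"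
    by (simp only: mult.assoc e mult.left_commute)
  finally have "expn \<zeta> r = fps_X ^ N * (inverse (expn \<zeta> s) * expn \<zeta> p)" .
  then show ?thesis by (rule dvdI)
qed

text \<open>Regularity at infinity: p has pole order at most n * d and s exactly n * d, so r has at
  most N * d. Thus i * (d - 1) + d * deg r_i \<le> N * d, and i < d allows rounding to i + deg r_i
  \<le> N.\<close>

lemma degree_bound:
  assumes r: "reduced r" "\<forall>(x, z)\<in>S. (z - b) ^ N * f x z = bev x z r"
    and s: "tot n s" "top_coeff n s \<noteq> 0" and p: "tot n p"
    and sp: "\<And>x z. (x, z) \<in> S \<Longrightarrow> bev x z s * f x z = bev x z p"
    and i: "poly.coeff r i \<noteq> 0"
  shows "i + Polynomial.degree (poly.coeff r i) \<le> N"
proof -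
  obtain U V :: "'a fls" where UV: "fls_subdegree U = - int (1 * (d - 1))" "fls_subdegree V = - int (1 * d)"
    "U ^ d + V ^ d = (V + 1) ^ d"
    using infinity_exists by auto
  have "ev fls_const U V (s * r - tau ^ N * p) = 0"
  proof (rule vanish_ev[of "{(a, b)}", OF _ _ coef_hom_fls_const UV(3)])
    fix x z assume "(x, z) \<in> A - {(a, b)}"
    then have xz: "(x, z) \<in> S" by (simp add: S_def)
    have "bev x z s * f x z = bev x z p" "(z - b) ^ N * f x z = bev x z r" using sp[OF xz] r(2) xz by auto
    then show "bev x z (s * r - tau ^ N * p) = 0" by (simp add: mult.left_commute flip: \<open>_ = bev x z r\<close> \<open>_ = bev x z p\<close>)
  qed simp
  then have e: "ev fls_const U V s * ev fls_const U V r = (V - fls_const b) ^ N * ev fls_const U V p"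
    by (simp add: tau_def)
  have "r \<noteq> 0" using i by auto
  note wr = ev_fls_subdegree[OF zero_less_one UV(1,2) r(1) \<open>r \<noteq> 0\<close>, unfolded mult_1]
  note ts = ev_tot(2)[OF zero_less_one UV(1,2) s, unfolded mult_1]
  have Vb: "fls_subdegree (V - fls_const b) = - int d" 
  proof -
    have "V \<noteq> 0" using UV d4 by auto
    then show ?thesis
      using UV(2) d4 fls_subdegree_diff_eq1[of V "fls_const b"] by simp
  qed
  have "ev fls_const U V s * ev fls_const U V r \<noteq> 0" using wr ts by simp
  then have p0: "ev fls_const U V p \<noteq> 0" "(V - fls_const b) ^ N \<noteq> 0" unfolding e by auto
  have "fls_subdegree (ev fls_const U V s) + fls_subdegree (ev fls_const U V r) =
      int N * (- int d) + fls_subdegree (ev fls_const U V p)"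
    using arg_cong[OF e, of fls_subdegree] wr ts p0 by (simp add: fls_subdegree_pow Vb)
  moreover have "fls_subdegree (ev fls_const U V p) \<ge> - int (n * d)"
    using ev_tot(1)[OF zero_less_one UV(1,2) p p0(1)] by simp
  moreover have "fls_subdegree (ev fls_const U V s) = - int (n * d)" using ts by blast
  moreover have "fls_subdegree (ev fls_const U V r) \<le> - int (i * (d - 1) + d * Polynomial.degree (poly.coeff r i))"
    using wr i by blast
  ultimately have "int (i * (d - 1) + d * Polynomial.degree (poly.coeff r i)) \<le> int (N * d)"
    by simp
  then have "i * (d - 1) + d * Polynomial.degree (poly.coeff r i) \<le> N * d"
    by (simp only: of_nat_le_iff)
  moreover have "i * (d - 1) + i = d * i" using d4 by (cases d) auto
  moreover have "i < d" using r(1) i by (meson not_le reduced_def)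
  ultimately have "i * (d - 1) + i + d * Polynomial.degree (poly.coeff r i) < N * d + d"
    by linarith
  then have "d * (i + Polynomial.degree (poly.coeff r i)) < d * (N + 1)"
    unfolding \<open>i * (d - 1) + i = d * i\<close> by (simp only: distrib_left mult.commute mult_1_right)
  then show ?thesis by (simp only: mult_less_cancel1) linarith
qed

text \<open>Laurent expansion at (a, b) of a function known only as values on \<open>S\<close>: a
  power of z - b clears the pole, and the resulting polynomial is expanded.\<close>

definition has_expn :: "('a \<Rightarrow> 'a \<Rightarrow> 'a) \<Rightarrow> 'a fls \<Rightarrow> bool" where
  "has_expn \<phi> F \<longleftrightarrow> (\<exists>M r. (\<forall>(x, z)\<in>S. (z - b) ^ M * \<phi> x z = bev x z r) \<and>
     fps_to_fls (expn 1 r) = fls_X ^ M * F)"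

lemma has_expn_poly: "has_expn (\<lambda>x z. bev x z r) (fps_to_fls (expn 1 r))"
  unfolding has_expn_def by (rule exI[of _ 0], rule exI[of _ r]) auto

lemma has_expn_add:
  assumes "has_expn \<phi> F" "has_expn \<psi> G"
  shows "has_expn (\<lambda>x z. \<phi> x z + \<psi> x z) (F + G)"
proof -
  obtain M r where M: "\<forall>(x, z)\<in>S. (z - b) ^ M * \<phi> x z = bev x z r" "fps_to_fls (expn 1 r) = fls_X ^ M * F"
    using assms(1) unfolding has_expn_def by blast
  obtain K s where K: "\<forall>(x, z)\<in>S. (z - b) ^ K * \<psi> x z = bev x z s" "fps_to_fls (expn 1 s) = fls_X ^ K * G"
    using assms(2) unfolding has_expn_def by blast
  have "(z - b) ^ (M + K) * (\<phi> x z + \<psi> x z) = bev x z (tau ^ K * r + tau ^ M * s)" if "(x, z) \<in> S" for x z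
  proof -
    have "(z - b) ^ M * \<phi> x z = bev x z r" "(z - b) ^ K * \<psi> x z = bev x z s" using M K that by auto
    then show ?thesis by (simp add: power_add algebra_simps flip: \<open>_ = bev x z r\<close> \<open>_ = bev x z s\<close>)
  qed
  moreover have "fps_to_fls (expn 1 (tau ^ K * r + tau ^ M * s)) = fls_X ^ (M + K) * (F + G)"
    by (simp add: fls_times_fps_to_fls fps_to_fls_power M(2) K(2) power_add algebra_simps)
  ultimately show ?thesis unfolding has_expn_def by blast
qed

lemma has_expn_mult:
  assumes "has_expn \<phi> F" "has_expn \<psi> G"
  shows "has_expn (\<lambda>x z. \<phi> x z * \<psi> x z) (F * G)"
proof -
  obtain M r where M: "\<forall>(x, z)\<in>S. (z - b) ^ M * \<phi> x z = bev x z r" "fps_to_fls (expn 1 r) = fls_X ^ M * F"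
    using assms(1) unfolding has_expn_def by blast
  obtain K s where K: "\<forall>(x, z)\<in>S. (z - b) ^ K * \<psi> x z = bev x z s" "fps_to_fls (expn 1 s) = fls_X ^ K * G"
    using assms(2) unfolding has_expn_def by blast
  have "(z - b) ^ (M + K) * (\<phi> x z * \<psi> x z) = bev x z (r * s)" if "(x, z) \<in> S" for x z
  proof -
    have "(z - b) ^ M * \<phi> x z = bev x z r" "(z - b) ^ K * \<psi> x z = bev x z s" using M K that by auto
    then show ?thesis by (simp add: power_add mult_ac flip: \<open>_ = bev x z r\<close> \<open>_ = bev x z s\<close>)
  qed
  moreover have "fps_to_fls (expn 1 (r * s)) = fls_X ^ (M + K) * (F * G)"
    by (simp add: fls_times_fps_to_fls M(2) K(2) power_add mult_ac)
  ultimately show ?thesis unfolding has_expn_def by blast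
qed

lemma has_expn_const: "has_expn (\<lambda>x z. c) (fls_const c)"
  using has_expn_poly[of "cc c"] by simp

text \<open>Identities between functions on \<open>S\<close> become identities of Laurent series; in
  this way F and G inherit the equation of the curve.\<close>

lemma has_expn_unique:
  assumes "has_expn \<phi> F" "has_expn \<psi> G" "\<And>x z. (x, z) \<in> S \<Longrightarrow> \<phi> x z = \<psi> x z"
  shows "F = G"
proof -
  obtain M r where M: "\<forall>(x, z)\<in>S. (z - b) ^ M * \<phi> x z = bev x z r" "fps_to_fls (expn 1 r) = fls_X ^ M * F"
    using assms(1) unfolding has_expn_def by blast
  obtain K s where K: "\<forall>(x, z)\<in>S. (z - b) ^ K * \<psi> x z = bev x z s" "fps_to_fls (expn 1 s) = fls_X ^ K * G"
    using assms(2) unfolding has_expn_def by blast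
  have "expn 1 (tau ^ K * r - tau ^ M * s) = 0"
  proof (rule expn_vanish)
    fix x z assume xz: "(x, z) \<in> S"
    have "(z - b) ^ M * \<phi> x z = bev x z r" "(z - b) ^ K * \<phi> x z = bev x z s" using M K xz assms(3)[OF xz] by auto
    then show "bev x z (tau ^ K * r - tau ^ M * s) = 0"
      by (simp add: mult.left_commute flip: \<open>_ = bev x z r\<close> \<open>_ = bev x z s\<close>)
  qed (simp add: mu_def)
  then have "fps_to_fls (fps_X ^ K * expn 1 r) = fps_to_fls (fps_X ^ M * expn 1 s)" by simp
  then show "F = G"
    by (simp add: fls_times_fps_to_fls fps_to_fls_power M(2) K(2) mult.left_commute[of "fls_X ^ K"])
qed

lemma has_expn_compose:
  assumes f: "has_expn f F" and g: "has_expn g G"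
  shows "has_expn (\<lambda>x z. bev (f x z) (g x z) w) (ev fls_const F G w)"
proof (induction w)
  case 0
  then show ?case using has_expn_const[of 0] by simp
next
  case (pCons q w)
  have q: "has_expn (\<lambda>x z. poly q (g x z)) (poly (map_poly fls_const q) G)"
  proof (induction q)
    case 0
    then show ?case using has_expn_const[of 0] by simp
  next
    case (pCons c q)
    then show ?case
      using has_expn_add[OF has_expn_const[of c] has_expn_mult[OF g pCons.IH]] by (simp add: map_poly_pCons)
  qed
  show ?case
    using has_expn_add[OF q has_expn_mult[OF f pCons.IH]]
    by (simp add: id_hom.ev_pCons fls_hom.ev_pCons map_poly_idI)
qed

end

section \<open>Excluding an image of the flex that is not a flex\<close>

lemma fps_X_power_dvd_iff:
  fixes h :: "'a::comm_ring_1 fps"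
  shows "fps_X ^ n dvd h \<longleftrightarrow> (\<forall>k<n. fps_nth h k = 0)"
proof
  assume "fps_X ^ n dvd h"
  then obtain q where "h = fps_X ^ n * q" by (rule dvdE)
  then show "\<forall>k<n. fps_nth h k = 0" by (simp add: fps_X_power_mult_nth)
next
  assume "\<forall>k<n. fps_nth h k = 0"
  then have "h = fps_X ^ n * fps_shift n h"
    by (intro fps_ext) (simp add: fps_X_power_mult_nth)
  then show "fps_X ^ n dvd h" by (rule dvdI)
qed

lemma fps_dvd_unit_mult:
  fixes u h :: "'a::field fps"
  assumes "fps_nth u 0 \<noteq> 0" "w dvd u * h"
  shows "w dvd h"
proof -
  have "h = inverse u * (u * h)"
    using inverse_mult_eq_1[OF assms(1)] by (simp add: mult.assoc[symmetric])
  then show ?thesis using assms(2) by (metis dvd_mult)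
qed

lemma dvd_power_diff:
  fixes x y :: "'a::comm_ring_1"
  shows "x - y dvd x ^ n - y ^ n"
proof (induction n)
  case (Suc n)
  have "x ^ Suc n - y ^ Suc n = x * (x ^ n - y ^ n) + (x - y) * y ^ n" by (simp add: algebra_simps)
  then show ?case using Suc by simp
qed simp

context fermat_branch
begin

text \<open>A vanishing second coefficient means contact of order 3 with the tangent line. The
  coefficients of exponent 0, 1, 2 in the equation of the curve rule this out when no coordinate of
  the point is 0.\<close>

lemma branch_curved:
  assumes b: "b \<noteq> 0" "b \<noteq> -1"
  shows "fps_nth y 2 \<noteq> 0"
proof
  assume y2: "fps_nth y 2 = 0"
  define a1 where "a1 = fps_nth y 1"
  have lin: "fps_of_poly [:c, e:] = fps_const c + fps_const e * fps_X" for c e :: 'a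
    by (simp add: fps_of_poly_pCons fps_of_poly_const)
  have "fps_X ^ 3 dvd y - fps_of_poly [:a, a1:]"
    unfolding fps_X_power_dvd_iff
  proof safe
    fix k :: nat assume "k < 3"
    then consider "k = 0" | "k = 1" | "k = 2" by linarith
    then show "fps_nth (y - fps_of_poly [:a, a1:]) k = 0"
      using y2 by cases (simp_all add: y0 a1_def numeral_2_eq_2)
  qed
  then have "fps_X ^ 3 dvd y ^ d - fps_of_poly [:a, a1:] ^ d"
    using dvd_power_diff dvd_trans by blast
  then have yd: "fps_nth (y ^ d) k = of_nat (d choose k) * (a1 ^ k * a ^ (d - k))" if "k < 3" for k
    using that unfolding fps_X_power_dvd_iff
    by (simp add: coeff_linear_poly_power' mult.assoc flip: fps_of_poly_power)
  have e: "of_nat (d choose k) * (a1 ^ k * a ^ (d - k) + b ^ (d - k) - (b + 1) ^ (d - k)) = 0" if "k < 3" for k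
  proof -
    have z1: "fps_const b + fps_X = fps_of_poly [:b, 1:]" by (simp add: lin)
    have z2: "fps_const b + fps_X + 1 = fps_of_poly [:b + 1, 1:]" by (simp add: lin flip: fps_const_add)
    have "fps_nth (y ^ d) k + fps_nth (fps_of_poly [:b, 1:] ^ d) k = fps_nth (fps_of_poly [:b + 1, 1:] ^ d) k"
      unfolding z1[symmetric] z2[symmetric] y_curve[symmetric] by simp
    then show ?thesis
      using that by (simp add: yd coeff_linear_poly_power' algebra_simps flip: fps_of_poly_power)
  qed
  \<comment> \<open>The relations \<open>e0\<close>, \<open>e1\<close>, \<open>e2\<close> say that
    the quadratic form p * X^2 + q * Y^2 - w * Z^2 vanishes on the span of (a, b, v) and (a1, 1, 1).
    With p, q, w nonzero it contains no such plane.\<close>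
  define p where "p = a ^ (d - 2)"
  define q where "q = b ^ (d - 2)"
  define w where "w = (b + 1) ^ (d - 2)"
  define v where "v = b + 1"
  have sq: "c ^ d = c ^ (d - 2) * c ^ 2" "c ^ (d - 1) = c ^ (d - 2) * c" for c :: 'a
  proof -
    have "d = d - 2 + 2" "d - 1 = Suc (d - 2)" using d4 by simp_all
    then show "c ^ d = c ^ (d - 2) * c ^ 2" "c ^ (d - 1) = c ^ (d - 2) * c"
      by (metis power_add, metis power_Suc2)
  qed
  have e0: "p * a ^ 2 + q * b ^ 2 = w * v ^ 2"
    using e[of 0] unfolding p_def q_def w_def v_def by (simp add: sq)
  have e1: "p * a * a1 + q * b = w * v"
  proof -
    have "a1 * a ^ (d - 1) + b ^ (d - 1) = (b + 1) ^ (d - 1)"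
      using e[of 1] d_nz by simp
    then show ?thesis unfolding p_def q_def w_def v_def by (simp only: sq(2) mult_ac)
  qed
  have e2: "p * a1 ^ 2 + q = w"
    using e[of 2] choose2_nz unfolding p_def q_def w_def v_def by (simp add: mult_ac)
  have pqw: "p \<noteq> 0" "q \<noteq> 0" "w \<noteq> 0"
    using a_nz b by (simp_all add: p_def q_def w_def add_eq_0_iff2)
  \<comment> \<open>Lagrange's identity for the two vectors; the right-hand side is w * v^2 * w - (w
    * v)^2.\<close>
  have "p * q * (a - b * a1) ^ 2 = (p * a ^ 2 + q * b ^ 2) * (p * a1 ^ 2 + q) - (p * a * a1 + q * b) ^ 2"
    by (simp add: power2_eq_square algebra_simps)
  also have "\<dots> = 0" unfolding e0 e1 e2 by (simp add: power2_eq_square algebra_simps)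
  finally have 1: "a = b * a1" using pqw by simp
  \<comment> \<open>The same identity with the roles of Y and Z exchanged.\<close>
  have "p * w * (a - v * a1) ^ 2 = (q * b) ^ 2 - (w * v ^ 2 - p * a ^ 2) * (w - p * a1 ^ 2)
     - ((q * b) ^ 2 - (w * v - p * a * a1) ^ 2)"
    by (simp add: power2_eq_square algebra_simps)
  also have "\<dots> = 0"
  proof -
    have "w * v ^ 2 - p * a ^ 2 = q * b ^ 2" "w - p * a1 ^ 2 = q" "w * v - p * a * a1 = q * b"
      using e0 e1 e2 by (simp_all add: algebra_simps)
    then show ?thesis by (simp add: power2_eq_square)
  qed
  finally have 2: "a = v * a1" using pqw by simp
  from 1 2 have "a1 = 0" by (simp add: v_def algebra_simps)
  then show False using 1 a_nz by simp
qed

lemma coeff_at_high: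
  assumes "poly.coeff r i \<noteq> 0 \<Longrightarrow> i + Polynomial.degree (poly.coeff r i) \<le> N" "N < i + k"
  shows "fps_nth (coeff_at r i) k = 0"
proof (cases "poly.coeff r i = 0")
  case False
  have "Polynomial.degree (pcompose (poly.coeff r i) [:b, 1:]) \<le> Polynomial.degree (poly.coeff r i) * Polynomial.degree [:b, 1:]"
    by (rule degree_pcompose_le)
  then have "Polynomial.degree (pcompose (poly.coeff r i) [:b, 1:]) < k"
    using assms False by simp
  then show ?thesis by (simp add: coeff_at_def coeff_eq_0)
qed (simp add: coeff_at_def)

text \<open>Fourier inversion identifies d * r_i * y^i with the expansion of r up to order N, and
  y^i is a unit because a \<noteq> 0.\<close>

lemma coeff_at_low:
  assumes r: "reduced r" "\<And>\<zeta>. \<zeta> \<in> mu - {1} \<Longrightarrow> fps_X ^ N dvd expn \<zeta> r" and i: "i < d"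
    and D: "D \<le> N" "fps_X ^ D dvd expn 1 r"
  shows "fps_X ^ D dvd coeff_at r i"
proof -
  have "fps_X ^ D dvd fps_X ^ N" using D(1) by (rule le_imp_power_dvd)
  then have "fps_X ^ D dvd fps_const (of_nat d) * (coeff_at r i * y ^ i) - expn 1 r"
    using coefficients_from_pole[OF r i] dvd_trans by blast
  then have "fps_X ^ D dvd fps_const (of_nat d) * (coeff_at r i * y ^ i) - expn 1 r + expn 1 r"
    using D(2) by (rule dvd_add)
  then have "fps_X ^ D dvd (fps_const (of_nat d) * y ^ i) * coeff_at r i"
    by (simp add: mult_ac)
  then show ?thesis
    by (rule fps_dvd_unit_mult[rotated]) (use d_nz a_nz in \<open>simp add: y0 fps_power_zeroth\<close>)
qed

text \<open>Intended for the inverse automorphism, which sends Q = (a, b) to the flex: f and g are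
  its coordinates off Q. The data \<open>s\<close>, \<open>p\<close>, \<open>q\<close> express that
  they are regular at the flex, and \<open>s'\<close>, \<open>q'\<close> recover z from them by a
  quotient regular at the flex.\<close>

lemma no_map_to_nonflex:
  assumes reg: "regular_on S f" "regular_on S g"
    and maps: "\<And>x z. (x, z) \<in> S \<Longrightarrow> (f x z, g x z) \<in> A"
    and inj: "inj_on (\<lambda>(x, z). (f x z, g x z)) S"
    and inf: "tot n s" "top_coeff n s \<noteq> 0" "tot n p" "tot n q"
      "\<And>x z. (x, z) \<in> S \<Longrightarrow> bev x z s * f x z = bev x z p"
      "\<And>x z. (x, z) \<in> S \<Longrightarrow> bev x z s * g x z = bev x z q"
    and inv: "tot n' s'" "top_coeff n' s' \<noteq> 0"
      "\<And>x z. (x, z) \<in> S \<Longrightarrow> bev (f x z) (g x z) s' * z = bev (f x z) (g x z) q'"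
    and b: "b \<noteq> 0" "b \<noteq> -1"
  shows False
proof -
  obtain n1 rf0 where "reduced rf0" "\<forall>(x, z)\<in>S. (z - b) ^ n1 * f x z = bev x z rf0"
    using pole_form[OF reg(1)] by blast
  note rf0 = this
  obtain n2 rg0 where "reduced rg0" "\<forall>(x, z)\<in>S. (z - b) ^ n2 * g x z = bev x z rg0"
    using pole_form[OF reg(2)] by blast
  note rg0 = this
  \<comment> \<open>A common exponent for f and g; the summand d guarantees N \<ge> d - 1, so that D
    below is a natural number.\<close>
  define N where "N = n1 + n2 + d"
  obtain rf where rf: "reduced rf" "\<forall>(x, z)\<in>S. (z - b) ^ N * f x z = bev x z rf"
    using pole_form_raise[OF rf0, of N] by (auto simp: N_def)
  obtain rg where rg: "reduced rg" "\<forall>(x, z)\<in>S. (z - b) ^ N * g x z = bev x z rg"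
    using pole_form_raise[OF rg0, of N] by (auto simp: N_def)
  note cf = regular_at_conjugates[OF reg(1) rf(2)] and cg = regular_at_conjugates[OF reg(2) rg(2)]
  have df: "i + Polynomial.degree (poly.coeff rf i) \<le> N" if "poly.coeff rf i \<noteq> 0" for i
    using degree_bound[OF rf inf(1,2,3)] inf(5) that by blast
  have dg: "i + Polynomial.degree (poly.coeff rg i) \<le> N" if "poly.coeff rg i \<noteq> 0" for i
    using degree_bound[OF rg inf(1,2,4)] inf(6) that by blast
  define F where "F = fps_to_fls (expn 1 rf) * fls_X_inv ^ N"
  define G where "G = fps_to_fls (expn 1 rg) * fls_X_inv ^ N"
  have XX: "fls_X ^ N * (H * fls_X_inv ^ N) = H" for H :: "'a fls"
  proof -
    have "fls_X ^ N * (H * fls_X_inv ^ N) = H * (fls_X * fls_X_inv) ^ N"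
      by (simp only: power_mult_distrib mult_ac)
    then show ?thesis by (simp add: fls_X_times_conv_shift)
  qed
  have hF: "has_expn f F"
    unfolding has_expn_def F_def using rf(2) by (intro exI[of _ N] exI[of _ rf]) (simp only: XX simp_thms)
  have hG: "has_expn g G"
    unfolding has_expn_def G_def using rg(2) by (intro exI[of _ N] exI[of _ rg]) (simp only: XX simp_thms)
  have FG: "F ^ d + G ^ d = (G + 1) ^ d"
  proof -
    have "ev fls_const F G FF = fls_const 0"
    proof (rule has_expn_unique[OF has_expn_compose[OF hF hG] has_expn_const])
      show "bev (f x z) (g x z) FF = 0" if "(x, z) \<in> S" for x z
        using maps[OF that] by (simp add: ev_FF[OF coef_hom_id] A_def)
    qed
    then show ?thesis by (simp add: ev_FF[OF coef_hom_fls_const])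
  qed
  \<comment> \<open>If g had no pole at Q, each r_i would be divisible by (z - b)^N and of degree at
    most N - i. Only r_0 = \<kappa> * (z - b)^N could survive, and g would be constant.\<close>
  have "fls_subdegree G < 0"
  proof (rule ccontr)
    assume neg: "\<not> fls_subdegree G < 0"
    have XN: "fps_X ^ N dvd expn 1 rg"
    proof (cases "expn 1 rg = 0")
      case False
      then have "fls_subdegree G = int (subdegree (expn 1 rg)) - int N"
        by (simp add: G_def fls_subdegree_fls_to_fps)
      then have "N \<le> subdegree (expn 1 rg)" using neg by linarith
      then show ?thesis
        unfolding fps_X_power_dvd_iff by (auto intro: nth_less_subdegree_zero)
    qed simp
    have low: "fps_nth (coeff_at rg i) k = 0" if "i < d" "k < N" for i k
    proof -
      have "fps_X ^ N dvd coeff_at rg i"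
        by (rule coeff_at_low[OF rg(1) _ that(1) order_refl XN]) (rule cg)
      then show ?thesis using that(2) by (simp add: fps_X_power_dvd_iff)
    qed
    have high: "fps_nth (coeff_at rg i) k = 0" if "N < i + k" for i k
      using coeff_at_high[OF dg that] .
    have ci: "poly.coeff rg i = 0" if "i > 0" for i
    proof (cases "i < d")
      case True
      have "coeff_at rg i = 0"
      proof (rule fps_ext)
        fix k show "fps_nth (coeff_at rg i) k = fps_nth 0 k"
          using low[OF True, of k] high[of i k] that by (cases "k < N") auto
      qed
      then have "pcompose (poly.coeff rg i) [:b, 1:] = 0" by (simp add: coeff_at_def)
      then show ?thesis by (simp add: pcompose_eq_0_iff)
    next
      case False
      then show ?thesis using rg(1) by (simp add: reduced_def)
    qed
    define \<kappa> where "\<kappa> = fps_nth (coeff_at rg 0) N"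
    have c0: "pcompose (poly.coeff rg 0) [:b, 1:] = Polynomial.monom \<kappa> N"
    proof (rule poly_eqI)
      fix k
      have "poly.coeff (pcompose (poly.coeff rg 0) [:b, 1:]) k = fps_nth (coeff_at rg 0) k"
        by (simp add: coeff_at_def)
      also have "\<dots> = poly.coeff (Polynomial.monom \<kappa> N) k"
        using low[of 0 k] high[of 0 k] d4 by (cases k N rule: linorder_cases) (auto simp: \<kappa>_def)
      finally show "poly.coeff (pcompose (poly.coeff rg 0) [:b, 1:]) k = poly.coeff (Polynomial.monom \<kappa> N) k" .
    qed
    have rgc: "rg = [:poly.coeff rg 0:]"
      by (rule poly_eqI) (simp add: coeff_pCons ci split: nat.split)
    have gc: "g x z = \<kappa>" if "(x, z) \<in> S" "z \<noteq> b" for x z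
    proof -
      have "bev x z rg = poly (poly.coeff rg 0) z" by (subst rgc) (simp add: map_poly_idI)
      also have "\<dots> = poly (pcompose (poly.coeff rg 0) [:b, 1:]) (z - b)" by (simp add: poly_pcompose)
      also have "\<dots> = \<kappa> * (z - b) ^ N" by (simp add: c0 poly_monom)
      finally have "(z - b) ^ N * g x z = \<kappa> * (z - b) ^ N" using rg(2) that(1) by auto
      then show ?thesis using that(2) by simp
    qed
    \<comment> \<open>An injective map cannot send this infinite set into the finite fibre over
      \<kappa>.\<close>
    define T where "T = {P \<in> A. snd P \<noteq> b}"
    have TS: "T \<subseteq> S" by (auto simp: T_def S_def)
    have "(\<lambda>(x, z). (f x z, g x z)) ` T \<subseteq> {x. (x, \<kappa>) \<in> A} \<times> {\<kappa>}"
    proof (rule image_subsetI)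
      fix P assume P: "P \<in> T"
      obtain x z where xz: "P = (x, z)" by (cases P)
      have xzS: "(x, z) \<in> S" "z \<noteq> b" using TS P xz by (auto simp: T_def)
      show "(case P of (x, z) \<Rightarrow> (f x z, g x z)) \<in> {x. (x, \<kappa>) \<in> A} \<times> {\<kappa>}"
        using maps[OF xzS(1)] gc[OF xzS] by (simp add: xz)
    qed
    moreover have "finite ({x. (x, \<kappa>) \<in> A} \<times> {\<kappa>})" using finite_fiber by simp
    ultimately have "finite ((\<lambda>(x, z). (f x z, g x z)) ` T)" by (rule finite_subset)
    moreover have "inj_on (\<lambda>(x, z). (f x z, g x z)) T" using inj TS by (rule inj_on_subset)
    ultimately have "finite T" by (rule finite_imageD)
    then show False using infinite_A' unfolding T_def by blast
  qed
  then obtain m where m: "m > 0" "fls_subdegree F = - int (m * (d - 1))" "fls_subdegree G = - int (m * d)"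
    using curve_fls_subdegree[OF FG] by blast
  \<comment> \<open>The function z - b has a simple zero at Q and is a quotient of polynomials in F
    and G, whose orders are multiples of m.\<close>
  have "m = 1"
  proof -
    have "ev fls_const F G s' * fps_to_fls (expn 1 zz) = ev fls_const F G q'"
      by (rule has_expn_unique[OF has_expn_mult[OF has_expn_compose[OF hF hG] has_expn_poly] has_expn_compose[OF hF hG]])
         (use inv(3) in simp)
    then have e: "ev fls_const F G s' * fls_X = ev fls_const F G (q' - cc b * s')"
      by (simp add: algebra_simps)
    have "ev fls_const F G s' \<noteq> 0 \<and> fls_subdegree (ev fls_const F G s') = - int (m * n' * d)"
      by (rule ev_tot(2)[OF m inv(1,2)])
    then have "fls_subdegree (ev fls_const F G (q' - cc b * s')) = 1 - int (m * n' * d)"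
      unfolding e[symmetric] by simp
    moreover have "int m dvd fls_subdegree (ev fls_const F G (q' - cc b * s'))"
      by (rule ev_fls_subdegree_dvd[OF FG m])
    ultimately have "int m dvd 1 - int (m * n' * d) + int (m * n' * d)"
      by (intro dvd_add) auto
    then show ?thesis by simp
  qed
  \<comment> \<open>The pole of f at Q has order d - 1, so the numerator \<open>rf\<close> has order
    N - (d - 1) there.\<close>
  define D where "D = N - (d - 1)"
  have E0: "expn 1 rf \<noteq> 0" using m d4 by (auto simp: F_def)
  have ND: "D + (d - 1) = N" by (simp add: D_def N_def)
  have "subdegree (expn 1 rf) = D"
  proof -
    have "fls_subdegree F = int (subdegree (expn 1 rf)) - int N"
      using E0 by (simp add: F_def fls_subdegree_fls_to_fps)
    then show ?thesis using m(2) \<open>m = 1\<close> ND by simp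
  qed
  then have ED: "fps_X ^ D dvd expn 1 rf" "fps_nth (expn 1 rf) D \<noteq> 0"
    using E0 unfolding fps_X_power_dvd_iff by auto
  \<comment> \<open>The coefficients of x^(d - 1) and x^(d - 2). The first is divisible by (z - b)^D
    and has degree at most N - (d - 1) = D, hence is a monomial; the second has degree at most D +
    1.\<close>
  define u where "u = coeff_at rf (d - 1)"
  define w where "w = coeff_at rf (d - 2)"
  have cp: "fps_X ^ N dvd fps_const (of_nat d) * (coeff_at rf i * y ^ i) - expn 1 rf" if "i < d" for i
    by (rule coefficients_from_pole[OF rf(1) _ that]) (rule cf)
  have d12: "d - 1 < d" "d - 2 < d" "D \<le> N" using d4 ND by simp_all
  have u_low: "fps_nth u k = 0" if "k < D" for k
  proof -
    have "fps_X ^ D dvd coeff_at rf (d - 1)"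
      by (rule coeff_at_low[OF rf(1) _ d12(1,3) ED(1)]) (rule cf)
    then show ?thesis using that by (simp add: u_def fps_X_power_dvd_iff)
  qed
  have u_high: "fps_nth u k = 0" if "k > D" for k
    unfolding u_def using that ND by (intro coeff_at_high[OF df]) auto
  have w_high: "fps_nth w (D + 2) = 0"
    unfolding w_def using ND d4 by (intro coeff_at_high[OF df]) auto
  have uX: "u = fps_const (fps_nth u D) * fps_X ^ D"
  proof (rule fps_ext)
    fix k show "fps_nth u k = fps_nth (fps_const (fps_nth u D) * fps_X ^ D) k"
      using u_low[of k] u_high[of k] by (cases k D rule: linorder_cases) simp_all
  qed
  \<comment> \<open>For u = 0 the inversion formula would make the numerator vanish to order N >
    D.\<close>
  have uD: "fps_nth u D \<noteq> 0"
  proof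
    assume 0: "fps_nth u D = 0"
    have "u = 0" by (subst uX, subst 0) simp
    then have "fps_X ^ N dvd - expn 1 rf" using cp[OF d12(1)] by (simp add: u_def)
    then show False using ED(2) ND d4 by (simp add: fps_X_power_dvd_iff)
  qed
  have "fps_X ^ N dvd (fps_const (of_nat d) * (u * y ^ (d - 1)) - expn 1 rf) - (fps_const (of_nat d) * (w * y ^ (d - 2)) - expn 1 rf)"
    unfolding u_def w_def by (intro dvd_diff cp d12)
  also have "(fps_const (of_nat d) * (u * y ^ (d - 1)) - expn 1 rf) - (fps_const (of_nat d) * (w * y ^ (d - 2)) - expn 1 rf)
      = (fps_const (of_nat d) * y ^ (d - 2)) * (u * y - w)"
  proof -
    have "d - 1 = Suc (d - 2)" using d4 by simp
    then have "y ^ (d - 1) = y ^ (d - 2) * y" by (simp only: power_Suc2)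
    then show ?thesis by (simp add: algebra_simps)
  qed
  finally have "fps_X ^ N dvd u * y - w"
    by (rule fps_dvd_unit_mult[rotated]) (use d_nz a_nz in \<open>simp add: y0 fps_power_zeroth\<close>)
  \<comment> \<open>Here d \<ge> 4 enters, as D + 2 < N = D + (d - 1). Since w has no term of
    exponent D + 2, the coefficient of exponent 2 in y has to vanish.\<close>
  then have "fps_nth (u * y - w) (D + 2) = 0"
    using ND d4 by (simp add: fps_X_power_dvd_iff)
  moreover have "fps_nth (u * y) (D + 2) = fps_nth u D * fps_nth y 2"
    by (subst uX) (simp add: mult.assoc fps_X_power_mult_nth)
  ultimately have "fps_nth y 2 = 0" using w_high uD by simp
  then show False using branch_curved[OF b] by simp
qed

end

section \<open>Forms and linear maps\<close>

definition sc :: "'a::field \<Rightarrow> 'a triple \<Rightarrow> 'a triple" where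
  "sc c v = (c * fst v, c * fst (snd v), c * snd (snd v))"

lemma sc_simps [simp]: "sc c (x, y, z) = (c * x, c * y, c * z)" "sc 1 v = v" "sc c (sc e v) = sc (c * e) v"
  by (simp_all add: sc_def mult.assoc)

lemma sc_eq_0_iff [simp]: "sc c v = (0, 0, 0) \<longleftrightarrow> c = 0 \<or> v = (0, 0, 0)"
  by (cases v) auto

lemma mem_proj_iff: "w \<in> proj v \<longleftrightarrow> (\<exists>c. c \<noteq> 0 \<and> w = sc c v)"
  by (cases v) (auto simp: proj_def)

lemma proj_eq_iff: "proj v = proj w \<longleftrightarrow> (\<exists>c. c \<noteq> 0 \<and> w = sc c v)"
proof
  assume "proj v = proj w"
  moreover have "w \<in> proj w" unfolding mem_proj_iff by (intro exI[of _ 1]) simp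
  ultimately have "w \<in> proj v" by blast
  then show "\<exists>c. c \<noteq> 0 \<and> w = sc c v" by (simp only: mem_proj_iff)
next
  assume "\<exists>c. c \<noteq> 0 \<and> w = sc c v"
  then obtain c where c: "c \<noteq> 0" "w = sc c v" by blast
  show "proj v = proj w"
  proof (rule equalityI; rule subsetI)
    fix t assume "t \<in> proj v"
    then obtain e where "e \<noteq> 0" "t = sc e v" by (auto simp: mem_proj_iff)
    then show "t \<in> proj w" using c by (auto simp: mem_proj_iff intro!: exI[of _ "e / c"])
  next
    fix t assume "t \<in> proj w"
    then obtain e where "e \<noteq> 0" "t = sc e w" by (auto simp: mem_proj_iff)
    then show "t \<in> proj v" using c by (auto simp: mem_proj_iff intro!: exI[of _ "e * c"])
  qed
qed

lemma self_in_proj: "v \<in> proj v"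
  unfolding mem_proj_iff by (intro exI[of _ 1]) simp

lemma form_sc: "form n a (sc c v) = c ^ n * form n a v"
proof -
  obtain x y z where v: "v = (x, y, z)" by (cases v)
  have "a i j * (c * x) ^ i * (c * y) ^ j * (c * z) ^ (n - i - j) = c ^ n * (a i j * x ^ i * y ^ j * z ^ (n - i - j))"
    if "i \<le> n" "j \<le> n - i" for i j
  proof -
    have "c ^ n = c ^ i * c ^ j * c ^ (n - i - j)"
      using that by (simp flip: power_add)
    then show ?thesis by (simp add: power_mult_distrib mult_ac)
  qed
  then show ?thesis
    unfolding v sc_simps form_def prod.case sum_distrib_left by (intro sum.cong refl) simp
qed

lemma vanishes_at_proj: "vanishes_at n a (proj v) \<longleftrightarrow> form n a v = 0"
proof
  assume "vanishes_at n a (proj v)"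
  then show "form n a v = 0" using self_in_proj[of v] unfolding vanishes_at_def by blast
qed (auto simp: vanishes_at_def mem_proj_iff form_sc)

lemma proj_in_P2: "v \<noteq> (0, 0, 0) \<Longrightarrow> proj v \<in> P2"
  by (auto simp: P2_def)

text \<open>The constant form 1 of degree 0 has no zeros, so the empty set is closed.\<close>

lemma zariski_open_P2: "zariski_open P2"
proof -
  have "\<not> vanishes_at 0 (\<lambda>_ _. 1) P" if "P \<in> P2" for P :: "'a point"
    using that by (auto simp: P2_def vanishes_at_proj form_def)
  then have "zariski_closure {} = ({} :: 'a point set)"
    by (auto simp: zariski_closure_def)
  then show ?thesis by (simp add: zariski_open_def)
qed

text \<open>A point outside a closed set is separated from it by one form; this form can replace the
  open set in a local description.\<close>

lemma zariski_open_cutoff: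
  assumes "zariski_open U" "proj v \<in> U"
  shows "\<exists>n a. form n a v \<noteq> 0 \<and> (\<forall>w. w \<noteq> (0, 0, 0) \<longrightarrow> form n a w \<noteq> 0 \<longrightarrow> proj w \<in> U)"
proof -
  have P2: "proj v \<in> P2" "zariski_closure (P2 - U) = P2 - U" using assms by (auto simp: zariski_open_def)
  then have "proj v \<notin> zariski_closure (P2 - U)" using assms(2) by blast
  then obtain n a where na: "\<forall>Q\<in>P2 - U. vanishes_at n a Q" "\<not> vanishes_at n a (proj v)"
    using P2(1) by (auto simp: zariski_closure_def)
  have "proj w \<in> U" if "w \<noteq> (0, 0, 0)" "form n a w \<noteq> 0" for w
    using na(1) proj_in_P2[OF that(1)] that(2) vanishes_at_proj by blast
  moreover have "form n a v \<noteq> 0" using na(2) vanishes_at_proj by blast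
  ultimately show ?thesis by blast
qed

definition linear_form :: "('a::field triple \<Rightarrow> 'a) \<Rightarrow> bool" where
  "linear_form l \<longleftrightarrow> (\<exists>a b c. \<forall>x y z. l (x, y, z) = a * x + b * y + c * z)"

definition linear_map :: "('a::field triple \<Rightarrow> 'a triple) \<Rightarrow> bool" where
  "linear_map T \<longleftrightarrow> linear_form (\<lambda>v. fst (T v)) \<and> linear_form (\<lambda>v. fst (snd (T v))) \<and>
     linear_form (\<lambda>v. snd (snd (T v)))"

lemma linear_form_comp:
  assumes "linear_form l" "linear_map T"
  shows "linear_form (\<lambda>v. l (T v))"
proof -
  obtain a b c where l: "\<And>x y z. l (x, y, z) = a * x + b * y + c * z"
    using assms(1) by (auto simp: linear_form_def)
  obtain a1 b1 c1 where 1: "\<And>x y z. fst (T (x, y, z)) = a1 * x + b1 * y + c1 * z"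
    using assms(2) by (auto simp: linear_form_def linear_map_def)
  obtain a2 b2 c2 where 2: "\<And>x y z. fst (snd (T (x, y, z))) = a2 * x + b2 * y + c2 * z"
    using assms(2) by (auto simp: linear_form_def linear_map_def)
  obtain a3 b3 c3 where 3: "\<And>x y z. snd (snd (T (x, y, z))) = a3 * x + b3 * y + c3 * z"
    using assms(2) by (auto simp: linear_form_def linear_map_def)
  have "l (T (x, y, z)) = (a * a1 + b * a2 + c * a3) * x + (a * b1 + b * b2 + c * b3) * y + (a * c1 + b * c2 + c * c3) * z" for x y z
  proof -
    have "T (x, y, z) = (fst (T (x, y, z)), fst (snd (T (x, y, z))), snd (snd (T (x, y, z))))" by simp
    then have "l (T (x, y, z)) = a * fst (T (x, y, z)) + b * fst (snd (T (x, y, z))) + c * snd (snd (T (x, y, z)))"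
      using l by metis
    then show ?thesis unfolding 1 2 3 by (simp add: algebra_simps)
  qed
  then show ?thesis unfolding linear_form_def by blast
qed

lemma linear_map_comp: "linear_map T \<Longrightarrow> linear_map T' \<Longrightarrow> linear_map (\<lambda>v. T (T' v))"
  using linear_form_comp unfolding linear_map_def by blast

lemma linear_form_sc: "linear_form l \<Longrightarrow> l (sc c v) = c * l v"
  by (cases v) (auto simp: linear_form_def algebra_simps)

lemma linear_map_sc: "linear_map T \<Longrightarrow> T (sc c v) = sc c (T v)"
proof -
  assume "linear_map T"
  then have "fst (T (sc c v)) = c * fst (T v)" "fst (snd (T (sc c v))) = c * fst (snd (T v))"
    "snd (snd (T (sc c v))) = c * snd (snd (T v))"
    unfolding linear_map_def by (auto dest: linear_form_sc)
  then show ?thesis unfolding sc_def[of c "T v"] by (simp add: prod_eq_iff)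
qed

lemma linear_map_0: "linear_map T \<Longrightarrow> T (0, 0, 0) = (0, 0, 0)"
  using linear_map_sc[of T 0 "(0, 0, 0)"] by (simp add: sc_def)

lemma linear_form_form:
  assumes "linear_form l"
  shows "\<exists>a. form 1 a = l"
proof -
  obtain a b c where l: "\<And>x y z. l (x, y, z) = a * x + b * y + c * z"
    using assms by (auto simp: linear_form_def)
  have "form 1 (\<lambda>i j. if i = 1 then a else if j = 1 then b else c) = l"
    by (auto simp: form_def l)
  then show ?thesis by blast
qed

lemma linear_curve_morphism:
  assumes T: "linear_map T" and nz: "\<And>v. v \<noteq> (0, 0, 0) \<Longrightarrow> T v \<noteq> (0, 0, 0)"
    and C: "C \<subseteq> P2" "f ` C \<subseteq> C" and f: "\<And>v. proj v \<in> C \<Longrightarrow> f (proj v) = proj (T v)"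
  shows "curve_morphism C f"
  unfolding curve_morphism_def
proof (intro conjI ballI)
  obtain a b c where abc: "form 1 a = (\<lambda>v. fst (T v))" "form 1 b = (\<lambda>v. fst (snd (T v)))" "form 1 c = (\<lambda>v. snd (snd (T v)))"
    using T linear_form_form unfolding linear_map_def by metis
  fix P assume P: "P \<in> C"
  have *: "(form 1 a v, form 1 b v, form 1 c v) = T v" for v unfolding abc by simp
  have "T v \<noteq> (0, 0, 0) \<and> f Q = proj (T v)" if Q: "Q \<in> P2 \<inter> C" "v \<in> Q" for Q v
  proof -
    obtain w where w: "Q = proj w" "w \<noteq> (0, 0, 0)" using Q by (auto simp: P2_def)
    then obtain k where k: "k \<noteq> 0" "v = sc k w" using Q(2) by (auto simp: mem_proj_iff)
    then have "Q = proj v" using w by (auto simp: proj_eq_iff)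
    moreover have "v \<noteq> (0, 0, 0)" using k w by simp
    ultimately show ?thesis using nz f Q(1) by auto
  qed
  then have "\<forall>Q\<in>P2 \<inter> C. \<forall>v\<in>Q. (form 1 a v, form 1 b v, form 1 c v) \<noteq> (0, 0, 0) \<and>
      f Q = proj (form 1 a v, form 1 b v, form 1 c v)"
    unfolding * by blast
  moreover have "P \<in> P2" using P C by blast
  ultimately show "\<exists>U n a b c. zariski_open U \<and> P \<in> U \<and> (\<forall>Q\<in>U \<inter> C. \<forall>v\<in>Q.
      (form n a v, form n b v, form n c v) \<noteq> (0, 0, 0) \<and> f Q = proj (form n a v, form n b v, form n c v))"
    using zariski_open_P2 by blast
qed (use C in auto)

text \<open>Homogeneous polynomial functions, generated rather than given by coefficients: linear
  substitution and dehomogenization then become inductions.\<close>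

inductive homf :: "nat \<Rightarrow> ('a::field triple \<Rightarrow> 'a) \<Rightarrow> bool" where
  const: "homf 0 (\<lambda>u. c)"
| zero: "homf n (\<lambda>u. 0)"
| coord1: "homf 1 fst"
| coord2: "homf 1 (\<lambda>u. fst (snd u))"
| coord3: "homf 1 (\<lambda>u. snd (snd u))"
| add: "homf n \<phi> \<Longrightarrow> homf n \<psi> \<Longrightarrow> homf n (\<lambda>u. \<phi> u + \<psi> u)"
| mult: "homf n \<phi> \<Longrightarrow> homf m \<psi> \<Longrightarrow> homf (n + m) (\<lambda>u. \<phi> u * \<psi> u)"

lemma homf_scale: "homf n \<phi> \<Longrightarrow> homf n (\<lambda>u. c * \<phi> u)"
  using homf.mult[OF homf.const] by fastforce

lemma homf_power: "homf 1 \<phi> \<Longrightarrow> homf k (\<lambda>u. \<phi> u ^ k)"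
proof (induction k)
  case 0
  show ?case using homf.const[of 1] by simp
next
  case (Suc k)
  then show ?case using homf.mult[of 1 \<phi> k "\<lambda>u. \<phi> u ^ k"] by simp
qed

lemma homf_sum: "(\<And>i. i \<in> I \<Longrightarrow> homf n (\<phi> i)) \<Longrightarrow> homf n (\<lambda>u. \<Sum>i\<in>I. \<phi> i u)"
  by (induction I rule: infinite_finite_induct) (auto intro: homf.zero homf.add)

lemma homf_linear_form:
  assumes "linear_form l"
  shows "homf 1 l"
proof -
  obtain a b c where l: "\<And>x y z. l (x, y, z) = a * x + b * y + c * z"
    using assms by (auto simp: linear_form_def)
  then have "l = (\<lambda>u. a * fst u + b * fst (snd u) + c * snd (snd u))" by auto
  moreover have "homf 1 (\<lambda>u. a * fst u + b * fst (snd u) + c * snd (snd u))"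
    by (intro homf.add homf_scale homf.coord1 homf.coord2 homf.coord3)
  ultimately show ?thesis by simp
qed

lemma homf_form:
  assumes T: "linear_map T"
  shows "homf n (\<lambda>u. form n a (T u))"
proof -
  let ?c1 = "\<lambda>u. fst (T u)" and ?c2 = "\<lambda>u. fst (snd (T u))" and ?c3 = "\<lambda>u. snd (snd (T u))"
  have lin: "homf 1 ?c1" "homf 1 ?c2" "homf 1 ?c3"
    using T homf_linear_form unfolding linear_map_def by blast+
  have f: "form n a (T u) = (\<Sum>i\<le>n. \<Sum>j\<le>n - i. a i j * (?c1 u ^ i * ?c2 u ^ j * ?c3 u ^ (n - i - j)))" for u
    by (cases "T u") (simp add: form_def mult.assoc)
  show ?thesis
    unfolding f
  proof (intro homf_sum)
    fix i j assume ij: "i \<in> {..n}" "j \<in> {..n - i}"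
    have "homf (i + j + (n - i - j)) (\<lambda>u. a i j * (?c1 u ^ i * ?c2 u ^ j * ?c3 u ^ (n - i - j)))"
      by (intro homf_scale homf.mult homf_power lin)
    then show "homf n (\<lambda>u. a i j * (?c1 u ^ i * ?c2 u ^ j * ?c3 u ^ (n - i - j)))"
      using ij by simp
  qed
qed

lemma homf_comp:
  assumes "homf n \<phi>" and T: "linear_map T"
  shows "homf n (\<lambda>u. \<phi> (T u))"
  using assms(1)
proof (induction rule: homf.induct)
  case coord1
  show ?case using T by (intro homf_linear_form) (simp add: linear_map_def)
next
  case coord2
  show ?case using T by (intro homf_linear_form) (simp add: linear_map_def)
next
  case coord3
  show ?case using T by (intro homf_linear_form) (simp add: linear_map_def)
qed (auto intro: homf.intros)

text \<open>Beyond total degree n + m one factor of each product of monomials is out of range; at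
  z^(n + m) only z^n times z^m remains.\<close>

lemma tot_mult:
  assumes p: "tot n p" and q: "tot m q"
  shows "tot (n + m) (p * q)" and "top_coeff (n + m) (p * q) = top_coeff n p * top_coeff m q"
proof -
  have cf: "poly.coeff (poly.coeff (p * q) i) j =
      (\<Sum>k\<le>i. \<Sum>l\<le>j. poly.coeff (poly.coeff p k) l * poly.coeff (poly.coeff q (i - k)) (j - l))" for i j
    by (simp add: coeff_mult coeff_sum)
  show "tot (n + m) (p * q)"
    unfolding tot_def cf
  proof (intro allI impI sum.neutral ballI)
    fix i j k l assume ij: "n + m < i + j" "k \<in> {..i}" "l \<in> {..j}"
    then have "n < k + l \<or> m < (i - k) + (j - l)" by auto
    then show "poly.coeff (poly.coeff p k) l * poly.coeff (poly.coeff q (i - k)) (j - l) = 0"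
      using p q by (auto simp: tot_def)
  qed
  have "(\<Sum>l\<le>n + m. poly.coeff (poly.coeff p 0) l * poly.coeff (poly.coeff q 0) (n + m - l))
      = (\<Sum>l\<in>{n}. poly.coeff (poly.coeff p 0) l * poly.coeff (poly.coeff q 0) (n + m - l))"
  proof (rule sum.mono_neutral_right)
    show "\<forall>l\<in>{..n + m} - {n}. poly.coeff (poly.coeff p 0) l * poly.coeff (poly.coeff q 0) (n + m - l) = 0"
    proof
      fix l assume "l \<in> {..n + m} - {n}"
      then have "n < l \<or> m < n + m - l" by auto
      then show "poly.coeff (poly.coeff p 0) l * poly.coeff (poly.coeff q 0) (n + m - l) = 0"
        using p q by (auto simp: tot_def)
    qed
  qed auto
  then show "top_coeff (n + m) (p * q) = top_coeff n p * top_coeff m q"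
    by (simp add: top_coeff_def cf)
qed

context fermat
begin

text \<open>Triples (X, Y, Z) normalized by Z / eps - Y = 1; the line Z = eps * Y is the tangent at
  the flex.\<close>

definition aff :: "'a \<Rightarrow> 'a \<Rightarrow> 'a triple" where "aff x z = (x, z, eps * (z + 1))"
definition flex :: "'a triple" where "flex = (0, 1, eps)"

definition cone :: "'a triple set" where
  "cone = {(x, y, z). x ^ d + y ^ d + z ^ d = 0 \<and> (x, y, z) \<noteq> (0, 0, 0)}"

lemma eps_nz: "eps \<noteq> 0"
  using eps d4 by (auto simp: power_0_left)

lemma cone_sc: "c \<noteq> 0 \<Longrightarrow> sc c u \<in> cone \<longleftrightarrow> u \<in> cone"
proof -
  assume c: "c \<noteq> 0"
  obtain x y z where u: "u = (x, y, z)" by (cases u)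
  have "(c * x) ^ d + (c * y) ^ d + (c * z) ^ d = c ^ d * (x ^ d + y ^ d + z ^ d)"
    by (simp add: power_mult_distrib distrib_left)
  then show ?thesis using c by (auto simp: u cone_def)
qed

lemma aff_in_cone: "aff x z \<in> cone \<longleftrightarrow> (x, z) \<in> A"
  using eps d4 by (auto simp: aff_def cone_def A_def power_mult_distrib eps_nz add_eq_0_iff2)

lemma flex_in_cone: "flex \<in> cone"
  using eps d4 by (simp add: flex_def cone_def power_0_left)

text \<open>On the tangent line Z = eps * Y the equation of the curve reduces to X^d = 0.\<close>

lemma cone_cases:
  assumes "(x, y, z) \<in> cone"
  shows "z / eps - y \<noteq> 0 \<Longrightarrow> (x, y, z) = sc (z / eps - y) (aff (x / (z / eps - y)) (y / (z / eps - y)))"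
    and "z / eps - y = 0 \<Longrightarrow> y \<noteq> 0 \<and> (x, y, z) = sc y flex"
proof -
  assume w: "z / eps - y \<noteq> 0"
  have "(z / eps - y) * (eps * (y / (z / eps - y) + 1)) = eps * (y + (z / eps - y))"
    using w by (simp only: distrib_left mult.left_commute[of "z / eps - y"]) simp
  also have "\<dots> = z" using eps_nz by simp
  finally show "(x, y, z) = sc (z / eps - y) (aff (x / (z / eps - y)) (y / (z / eps - y)))"
    using w by (simp add: aff_def)
next
  assume "z / eps - y = 0"
  then have z: "z = eps * y" using eps_nz by (simp add: field_simps)
  then have "x ^ d = 0" using assms eps by (simp add: cone_def power_mult_distrib)
  then have "x = 0" by simp
  then show "y \<noteq> 0 \<and> (x, y, z) = sc y flex"
    using assms z by (auto simp: cone_def flex_def mult.commute)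
qed

lemma aff_sc_eq: "sc c (aff x z) = aff x' z' \<Longrightarrow> x = x' \<and> z = z'"
proof -
  assume "sc c (aff x z) = aff x' z'"
  then have e: "c * x = x'" "c * z = z'" "eps * (c * (z + 1)) = eps * (z' + 1)"
    by (auto simp: aff_def mult.left_commute)
  then have "c * (z + 1) = z' + 1" using eps_nz by simp
  then have "c = 1" using e(2) by (simp add: distrib_left)
  then show ?thesis using e by simp
qed

lemma aff_sc_neq_flex: "sc c (aff x z) \<noteq> flex"
proof
  assume "sc c (aff x z) = flex"
  then have "c * z = 1" "eps * (c * (z + 1)) = eps * 1"
    by (auto simp: aff_def flex_def mult.left_commute)
  then have "c * z = 1" "c * (z + 1) = 1" using eps_nz by simp_all
  then show False by (auto simp: distrib_left)
qed

text \<open>Dehomogenization in the chart \<open>aff\<close>. The value at the flex is recorded too,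
  because by \<open>ev_tot\<close> it governs the pole order at infinity.\<close>

definition hpoly :: "nat \<Rightarrow> ('a triple \<Rightarrow> 'a) \<Rightarrow> 'a poly poly \<Rightarrow> bool" where
  "hpoly n \<phi> p \<longleftrightarrow> tot n p \<and> (\<forall>x z. bev x z p = \<phi> (aff x z)) \<and> top_coeff n p = \<phi> flex"

lemma hpoly_add: "hpoly n \<phi> p \<Longrightarrow> hpoly n \<psi> q \<Longrightarrow> hpoly n (\<lambda>u. \<phi> u + \<psi> u) (p + q)"
  by (auto simp: hpoly_def tot_def top_coeff_def)

lemma hpoly_mult: "hpoly n \<phi> p \<Longrightarrow> hpoly m \<psi> q \<Longrightarrow> hpoly (n + m) (\<lambda>u. \<phi> u * \<psi> u) (p * q)"
  by (auto simp: hpoly_def tot_mult)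

lemma hpoly_scale: "hpoly n \<phi> p \<Longrightarrow> hpoly n (\<lambda>u. c * \<phi> u) (smult [:c:] p)"
  by (auto simp: hpoly_def tot_def top_coeff_def map_poly_idI)

lemma hpoly_0: "hpoly n (\<lambda>u. 0) 0"
  by (auto simp: hpoly_def tot_def top_coeff_def)

lemma hpoly_1: "hpoly 0 (\<lambda>u. 1) 1"
  by (auto simp: hpoly_def tot_def top_coeff_def one_pCons coeff_pCons split: nat.splits)

lemma hpoly_coords:
  "hpoly 1 fst xx" "hpoly 1 (\<lambda>u. fst (snd u)) zz" "hpoly 1 (\<lambda>u. snd (snd u)) (smult [:eps:] (zz + 1))"
  by (auto simp: hpoly_def tot_def top_coeff_def xx_def zz_def aff_def flex_def map_poly_idI one_pCons
      coeff_pCons distrib_left id_hom.ev_pCons split: nat.splits)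

lemma homf_imp_hpoly: "homf n \<phi> \<Longrightarrow> \<exists>p. hpoly n \<phi> p"
proof (induction rule: homf.induct)
  case (const c)
  then show ?case using hpoly_scale[OF hpoly_1, of c] by auto
next
  case (mult n \<phi> m \<psi>)
  then show ?case using hpoly_mult by blast
next
  case (add n \<phi> \<psi>)
  then show ?case using hpoly_add by blast
qed (use hpoly_0 hpoly_coords in blast)+

end

section \<open>Morphisms of the Fermat curve\<close>

text \<open>Computations take place in Fermat coordinates u = L v, while points stay classes of the
  original vectors v; thus the given notions of closure and morphism apply to the Chebyshev curve
  itself.\<close>

locale fermat_curve = fermat d eps for d and eps :: "'a::alg_closed_field" +
  fixes L Li :: "'a triple \<Rightarrow> 'a triple"
  assumes lin_L: "linear_map L" and lin_Li: "linear_map Li"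
    and L_Li [simp]: "L (Li u) = u" and Li_L [simp]: "Li (L v) = v"
begin

definition pt :: "'a triple \<Rightarrow> 'a point" where "pt u = proj (Li u)"
definition curve :: "'a point set" where "curve = pt ` cone"

lemma Li_nz: "u \<noteq> (0, 0, 0) \<Longrightarrow> Li u \<noteq> (0, 0, 0)"
  using L_Li[of u] linear_map_0[OF lin_L] by metis

lemma L_nz: "v \<noteq> (0, 0, 0) \<Longrightarrow> L v \<noteq> (0, 0, 0)"
  using Li_L[of v] linear_map_0[OF lin_Li] by metis

lemma pt_eq_iff: "pt u = pt u' \<longleftrightarrow> (\<exists>c. c \<noteq> 0 \<and> u' = sc c u)"
proof -
  have "Li u' = sc c (Li u) \<longleftrightarrow> u' = sc c u" for c
    using linear_map_sc[OF lin_Li, of c u] by (metis L_Li)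
  then show ?thesis by (simp only: pt_def proj_eq_iff)
qed

lemma pt_sc: "c \<noteq> 0 \<Longrightarrow> pt (sc c u) = pt u"
  using pt_eq_iff[of u "sc c u"] by auto

lemma cone_nz: "u \<in> cone \<Longrightarrow> u \<noteq> (0, 0, 0)"
  by (auto simp: cone_def)

lemma pt_in_curve: "pt u \<in> curve \<longleftrightarrow> u \<in> cone"
proof
  assume "pt u \<in> curve"
  then obtain w where "w \<in> cone" "pt u = pt w" unfolding curve_def by blast
  then obtain c where "c \<noteq> 0" "w = sc c u" using pt_eq_iff by metis
  with \<open>w \<in> cone\<close> show "u \<in> cone" using cone_sc by metis
qed (simp add: curve_def)

lemma curve_P2: "curve \<subseteq> P2"
  using proj_in_P2 Li_nz cone_nz unfolding curve_def pt_def by blast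

lemma curve_cases:
  assumes "P \<in> curve"
  obtains "P = pt flex" | x z where "(x, z) \<in> A" "P = pt (aff x z)"
proof -
  obtain u where u: "u \<in> cone" "P = pt u" using assms unfolding curve_def by blast
  obtain x y z where xyz: "u = (x, y, z)" by (cases u)
  show ?thesis
  proof (cases "z / eps - y = 0")
    case True
    then have "y \<noteq> 0" "u = sc y flex" using cone_cases(2)[of x y z] u xyz by auto
    then show ?thesis using that(1) u pt_sc by simp
  next
    case False
    then have e: "u = sc (z / eps - y) (aff (x / (z / eps - y)) (y / (z / eps - y)))"
      using cone_cases(1)[of x y z] u xyz by simp
    then have "aff (x / (z / eps - y)) (y / (z / eps - y)) \<in> cone"
      using u(1) False cone_sc by metis
    moreover have "P = pt (aff (x / (z / eps - y)) (y / (z / eps - y)))"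
      using u(2) e pt_sc[OF False] by metis
    ultimately show ?thesis using that(2) by (simp add: aff_in_cone)
  qed
qed

definition co :: "'a point \<Rightarrow> 'a \<times> 'a" where
  "co P = (SOME xz. xz \<in> A \<and> P = pt (aff (fst xz) (snd xz)))"

lemma pt_aff_eq_iff: "pt (aff x z) = pt (aff x' z') \<longleftrightarrow> x = x' \<and> z = z'"
  using aff_sc_eq[of _ x z x' z'] unfolding pt_eq_iff by (metis sc_simps(2) one_neq_zero)

lemma pt_aff_neq_flex: "pt (aff x z) \<noteq> pt flex"
  unfolding pt_eq_iff using aff_sc_neq_flex by metis

lemma co_aff: "(x, z) \<in> A \<Longrightarrow> co (pt (aff x z)) = (x, z)"
  unfolding co_def by (rule some_equality) (auto simp: pt_aff_eq_iff)

lemma co_spec: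
  assumes "P \<in> curve" "P \<noteq> pt flex"
  shows "co P \<in> A" "pt (aff (fst (co P)) (snd (co P))) = P"
proof -
  obtain x z where "(x, z) \<in> A" "P = pt (aff x z)"
    using curve_cases[OF assms(1)] assms(2) by metis
  then show "co P \<in> A" "pt (aff (fst (co P)) (snd (co P))) = P" by (simp_all add: co_aff)
qed

lemma aff_in_curve: "(x, z) \<in> A \<Longrightarrow> pt (aff x z) \<in> curve"
  by (simp add: pt_in_curve aff_in_cone)

lemma flex_in_curve: "pt flex \<in> curve"
  by (simp add: pt_in_curve flex_in_cone)

text \<open>Morphisms described in Fermat coordinates without open sets: the forms represent f
  wherever they are not all zero.\<close>

definition locmor :: "('a point \<Rightarrow> 'a point) \<Rightarrow> bool" where
  "locmor f \<longleftrightarrow> f ` curve \<subseteq> curve \<and> (\<forall>u0\<in>cone. \<exists>n \<phi>1 \<phi>2 \<phi>3. homf n \<phi>1 \<and> homf n \<phi>2 \<and> homf n \<phi>3 \<and>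
    (\<phi>1 u0, \<phi>2 u0, \<phi>3 u0) \<noteq> (0, 0, 0) \<and>
    (\<forall>u\<in>cone. (\<phi>1 u, \<phi>2 u, \<phi>3 u) \<noteq> (0, 0, 0) \<longrightarrow> f (pt u) = pt (\<phi>1 u, \<phi>2 u, \<phi>3 u)))"

lemma locmor_closed: "locmor f \<Longrightarrow> P \<in> curve \<Longrightarrow> f P \<in> curve"
  unfolding locmor_def by blast

lemma curve_morphism_locmor:
  assumes f: "curve_morphism curve f"
  shows "locmor f"
  unfolding locmor_def
proof (intro conjI ballI)
  show "f ` curve \<subseteq> curve" using f unfolding curve_morphism_def by blast
  fix u0 assume u0: "u0 \<in> cone"
  have "pt u0 \<in> curve" using u0 by (simp add: pt_in_curve)
  then obtain U n a b c where U: "zariski_open U" "pt u0 \<in> U" and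
    abc: "\<forall>Q\<in>U \<inter> curve. \<forall>v\<in>Q. (form n a v, form n b v, form n c v) \<noteq> (0, 0, 0) \<and>
           f Q = proj (form n a v, form n b v, form n c v)"
    using f unfolding curve_morphism_def by meson
  obtain m e where e: "form m e (Li u0) \<noteq> 0"
    "\<And>w. w \<noteq> (0, 0, 0) \<Longrightarrow> form m e w \<noteq> 0 \<Longrightarrow> proj w \<in> U"
    using zariski_open_cutoff[OF U(1), of "Li u0"] U(2) unfolding pt_def by blast
  define W where "W = (\<lambda>u. (form n a (Li u), form n b (Li u), form n c (Li u)))"
  \<comment> \<open>The factor \<open>form m e\<close> vanishes outside U, so a nonzero value of
    \<Phi> certifies that the local representation applies.\<close>
  define \<Phi> where "\<Phi> = (\<lambda>u. sc (form m e (Li u)) (L (W u)))"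
  have main: "W u \<noteq> (0, 0, 0) \<and> f (pt u) = proj (W u)" if "u \<in> cone" "pt u \<in> U" for u
  proof -
    have "Li u \<in> pt u" unfolding pt_def by (rule self_in_proj)
    then show ?thesis using abc that pt_in_curve unfolding W_def by blast
  qed
  have hp: "homf (m + n) (\<lambda>u. form m e (Li u) * l (W u))" if l: "linear_form l" for l
  proof -
    obtain k1 k2 k3 where k: "\<And>x y z. l (x, y, z) = k1 * x + k2 * y + k3 * z"
      using l by (auto simp: linear_form_def)
    show ?thesis
      unfolding W_def k by (intro homf.mult homf.add homf_scale homf_form lin_Li)
  qed
  have lf: "linear_form (\<lambda>v. fst (L v))" "linear_form (\<lambda>v. fst (snd (L v)))" "linear_form (\<lambda>v. snd (snd (L v)))"
    using lin_L by (simp_all add: linear_map_def)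
  define \<phi>1 \<phi>2 \<phi>3 where "\<phi>1 = (\<lambda>u. form m e (Li u) * fst (L (W u)))"
    and "\<phi>2 = (\<lambda>u. form m e (Li u) * fst (snd (L (W u))))" and "\<phi>3 = (\<lambda>u. form m e (Li u) * snd (snd (L (W u))))"
  have \<Phi>: "(\<phi>1 u, \<phi>2 u, \<phi>3 u) = \<Phi> u" for u
    by (simp add: \<Phi>_def \<phi>1_def \<phi>2_def \<phi>3_def sc_def)
  have "\<Phi> u0 \<noteq> (0, 0, 0)"
    using e(1) main[OF u0 U(2)] L_nz by (simp add: \<Phi>_def)
  moreover have "f (pt u) = pt (\<Phi> u)" if u: "u \<in> cone" "\<Phi> u \<noteq> (0, 0, 0)" for u
  proof -
    have ne: "form m e (Li u) \<noteq> 0" using u(2) by (auto simp: \<Phi>_def)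
    then have "pt u \<in> U" using e(2)[OF Li_nz[OF cone_nz[OF u(1)]]] by (simp add: pt_def)
    then have "f (pt u) = proj (W u)" using main u by blast
    also have "\<dots> = pt (L (W u))" by (simp add: pt_def)
    also have "\<dots> = pt (\<Phi> u)" unfolding \<Phi>_def by (rule pt_sc[OF ne, symmetric])
    finally show ?thesis .
  qed
  ultimately show "\<exists>n \<phi>1 \<phi>2 \<phi>3. homf n \<phi>1 \<and> homf n \<phi>2 \<and> homf n \<phi>3 \<and>
    (\<phi>1 u0, \<phi>2 u0, \<phi>3 u0) \<noteq> (0, 0, 0) \<and>
    (\<forall>u\<in>cone. (\<phi>1 u, \<phi>2 u, \<phi>3 u) \<noteq> (0, 0, 0) \<longrightarrow> f (pt u) = pt (\<phi>1 u, \<phi>2 u, \<phi>3 u))"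
    using hp[OF lf(1)] hp[OF lf(2)] hp[OF lf(3)] unfolding \<phi>1_def[symmetric] \<phi>2_def[symmetric] \<phi>3_def[symmetric] \<Phi>[symmetric]
    by metis
qed

text \<open>The affine coordinates of the image are quotients of forms of one degree n. As
  \<open>u0\<close> may be an affine point or the flex, the nonvanishing of the denominator is
  stated for the form \<sigma>; it becomes a statement on the value of \<open>s\<close> or on its
  top coefficient.\<close>

lemma chart_representation:
  assumes f: "locmor f" and u0: "u0 \<in> cone" and ne: "f (pt u0) \<noteq> pt flex"
  obtains n \<sigma> s p q where "hpoly n \<sigma> s" "tot n p" "tot n q" "\<sigma> u0 \<noteq> 0"
    "\<And>x z. (x, z) \<in> A \<Longrightarrow> f (pt (aff x z)) \<noteq> pt flex \<Longrightarrow> bev x z s * fst (co (f (pt (aff x z)))) = bev x z p"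
    "\<And>x z. (x, z) \<in> A \<Longrightarrow> f (pt (aff x z)) \<noteq> pt flex \<Longrightarrow> bev x z s * snd (co (f (pt (aff x z)))) = bev x z q"
proof -
  obtain n \<phi>1 \<phi>2 \<phi>3 where hf: "homf n \<phi>1" "homf n \<phi>2" "homf n \<phi>3"
    and nz: "(\<phi>1 u0, \<phi>2 u0, \<phi>3 u0) \<noteq> (0, 0, 0)"
    and rep: "\<And>u. u \<in> cone \<Longrightarrow> (\<phi>1 u, \<phi>2 u, \<phi>3 u) \<noteq> (0, 0, 0) \<Longrightarrow> f (pt u) = pt (\<phi>1 u, \<phi>2 u, \<phi>3 u)"
    using bspec[OF conjunct2[OF f[unfolded locmor_def]] u0] by metis
  obtain p1 p2 p3 where h: "hpoly n \<phi>1 p1" "hpoly n \<phi>2 p2" "hpoly n \<phi>3 p3"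
    using hf homf_imp_hpoly by metis
  \<comment> \<open>The equation of the tangent line at the flex, evaluated at the image; it is 0
    exactly where the image is the flex.\<close>
  define \<sigma> where "\<sigma> = (\<lambda>u. (1 / eps) * \<phi>3 u + (-1) * \<phi>2 u)"
  define s where "s = smult [:1 / eps:] p3 + smult [:-1:] p2"
  have hs: "hpoly n \<sigma> s"
    unfolding \<sigma>_def s_def by (intro hpoly_add hpoly_scale h)
  have key: "\<sigma> u \<noteq> 0 \<and> \<sigma> u * fst (co (f (pt u))) = \<phi>1 u \<and> \<sigma> u * snd (co (f (pt u))) = \<phi>2 u"
    if u: "u \<in> cone" "(\<phi>1 u, \<phi>2 u, \<phi>3 u) \<noteq> (0, 0, 0)" "f (pt u) \<noteq> pt flex" for u
  proof -
    have fu: "f (pt u) = pt (\<phi>1 u, \<phi>2 u, \<phi>3 u)" by (rule rep[OF u(1,2)])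
    have "f (pt u) \<in> curve" using u(1) by (intro locmor_closed[OF f]) (simp add: pt_in_curve)
    then have cone: "(\<phi>1 u, \<phi>2 u, \<phi>3 u) \<in> cone" unfolding fu pt_in_curve .
    have \<sigma>: "\<sigma> u = \<phi>3 u / eps - \<phi>2 u" by (simp add: \<sigma>_def)
    have ne: "\<sigma> u \<noteq> 0"
    proof
      assume "\<sigma> u = 0"
      then have "\<phi>2 u \<noteq> 0 \<and> (\<phi>1 u, \<phi>2 u, \<phi>3 u) = sc (\<phi>2 u) flex"
        using cone_cases(2)[OF cone] \<sigma> by simp
      then show False using u(3) fu pt_sc by metis
    qed
    have e: "(\<phi>1 u, \<phi>2 u, \<phi>3 u) = sc (\<sigma> u) (aff (\<phi>1 u / \<sigma> u) (\<phi>2 u / \<sigma> u))"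
      using cone_cases(1)[OF cone] ne unfolding \<sigma> by blast
    have "(\<phi>1 u / \<sigma> u, \<phi>2 u / \<sigma> u) \<in> A"
      using cone cone_sc[OF ne] e aff_in_cone by metis
    moreover have "f (pt u) = pt (aff (\<phi>1 u / \<sigma> u) (\<phi>2 u / \<sigma> u))"
      using fu e pt_sc[OF ne] by metis
    ultimately have "co (f (pt u)) = (\<phi>1 u / \<sigma> u, \<phi>2 u / \<sigma> u)" by (simp add: co_aff)
    then show ?thesis using ne by simp
  qed
  have rel: "bev x z s * fst (co (f (pt (aff x z)))) = bev x z p1 \<and> bev x z s * snd (co (f (pt (aff x z)))) = bev x z p2"
    if xz: "(x, z) \<in> A" "f (pt (aff x z)) \<noteq> pt flex" for x z
  proof -
    have b: "bev x z s = \<sigma> (aff x z)" "bev x z p1 = \<phi>1 (aff x z)" "bev x z p2 = \<phi>2 (aff x z)"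
      using h hs by (simp_all add: hpoly_def)
    have ac: "aff x z \<in> cone" using xz by (simp add: aff_in_cone)
    show ?thesis
    proof (cases "(\<phi>1 (aff x z), \<phi>2 (aff x z), \<phi>3 (aff x z)) = (0, 0, 0)")
      \<comment> \<open>At a common zero of the three forms both sides are 0, so the cleared
        identity holds there too.\<close>
      case True
      then show ?thesis unfolding b \<sigma>_def by simp
    next
      case False
      then show ?thesis using key[OF ac False xz(2)] unfolding b by blast
    qed
  qed
  have "\<sigma> u0 \<noteq> 0" using key[OF u0 nz ne] by blast
  moreover have "tot n p1" "tot n p2" using h by (simp_all add: hpoly_def)
  ultimately show ?thesis using that[of n \<sigma> s p1 p2] hs rel by blast
qed

lemma chart_regular:
  assumes f: "locmor f" and T: "T \<subseteq> A" "\<And>x z. (x, z) \<in> T \<Longrightarrow> f (pt (aff x z)) \<noteq> pt flex"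
  shows "regular_on T (\<lambda>x z. fst (co (f (pt (aff x z)))))" "regular_on T (\<lambda>x z. snd (co (f (pt (aff x z)))))"
proof -
  have main: "(\<exists>s p. bev x z s \<noteq> 0 \<and> (\<forall>(x', z')\<in>T. bev x' z' s * fst (co (f (pt (aff x' z')))) = bev x' z' p)) \<and>
      (\<exists>s q. bev x z s \<noteq> 0 \<and> (\<forall>(x', z')\<in>T. bev x' z' s * snd (co (f (pt (aff x' z')))) = bev x' z' q))"
    if xz: "(x, z) \<in> T" for x z
  proof -
    have ac: "aff x z \<in> cone" using xz T by (auto simp: aff_in_cone)
    obtain n \<sigma> s p q where s: "hpoly n \<sigma> s" "\<sigma> (aff x z) \<noteq> 0"
      and r: "\<And>x z. (x, z) \<in> A \<Longrightarrow> f (pt (aff x z)) \<noteq> pt flex \<Longrightarrow> bev x z s * fst (co (f (pt (aff x z)))) = bev x z p"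
      "\<And>x z. (x, z) \<in> A \<Longrightarrow> f (pt (aff x z)) \<noteq> pt flex \<Longrightarrow> bev x z s * snd (co (f (pt (aff x z)))) = bev x z q"
      by (rule chart_representation[OF f ac T(2)[OF xz]]) (rule that)
    have nz: "bev x z s \<noteq> 0" using s by (simp add: hpoly_def)
    have rel: "bev x' z' s * fst (co (f (pt (aff x' z')))) = bev x' z' p"
      "bev x' z' s * snd (co (f (pt (aff x' z')))) = bev x' z' q" if "(x', z') \<in> T" for x' z'
      using r[OF subsetD[OF T(1) that] T(2)[OF that]] .
    have "\<forall>(x', z')\<in>T. bev x' z' s * fst (co (f (pt (aff x' z')))) = bev x' z' p"
      by (rule ballI) (auto intro: rel(1) simp only: split_paired_all prod.case)
    moreover have "\<forall>(x', z')\<in>T. bev x' z' s * snd (co (f (pt (aff x' z')))) = bev x' z' q"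
      by (rule ballI) (auto intro: rel(2) simp only: split_paired_all prod.case)
    ultimately show ?thesis using nz by (intro conjI) (rule exI, rule exI, rule conjI, assumption, assumption)+
  qed
  show "regular_on T (\<lambda>x z. fst (co (f (pt (aff x z)))))"
    unfolding regular_on_def
  proof (rule ballI)
    fix P assume P: "P \<in> T"
    obtain x z where xz: "P = (x, z)" by (cases P)
    show "case P of (x, z) \<Rightarrow> \<exists>s p. bev x z s \<noteq> 0 \<and>
        (\<forall>(x', z')\<in>T. bev x' z' s * fst (co (f (pt (aff x' z')))) = bev x' z' p)"
      unfolding xz prod.case by (rule conjunct1[OF main[OF P[unfolded xz]]])
  qed
  show "regular_on T (\<lambda>x z. snd (co (f (pt (aff x z)))))"
    unfolding regular_on_def
  proof (rule ballI)
    fix P assume P: "P \<in> T"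
    obtain x z where xz: "P = (x, z)" by (cases P)
    show "case P of (x, z) \<Rightarrow> \<exists>s p. bev x z s \<noteq> 0 \<and>
        (\<forall>(x', z')\<in>T. bev x' z' s * snd (co (f (pt (aff x' z')))) = bev x' z' p)"
      unfolding xz prod.case by (rule conjunct2[OF main[OF P[unfolded xz]]])
  qed
qed

text \<open>The series argument is applied to the inverse g, whose coordinates have a pole at the
  image of the flex; f supplies the formula for z. The alternatives a = 0, b = 0, b = -1 describe
  the points of the chart with a vanishing coordinate.\<close>

lemma automorphism_flex_image:
  assumes f: "locmor f" and g: "locmor g"
    and fg: "\<And>P. P \<in> curve \<Longrightarrow> f (g P) = P"
    and ab: "(a, b) \<in> A" "f (pt flex) = pt (aff a b)"
  shows "a = 0 \<or> b = 0 \<or> b = -1"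
proof (rule ccontr)
  assume "\<not> ?thesis"
  then have nz: "a \<noteq> 0" "b \<noteq> 0" "b \<noteq> -1" by auto
  obtain y where y: "fps_nth y 0 = a" "y ^ d + (fps_const b + fps_X) ^ d = (fps_const b + fps_X + 1) ^ d"
    using local_branch[OF ab(1) nz(1)] by blast
  interpret br: fermat_branch d eps a b y
    by unfold_locales (use ab nz y in auto)
  have SA: "(x, z) \<in> A" if "(x, z) \<in> br.S" for x z using that by (simp add: br.S_def)
  note gc = locmor_closed[OF g]
  have gne: "g (pt (aff x z)) \<noteq> pt flex" if "(x, z) \<in> br.S" for x z
  proof
    assume "g (pt (aff x z)) = pt flex"
    moreover have "f (g (pt (aff x z))) = pt (aff x z)" by (rule fg[OF aff_in_curve[OF SA[OF that]]])
    ultimately have "pt (aff x z) = pt (aff a b)" using ab(2) by simp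
    then show False using that by (simp add: pt_aff_eq_iff br.S_def)
  qed
  have gflex: "g (pt flex) \<noteq> pt flex"
  proof
    assume "g (pt flex) = pt flex"
    then have "f (pt flex) = pt flex" using fg[OF flex_in_curve] by simp
    then show False using ab pt_aff_neq_flex by simp
  qed
  have fflex: "f (pt flex) \<noteq> pt flex" using ab pt_aff_neq_flex by simp
  let ?f = "\<lambda>x z. fst (co (g (pt (aff x z))))" and ?g = "\<lambda>x z. snd (co (g (pt (aff x z))))"
  have spec: "co (g (pt (aff x z))) \<in> A" "pt (aff (?f x z) (?g x z)) = g (pt (aff x z))" if "(x, z) \<in> br.S" for x z
    using co_spec[OF gc[OF aff_in_curve[OF SA[OF that]]] gne[OF that]] .
  obtain n \<sigma> s p q where s: "hpoly n \<sigma> s" "tot n p" "tot n q" "\<sigma> flex \<noteq> 0"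
    and r: "\<And>x z. (x, z) \<in> A \<Longrightarrow> g (pt (aff x z)) \<noteq> pt flex \<Longrightarrow> bev x z s * fst (co (g (pt (aff x z)))) = bev x z p"
      "\<And>x z. (x, z) \<in> A \<Longrightarrow> g (pt (aff x z)) \<noteq> pt flex \<Longrightarrow> bev x z s * snd (co (g (pt (aff x z)))) = bev x z q"
    by (rule chart_representation[OF g flex_in_cone gflex]) (rule that)
  obtain n' \<sigma>' s' p' q' where s': "hpoly n' \<sigma>' s'" "tot n' p'" "tot n' q'" "\<sigma>' flex \<noteq> 0"
    and r': "\<And>x z. (x, z) \<in> A \<Longrightarrow> f (pt (aff x z)) \<noteq> pt flex \<Longrightarrow> bev x z s' * fst (co (f (pt (aff x z)))) = bev x z p'"
      "\<And>x z. (x, z) \<in> A \<Longrightarrow> f (pt (aff x z)) \<noteq> pt flex \<Longrightarrow> bev x z s' * snd (co (f (pt (aff x z)))) = bev x z q'"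
    by (rule chart_representation[OF f flex_in_cone fflex]) (rule that)
  show False
  proof (rule br.no_map_to_nonflex[of ?f ?g n s p q n' s' q'])
    have BA: "br.S \<subseteq> A" by (auto simp: br.S_def)
    show "regular_on br.S ?f" "regular_on br.S ?g"
      by (rule chart_regular[OF g BA]; erule gne)+
    show "(?f x z, ?g x z) \<in> A" if "(x, z) \<in> br.S" for x z
      using spec(1)[OF that] by simp
    show "inj_on (\<lambda>(x, z). (?f x z, ?g x z)) br.S"
    proof (rule inj_onI)
      fix P P' assume P: "P \<in> br.S" "P' \<in> br.S" "(case P of (x, z) \<Rightarrow> (?f x z, ?g x z)) = (case P' of (x, z) \<Rightarrow> (?f x z, ?g x z))"
      obtain x z x' z' where xz: "P = (x, z)" "P' = (x', z')" by (cases P, cases P')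
      have S: "(x, z) \<in> br.S" "(x', z') \<in> br.S" using P(1,2) xz by simp_all
      have "?f x z = ?f x' z'" "?g x z = ?g x' z'" using P(3) by (simp_all add: xz)
      then have "g (pt (aff x z)) = g (pt (aff x' z'))"
        using spec(2)[OF S(1)] spec(2)[OF S(2)] by metis
      then have "pt (aff x z) = pt (aff x' z')"
        using fg[OF aff_in_curve[OF SA[OF S(1)]]] fg[OF aff_in_curve[OF SA[OF S(2)]]] by metis
      then show "P = P'" by (simp add: xz pt_aff_eq_iff)
    qed
    show "tot n s" "top_coeff n s \<noteq> 0" "tot n p" "tot n q" "tot n' s'" "top_coeff n' s' \<noteq> 0"
      using s s' by (simp_all add: hpoly_def)
    show "bev x z s * ?f x z = bev x z p" "bev x z s * ?g x z = bev x z q" if "(x, z) \<in> br.S" for x z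
      using r[OF SA[OF that] gne[OF that]] .
    show "bev (?f x z) (?g x z) s' * z = bev (?f x z) (?g x z) q'" if xz: "(x, z) \<in> br.S" for x z
    proof -
      have fa: "f (pt (aff (?f x z) (?g x z))) = pt (aff x z)"
        unfolding spec(2)[OF xz] by (rule fg[OF aff_in_curve[OF SA[OF xz]]])
      have "(?f x z, ?g x z) \<in> A" using spec(1)[OF xz] by simp
      moreover have "f (pt (aff (?f x z) (?g x z))) \<noteq> pt flex"
        unfolding fa by (rule pt_aff_neq_flex)
      ultimately have "bev (?f x z) (?g x z) s' * snd (co (f (pt (aff (?f x z) (?g x z))))) = bev (?f x z) (?g x z) q'"
        by (rule r'(2))
      then show ?thesis unfolding fa co_aff[OF SA[OF xz]] by simp
    qed
  qed (use nz in simp_all)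
qed

lemma automorphism_fixing_flex_points:
  assumes f: "locmor f" and g: "locmor g"
    and fg: "\<And>P. P \<in> curve \<Longrightarrow> f (g P) = P" and gf: "\<And>P. P \<in> curve \<Longrightarrow> g (f P) = P"
    and fl: "f (pt flex) = pt flex"
  obtains \<delta> where "\<delta> ^ d = 1" "\<And>x z. (x, z) \<in> A \<Longrightarrow> f (pt (aff x z)) = pt (aff (\<delta> * x) z)"
    | \<delta> where "\<delta> ^ d = (-1) ^ (d - 1)" "\<And>x z. (x, z) \<in> A \<Longrightarrow> f (pt (aff x z)) = pt (aff (\<delta> * x) (- z - 1))"
proof -
  have gfl: "g (pt flex) = pt flex" using gf[OF flex_in_curve] fl by simp
  note fc = locmor_closed[OF f] and gc = locmor_closed[OF g]
  have fne: "f (pt (aff x z)) \<noteq> pt flex" if "(x, z) \<in> A" for x z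
    using gf[OF aff_in_curve[OF that]] gfl pt_aff_neq_flex by metis
  have gne: "g (pt (aff x z)) \<noteq> pt flex" if "(x, z) \<in> A" for x z
    using fg[OF aff_in_curve[OF that]] fl pt_aff_neq_flex by metis
  let ?f = "\<lambda>x z. fst (co (f (pt (aff x z))))" and ?g = "\<lambda>x z. snd (co (f (pt (aff x z))))"
  let ?f' = "\<lambda>x z. fst (co (g (pt (aff x z))))" and ?g' = "\<lambda>x z. snd (co (g (pt (aff x z))))"
  have fs: "co (f (pt (aff x z))) \<in> A" "pt (aff (?f x z) (?g x z)) = f (pt (aff x z))" if "(x, z) \<in> A" for x z
    using co_spec[OF fc[OF aff_in_curve[OF that]] fne[OF that]] .
  have gs: "co (g (pt (aff x z))) \<in> A" "pt (aff (?f' x z) (?g' x z)) = g (pt (aff x z))" if "(x, z) \<in> A" for x z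
    using co_spec[OF gc[OF aff_in_curve[OF that]] gne[OF that]] .
  have "\<exists>\<delta>. (\<delta> ^ d = 1 \<and> (\<forall>(x, z)\<in>A. ?f x z = \<delta> * x \<and> ?g x z = z)) \<or>
    (\<delta> ^ d = (-1) ^ (d - 1) \<and> (\<forall>(x, z)\<in>A. ?f x z = \<delta> * x \<and> ?g x z = - z - 1))"
  proof (rule automorphism_fixing_flex[of ?f ?g ?f' ?g'])
    show "regular_on A ?f" "regular_on A ?g"
      by (rule chart_regular[OF f order_refl]; erule fne)+
    show "regular_on A ?f'" "regular_on A ?g'"
      by (rule chart_regular[OF g order_refl]; erule gne)+
    show "(?f x z, ?g x z) \<in> A" if "(x, z) \<in> A" for x z using fs(1)[OF that] by simp
    show "(?f' x z, ?g' x z) \<in> A" if "(x, z) \<in> A" for x z using gs(1)[OF that] by simp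
    show "?f' (?f x z) (?g x z) = x \<and> ?g' (?f x z) (?g x z) = z" if "(x, z) \<in> A" for x z
      unfolding fs(2)[OF that] gf[OF aff_in_curve[OF that]] co_aff[OF that] by simp
    show "?g (?f' x z) (?g' x z) = z" if "(x, z) \<in> A" for x z
      unfolding gs(2)[OF that] fg[OF aff_in_curve[OF that]] co_aff[OF that] by simp
  qed
  then obtain \<delta> where "(\<delta> ^ d = 1 \<and> (\<forall>(x, z)\<in>A. ?f x z = \<delta> * x \<and> ?g x z = z)) \<or>
    (\<delta> ^ d = (-1) ^ (d - 1) \<and> (\<forall>(x, z)\<in>A. ?f x z = \<delta> * x \<and> ?g x z = - z - 1))" by blast
  then show ?thesis
  proof (elim disjE conjE)
    assume \<delta>: "\<delta> ^ d = 1" and e: "\<forall>(x, z)\<in>A. ?f x z = \<delta> * x \<and> ?g x z = z"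
    show ?thesis
    proof (rule that(1)[OF \<delta>])
      fix x z assume xz: "(x, z) \<in> A"
      then have "?f x z = \<delta> * x" "?g x z = z" using e by auto
      then show "f (pt (aff x z)) = pt (aff (\<delta> * x) z)" using fs(2)[OF xz] by metis
    qed
  next
    assume \<delta>: "\<delta> ^ d = (-1) ^ (d - 1)" and e: "\<forall>(x, z)\<in>A. ?f x z = \<delta> * x \<and> ?g x z = - z - 1"
    show ?thesis
    proof (rule that(2)[OF \<delta>])
      fix x z assume xz: "(x, z) \<in> A"
      then have "?f x z = \<delta> * x" "?g x z = - z - 1" using e by auto
      then show "f (pt (aff x z)) = pt (aff (\<delta> * x) (- z - 1))" using fs(2)[OF xz] by metis
    qed
  qed
qed

end

section \<open>Monomial automorphisms\<close>

text \<open>Coordinates are indexed by {1..3}, the set on which \<open>sym_group 3\<close>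
  acts.\<close>

definition cd :: "'a triple \<Rightarrow> nat \<Rightarrow> 'a" where
  "cd u i = (if i = 1 then fst u else if i = 2 then fst (snd u) else snd (snd u))"

lemma interval_3: "{1..3::nat} = {1, 2, 3}" "{Suc 0..3} = {1, 2, 3}"
  by auto

lemma cd_simps [simp]: "cd (x, y, z) 1 = x" "cd (x, y, z) (Suc 0) = x" "cd (x, y, z) 2 = y" "cd (x, y, z) 3 = z"
  by (simp_all add: cd_def)

lemma triple_eq_iff: "u = v \<longleftrightarrow> (\<forall>i\<in>{1..3}. cd u i = cd v i)"
  by (cases u; cases v) (auto simp: interval_3)

lemma triple_nz_iff: "v \<noteq> (0, 0, 0) \<longleftrightarrow> (\<exists>i\<in>{1..3}. cd v i \<noteq> 0)"
  by (cases v) (auto simp: interval_3)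

lemma cd_sc [simp]: "cd (sc c u) i = c * cd u i"
  by (cases u) (auto simp: cd_def)

lemma linear_form_cd: "linear_form (\<lambda>u. k * cd u i)"
  unfolding linear_form_def
  by (rule exI[of _ "if i = 1 then k else 0"], rule exI[of _ "if i = 1 then 0 else if i = 2 then k else 0"],
      rule exI[of _ "if i = 1 then 0 else if i = 2 then 0 else k"]) (auto simp: cd_def)

definition mact :: "(nat \<Rightarrow> nat) \<Rightarrow> (nat \<Rightarrow> 'a::field) \<Rightarrow> 'a triple \<Rightarrow> 'a triple" where
  "mact \<sigma> c u = (c 1 * cd u (\<sigma> 1), c 2 * cd u (\<sigma> 2), c 3 * cd u (\<sigma> 3))"

lemma cd_mact: "i \<in> {1..3} \<Longrightarrow> cd (mact \<sigma> c u) i = c i * cd u (\<sigma> i)"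
  by (auto simp: interval_3 mact_def)

lemma mact_sc: "mact \<sigma> c (sc k u) = sc k (mact \<sigma> c u)"
  by (simp add: mact_def mult.left_commute)

lemma linear_map_mact: "linear_map (mact \<sigma> c)"
  by (simp add: linear_map_def mact_def linear_form_cd)

text \<open>Coordinates are pulled back, so the permutations compose in the opposite order.\<close>

lemma mact_comp:
  assumes "\<sigma> permutes {1..3}"
  shows "mact \<sigma> c (mact \<tau> e u) = mact (\<tau> \<circ> \<sigma>) (\<lambda>i. c i * e (\<sigma> i)) u"
  unfolding triple_eq_iff
proof
  fix i :: nat assume i: "i \<in> {1..3}"
  then have "\<sigma> i \<in> {1..3}" using assms permutes_in_image by fastforce
  then show "cd (mact \<sigma> c (mact \<tau> e u)) i = cd (mact (\<tau> \<circ> \<sigma>) (\<lambda>i. c i * e (\<sigma> i)) u) i"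
    using i by (simp add: cd_mact)
qed

context fermat_curve
begin

definition roots3 :: "(nat \<Rightarrow> 'a) \<Rightarrow> bool" where "roots3 c \<longleftrightarrow> (\<forall>i\<in>{1..3}. c i ^ d = 1)"

lemma roots3_nz: "roots3 c \<Longrightarrow> i \<in> {1..3} \<Longrightarrow> c i \<noteq> 0"
proof
  assume "roots3 c" "i \<in> {1..3}" "c i = 0"
  then have "(0::'a) ^ d = 1" unfolding roots3_def by metis
  then show False using d4 by (simp add: power_0_left)
qed

lemma cone_iff: "u \<in> cone \<longleftrightarrow> (\<Sum>i\<in>{1..3}. cd u i ^ d) = 0 \<and> (\<exists>i\<in>{1..3}. cd u i \<noteq> 0)"
  by (cases u) (auto simp: cone_def interval_3 add.assoc)

lemma mact_cone:
  assumes \<sigma>: "\<sigma> permutes {1..3}" and c: "roots3 c" and u: "u \<in> cone"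
  shows "mact \<sigma> c u \<in> cone"
proof -
  have "(\<Sum>i\<in>{1..3}. cd (mact \<sigma> c u) i ^ d) = (\<Sum>i\<in>{1..3}. cd u (\<sigma> i) ^ d)"
    using c by (intro sum.cong refl) (simp add: cd_mact power_mult_distrib roots3_def)
  also have "\<dots> = (\<Sum>i\<in>{1..3}. cd u i ^ d)"
    using sum.permute[OF \<sigma>, of "\<lambda>i. cd u i ^ d"] by (simp add: o_def)
  finally have "(\<Sum>i\<in>{1..3}. cd (mact \<sigma> c u) i ^ d) = 0" using u by (simp add: cone_iff)
  moreover obtain i where i: "i \<in> {1..3}" "cd u i \<noteq> 0" using u by (auto simp: cone_iff)
  then obtain j where j: "j \<in> {1..3}" "\<sigma> j = i"
    using permutes_image[OF \<sigma>] by (metis imageE)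
  have "cd (mact \<sigma> c u) j \<noteq> 0" using i j roots3_nz[OF c j(1)] by (simp add: cd_mact)
  ultimately show ?thesis using j(1) unfolding cone_iff by blast
qed

text \<open>Well defined on points since \<open>mact\<close> commutes with scalars; the restriction
  follows the convention that elements of \<open>Aut\<close> are undefined off the curve.\<close>

definition mon :: "(nat \<Rightarrow> nat) \<Rightarrow> (nat \<Rightarrow> 'a) \<Rightarrow> 'a point \<Rightarrow> 'a point" where
  "mon \<sigma> c = (\<lambda>P\<in>curve. pt (mact \<sigma> c (L (SOME v. v \<in> P))))"

lemma mon_pt: "u \<in> cone \<Longrightarrow> mon \<sigma> c (pt u) = pt (mact \<sigma> c u)"
proof -
  assume u: "u \<in> cone"
  have "(SOME v. v \<in> pt u) \<in> pt u"
    unfolding pt_def by (rule someI[of "\<lambda>v. v \<in> proj (Li u)", OF self_in_proj])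
  then obtain k where k: "k \<noteq> 0" "(SOME v. v \<in> pt u) = sc k (Li u)"
    unfolding pt_def mem_proj_iff by blast
  have "L (sc k (Li u)) = sc k u" using linear_map_sc[OF lin_L] by simp
  then have "mon \<sigma> c (pt u) = pt (sc k (mact \<sigma> c u))"
    using u by (simp add: mon_def pt_in_curve k(2) mact_sc)
  then show ?thesis using pt_sc[OF k(1)] by simp
qed

lemma curve_pt: "P \<in> curve \<Longrightarrow> \<exists>u\<in>cone. P = pt u"
  unfolding curve_def by blast

lemma mon_closed:
  assumes "\<sigma> permutes {1..3}" "roots3 c" "P \<in> curve"
  shows "mon \<sigma> c P \<in> curve"
proof -
  obtain u where "u \<in> cone" "P = pt u" using curve_pt[OF assms(3)] by blast
  then show ?thesis using mact_cone[OF assms(1,2)] by (simp add: mon_pt pt_in_curve)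
qed

lemma mon_morphism:
  assumes \<sigma>: "\<sigma> permutes {1..3}" and c: "roots3 c"
  shows "curve_morphism curve (mon \<sigma> c)"
proof (rule linear_curve_morphism[where T = "\<lambda>v. Li (mact \<sigma> c (L v))"])
  show "linear_map (\<lambda>v. Li (mact \<sigma> c (L v)))"
    by (rule linear_map_comp[OF lin_Li linear_map_comp[OF linear_map_mact lin_L]])
  show "Li (mact \<sigma> c (L v)) \<noteq> (0, 0, 0)" if v: "v \<noteq> (0, 0, 0)" for v
  proof (rule Li_nz)
    from triple_nz_iff[THEN iffD1, OF L_nz[OF v]]
    obtain i where i: "i \<in> {1..3}" "cd (L v) i \<noteq> 0" by (rule bexE)
    then obtain j where j: "j \<in> {1..3}" "\<sigma> j = i"
      using permutes_image[OF \<sigma>] by (metis imageE)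
    have "cd (mact \<sigma> c (L v)) j \<noteq> 0" using i j roots3_nz[OF c j(1)] by (simp add: cd_mact)
    then show "mact \<sigma> c (L v) \<noteq> (0, 0, 0)"
      by (rule triple_nz_iff[THEN iffD2, OF bexI]) (rule j(1))
  qed
  show "curve \<subseteq> P2" by (rule curve_P2)
  show "mon \<sigma> c ` curve \<subseteq> curve" by (rule image_subsetI) (rule mon_closed[OF \<sigma> c])
  show "mon \<sigma> c (proj v) = proj (Li (mact \<sigma> c (L v)))" if "proj v \<in> curve" for v
  proof -
    have e: "proj v = pt (L v)" by (simp add: pt_def)
    then have "L v \<in> cone" using that pt_in_curve by simp
    then have "mon \<sigma> c (pt (L v)) = pt (mact \<sigma> c (L v))" by (rule mon_pt)
    also have "\<dots> = proj (Li (mact \<sigma> c (L v)))" by (rule pt_def)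
    finally show ?thesis by (simp only: e)
  qed
qed

lemma mon_comp:
  assumes "\<sigma> permutes {1..3}" "\<tau> permutes {1..3}" "roots3 c" "roots3 e" "P \<in> curve"
  shows "mon \<sigma> c (mon \<tau> e P) = mon (\<tau> \<circ> \<sigma>) (\<lambda>i. c i * e (\<sigma> i)) P"
proof -
  obtain u where "u \<in> cone" "P = pt u" using curve_pt[OF assms(5)] by blast
  then show ?thesis using mact_cone[OF assms(2,4)] by (simp add: mon_pt mact_comp[OF assms(1)])
qed

lemma mon_eqI:
  assumes "\<And>i. i \<in> {1..3} \<Longrightarrow> c i = e i"
  shows "mon \<sigma> c = mon \<sigma> e"
  unfolding mon_def mact_def using assms by (simp add: interval_3)

lemma mon_id: "P \<in> curve \<Longrightarrow> mon id (\<lambda>_. 1) P = P"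
proof -
  assume "P \<in> curve"
  then obtain u where "u \<in> cone" "P = pt u" using curve_pt by blast
  moreover have "mact id (\<lambda>_. 1) u = u" unfolding triple_eq_iff by (simp add: cd_mact)
  ultimately show ?thesis by (simp add: mon_pt)
qed

lemma roots3_mult:
  assumes "\<sigma> permutes {1..3}" "roots3 c" "roots3 e"
  shows "roots3 (\<lambda>i. c i * e (\<sigma> i))"
  unfolding roots3_def
proof
  fix i :: nat assume i: "i \<in> {1..3}"
  then have "\<sigma> i \<in> {1..3}" using assms(1) permutes_in_image by fastforce
  then show "(c i * e (\<sigma> i)) ^ d = 1" using assms i by (simp add: roots3_def power_mult_distrib)
qed

lemma mon_inverse:
  assumes \<sigma>: "\<sigma> permutes {1..3}" and c: "roots3 c"
  obtains \<sigma>' c' where "\<sigma>' permutes {1..3}" "roots3 c'"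
    "\<And>P. P \<in> curve \<Longrightarrow> mon \<sigma> c (mon \<sigma>' c' P) = P" "\<And>P. P \<in> curve \<Longrightarrow> mon \<sigma>' c' (mon \<sigma> c P) = P"
proof -
  define \<sigma>' where "\<sigma>' = inv_into UNIV \<sigma>"
  define c' where "c' = (\<lambda>i. 1 / c (\<sigma>' i))"
  have \<sigma>': "\<sigma>' permutes {1..3}" unfolding \<sigma>'_def by (rule permutes_inv[OF \<sigma>])
  have inv: "\<sigma>' \<circ> \<sigma> = id" "\<sigma> \<circ> \<sigma>' = id"
    unfolding \<sigma>'_def using permutes_inv_o[OF \<sigma>] by simp_all
  have in3: "\<sigma>' i \<in> {1..3}" if "i \<in> {1..3}" for i using that \<sigma>' permutes_in_image by fastforce
  have c': "roots3 c'"
    unfolding roots3_def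
  proof
    fix i :: nat assume "i \<in> {1..3}"
    then have "c (\<sigma>' i) ^ d = 1" using c in3 by (simp add: roots3_def)
    then show "c' i ^ d = 1" by (simp add: c'_def power_divide)
  qed
  have 1: "mon (\<sigma>' \<circ> \<sigma>) (\<lambda>i. c i * c' (\<sigma> i)) = mon id (\<lambda>_. 1)"
  proof -
    have "\<sigma>' (\<sigma> i) = i" for i using inv(1) by (metis comp_apply id_apply)
    then show ?thesis unfolding inv using roots3_nz[OF c] by (intro mon_eqI) (simp add: c'_def)
  qed
  have 2: "mon (\<sigma> \<circ> \<sigma>') (\<lambda>i. c' i * c (\<sigma>' i)) = mon id (\<lambda>_. 1)"
    unfolding inv using roots3_nz[OF c in3] by (intro mon_eqI) (simp add: c'_def)
  show ?thesis
  proof (rule that[OF \<sigma>' c'])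
    show "mon \<sigma> c (mon \<sigma>' c' P) = P" if "P \<in> curve" for P
      unfolding mon_comp[OF \<sigma> \<sigma>' c c' that] 1 by (rule mon_id[OF that])
    show "mon \<sigma>' c' (mon \<sigma> c P) = P" if "P \<in> curve" for P
      unfolding mon_comp[OF \<sigma>' \<sigma> c' c that] 2 by (rule mon_id[OF that])
  qed
qed

lemma mon_in_Aut:
  assumes \<sigma>: "\<sigma> permutes {1..3}" and c: "roots3 c"
  shows "mon \<sigma> c \<in> carrier (Aut curve)"
proof -
  obtain \<sigma>' c' where s: "\<sigma>' permutes {1..3}" "roots3 c'"
    and inv: "\<And>P. P \<in> curve \<Longrightarrow> mon \<sigma> c (mon \<sigma>' c' P) = P" "\<And>P. P \<in> curve \<Longrightarrow> mon \<sigma>' c' (mon \<sigma> c P) = P"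
    using mon_inverse[OF \<sigma> c] by metis
  have bij: "bij_betw (mon \<sigma> c) curve curve"
  proof (rule bij_betw_byWitness[of _ "mon \<sigma>' c'"])
    show "mon \<sigma> c ` curve \<subseteq> curve" by (rule image_subsetI) (rule mon_closed[OF \<sigma> c])
    show "mon \<sigma>' c' ` curve \<subseteq> curve" by (rule image_subsetI) (rule mon_closed[OF s])
  qed (simp_all add: inv)
  have ext: "mon \<tau> e \<in> extensional curve" for \<tau> e by (simp add: mon_def)
  have "restrict (inv_into curve (mon \<sigma> c)) curve = mon \<sigma>' c'"
  proof (rule extensionalityI[of _ curve])
    fix P assume P: "P \<in> curve"
    have "inv_into curve (mon \<sigma> c) P = mon \<sigma>' c' P"
      by (rule inv_into_f_eq[OF bij_betw_imp_inj_on[OF bij] mon_closed[OF s P] inv(1)[OF P]])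
    then show "restrict (inv_into curve (mon \<sigma> c)) curve P = mon \<sigma>' c' P" using P by simp
  qed (simp_all add: ext)
  then show ?thesis
    using bij ext[of \<sigma> c] mon_morphism[OF \<sigma> c] mon_morphism[OF s] unfolding Aut_def Bij_def by simp
qed

text \<open>Together with \<open>locmor_mon_right\<close> this allows an automorphism to be
  corrected by monomial maps until it fixes the flex.\<close>

lemma locmor_mon_left:
  assumes \<sigma>: "\<sigma> permutes {1..3}" and c: "roots3 c" and f: "locmor f"
  shows "locmor (\<lambda>P. mon \<sigma> c (f P))"
  unfolding locmor_def
proof (intro conjI ballI)
  show "(\<lambda>P. mon \<sigma> c (f P)) ` curve \<subseteq> curve" using locmor_closed[OF f] mon_closed[OF \<sigma> c] by blast
  fix u0 assume u0: "u0 \<in> cone"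
  obtain n \<phi>1 \<phi>2 \<phi>3 where h: "homf n \<phi>1" "homf n \<phi>2" "homf n \<phi>3" and nz: "(\<phi>1 u0, \<phi>2 u0, \<phi>3 u0) \<noteq> (0, 0, 0)"
    and rep: "\<And>u. u \<in> cone \<Longrightarrow> (\<phi>1 u, \<phi>2 u, \<phi>3 u) \<noteq> (0, 0, 0) \<Longrightarrow> f (pt u) = pt (\<phi>1 u, \<phi>2 u, \<phi>3 u)"
    using bspec[OF conjunct2[OF f[unfolded locmor_def]] u0] by metis
  define \<Phi> where "\<Phi> = (\<lambda>u. (\<phi>1 u, \<phi>2 u, \<phi>3 u))"
  have hc: "homf n (\<lambda>u. k * cd (\<Phi> u) i)" for k i
    unfolding cd_def \<Phi>_def fst_conv snd_conv by (cases "i = 1"; cases "i = 2") (simp_all add: homf_scale h)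
  have cone: "\<Phi> u \<in> cone" if u: "u \<in> cone" "\<Phi> u \<noteq> (0, 0, 0)" for u
  proof -
    have "f (pt u) \<in> curve" using u(1) locmor_closed[OF f] pt_in_curve by blast
    then show ?thesis using rep[OF u[unfolded \<Phi>_def]] pt_in_curve unfolding \<Phi>_def by metis
  qed
  have nz_iff: "\<Phi> u \<noteq> (0, 0, 0)" if "mact \<sigma> c (\<Phi> u) \<noteq> (0, 0, 0)" for u
    using that linear_map_0[OF linear_map_mact] by metis
  show "\<exists>n \<phi>1 \<phi>2 \<phi>3. homf n \<phi>1 \<and> homf n \<phi>2 \<and> homf n \<phi>3 \<and> (\<phi>1 u0, \<phi>2 u0, \<phi>3 u0) \<noteq> (0, 0, 0) \<and>
    (\<forall>u\<in>cone. (\<phi>1 u, \<phi>2 u, \<phi>3 u) \<noteq> (0, 0, 0) \<longrightarrow> mon \<sigma> c (f (pt u)) = pt (\<phi>1 u, \<phi>2 u, \<phi>3 u))"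
  proof (rule exI[of _ n], rule exI[of _ "\<lambda>u. c 1 * cd (\<Phi> u) (\<sigma> 1)"], rule exI[of _ "\<lambda>u. c 2 * cd (\<Phi> u) (\<sigma> 2)"],
      rule exI[of _ "\<lambda>u. c 3 * cd (\<Phi> u) (\<sigma> 3)"], intro conjI ballI impI hc, fold mact_def)
    have "\<Phi> u0 \<in> cone" using cone[OF u0] nz by (simp add: \<Phi>_def)
    then show "mact \<sigma> c (\<Phi> u0) \<noteq> (0, 0, 0)" using mact_cone[OF \<sigma> c] cone_nz by blast
    fix u assume u: "u \<in> cone" "mact \<sigma> c (\<Phi> u) \<noteq> (0, 0, 0)"
    have "f (pt u) = pt (\<Phi> u)" using rep[OF u(1)] nz_iff[OF u(2)] unfolding \<Phi>_def by blast
    then show "mon \<sigma> c (f (pt u)) = pt (mact \<sigma> c (\<Phi> u))"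
      using mon_pt[OF cone[OF u(1) nz_iff[OF u(2)]]] by simp
  qed
qed

lemma locmor_mon_right:
  assumes \<sigma>: "\<sigma> permutes {1..3}" and c: "roots3 c" and f: "locmor f"
  shows "locmor (\<lambda>P. f (mon \<sigma> c P))"
  unfolding locmor_def
proof (intro conjI ballI)
  show "(\<lambda>P. f (mon \<sigma> c P)) ` curve \<subseteq> curve" using locmor_closed[OF f] mon_closed[OF \<sigma> c] by blast
  fix u0 assume u0: "u0 \<in> cone"
  obtain n \<phi>1 \<phi>2 \<phi>3 where h: "homf n \<phi>1" "homf n \<phi>2" "homf n \<phi>3"
    and nz: "(\<phi>1 (mact \<sigma> c u0), \<phi>2 (mact \<sigma> c u0), \<phi>3 (mact \<sigma> c u0)) \<noteq> (0, 0, 0)"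
    and rep: "\<And>u. u \<in> cone \<Longrightarrow> (\<phi>1 u, \<phi>2 u, \<phi>3 u) \<noteq> (0, 0, 0) \<Longrightarrow> f (pt u) = pt (\<phi>1 u, \<phi>2 u, \<phi>3 u)"
    using bspec[OF conjunct2[OF f[unfolded locmor_def]] mact_cone[OF \<sigma> c u0]] by metis
  note hm = h[THEN homf_comp, OF linear_map_mact[of \<sigma> c]]
  show "\<exists>n \<phi>1 \<phi>2 \<phi>3. homf n \<phi>1 \<and> homf n \<phi>2 \<and> homf n \<phi>3 \<and> (\<phi>1 u0, \<phi>2 u0, \<phi>3 u0) \<noteq> (0, 0, 0) \<and>
    (\<forall>u\<in>cone. (\<phi>1 u, \<phi>2 u, \<phi>3 u) \<noteq> (0, 0, 0) \<longrightarrow> f (mon \<sigma> c (pt u)) = pt (\<phi>1 u, \<phi>2 u, \<phi>3 u))"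
  proof (rule exI[of _ n], rule exI[of _ "\<lambda>u. \<phi>1 (mact \<sigma> c u)"], rule exI[of _ "\<lambda>u. \<phi>2 (mact \<sigma> c u)"],
      rule exI[of _ "\<lambda>u. \<phi>3 (mact \<sigma> c u)"], intro conjI ballI impI hm nz)
    fix u assume u: "u \<in> cone" "(\<phi>1 (mact \<sigma> c u), \<phi>2 (mact \<sigma> c u), \<phi>3 (mact \<sigma> c u)) \<noteq> (0, 0, 0)"
    show "f (mon \<sigma> c (pt u)) = pt (\<phi>1 (mact \<sigma> c u), \<phi>2 (mact \<sigma> c u), \<phi>3 (mact \<sigma> c u))"
      unfolding mon_pt[OF u(1)] by (rule rep[OF mact_cone[OF \<sigma> c u(1)] u(2)])
  qed
qed

text \<open>The points with a vanishing coordinate are the flexes.\<close>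

lemma move_to_flex:
  assumes u: "u \<in> cone" and i: "i \<in> {1..3}" "cd u i = 0"
  obtains \<sigma> c where "\<sigma> permutes {1..3}" "roots3 c" "mon \<sigma> c (pt u) = pt flex"
proof -
  \<comment> \<open>Brings the vanishing coordinate to the first place.\<close>
  define \<sigma> where "\<sigma> = Transposition.transpose 1 i"
  have \<sigma>: "\<sigma> permutes {1..3}" unfolding \<sigma>_def using i by (intro permutes_swap_id) auto
  have \<sigma>1: "\<sigma> 1 = i" by (simp add: \<sigma>_def)
  have "(\<Sum>j\<in>{1..3}. cd u (\<sigma> j) ^ d) = (\<Sum>j\<in>{1..3}. cd u j ^ d)"
    using sum.permute[OF \<sigma>, of "\<lambda>i. cd u i ^ d"] by (simp add: o_def)
  then have "(\<Sum>j\<in>{1..3}. cd u (\<sigma> j) ^ d) = 0" using u by (simp add: cone_iff)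
  then have s: "cd u (\<sigma> 2) ^ d + cd u (\<sigma> 3) ^ d = 0"
    using \<sigma>1 i(2) d4 by (simp add: interval_3 power_0_left)
  have nz: "cd u (\<sigma> 2) \<noteq> 0 \<and> cd u (\<sigma> 3) \<noteq> 0"
  proof (rule ccontr)
    assume "\<not> ?thesis"
    then have "cd u (\<sigma> 2) = 0 \<and> cd u (\<sigma> 3) = 0" using s d4 by (auto simp: power_0_left)
    then have "\<forall>j\<in>{1..3}. cd u (\<sigma> j) = 0" using \<sigma>1 i(2) by (auto simp: interval_3)
    then have "\<forall>j\<in>\<sigma> ` {1..3}. cd u j = 0" by blast
    then show False using u unfolding permutes_image[OF \<sigma>] cone_iff by blast
  qed
  \<comment> \<open>The factor that makes the last two coordinates proportional to (1, eps). It is a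
    d-th root of unity, as their d-th powers add up to 0 and eps^d = -1.\<close>
  define c where "c = (\<lambda>j::nat. if j = 3 then eps * cd u (\<sigma> 2) / cd u (\<sigma> 3) else 1)"
  have c: "roots3 c"
  proof -
    have "cd u (\<sigma> 2) ^ d = - (cd u (\<sigma> 3) ^ d)" using s by (simp add: eq_neg_iff_add_eq_0)
    then have "(eps * cd u (\<sigma> 2) / cd u (\<sigma> 3)) ^ d = 1"
      using nz by (simp add: power_divide power_mult_distrib eps)
    then show ?thesis by (simp add: roots3_def c_def)
  qed
  have "mact \<sigma> c u = sc (cd u (\<sigma> 2)) flex"
    using nz \<sigma>1 i(2) by (simp add: mact_def c_def flex_def)
  then have "mon \<sigma> c (pt u) = pt flex" using u nz by (simp add: mon_pt pt_sc)
  then show ?thesis using that \<sigma> c by blast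
qed

theorem Aut_monomial:
  assumes "f \<in> carrier (Aut curve)"
  shows "\<exists>\<sigma> c. \<sigma> permutes {1..3} \<and> roots3 c \<and> f = mon \<sigma> c"
proof -
  define g where "g = restrict (inv_into curve f) curve"
  have f: "f \<in> extensional curve" "bij_betw f curve curve" "curve_morphism curve f" "curve_morphism curve g"
    using assms by (simp_all add: Aut_def Bij_def g_def)
  note lf = curve_morphism_locmor[OF f(3)] and lg = curve_morphism_locmor[OF f(4)]
  have fg: "f (g P) = P" if "P \<in> curve" for P
    using that f(2) by (simp add: g_def bij_betw_inv_into_right)
  have gf: "g (f P) = P" if "P \<in> curve" for P
    using that f(2) locmor_closed[OF lf that] by (simp add: g_def bij_betw_inv_into_left)
  have "f (pt flex) \<in> curve" by (rule locmor_closed[OF lf flex_in_curve])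
  then obtain u i where u: "u \<in> cone" "f (pt flex) = pt u" "i \<in> {1..3}" "cd u i = 0"
  proof (cases rule: curve_cases)
    case 1
    then show ?thesis using that[of flex 1] flex_in_cone by (simp add: flex_def)
  next
    case (2 a b)
    have "a = 0 \<or> b = 0 \<or> b = -1" by (rule automorphism_flex_image[OF lf lg fg 2])
    then have "\<exists>i\<in>{1..3}. cd (aff a b) i = 0" by (auto simp: interval_3 aff_def)
    then show ?thesis using that[of "aff a b"] 2 by (auto simp: aff_in_cone)
  qed
  obtain \<sigma> c where s: "\<sigma> permutes {1..3}" "roots3 c" "mon \<sigma> c (pt u) = pt flex"
    by (rule move_to_flex[OF u(1,3,4)])
  obtain \<sigma>' c' where s': "\<sigma>' permutes {1..3}" "roots3 c'"
    and inv: "\<And>P. P \<in> curve \<Longrightarrow> mon \<sigma> c (mon \<sigma>' c' P) = P" "\<And>P. P \<in> curve \<Longrightarrow> mon \<sigma>' c' (mon \<sigma> c P) = P"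
    using mon_inverse[OF s(1,2)] by metis
  \<comment> \<open>The correction by a monomial map turns f into an automorphism fixing the
    flex.\<close>
  define f1 where "f1 = (\<lambda>P. mon \<sigma> c (f P))"
  define g1 where "g1 = (\<lambda>P. g (mon \<sigma>' c' P))"
  have l1: "locmor f1" "locmor g1"
    unfolding f1_def g1_def by (rule locmor_mon_left[OF s(1,2) lf], rule locmor_mon_right[OF s' lg])
  have fg1: "f1 (g1 P) = P" if "P \<in> curve" for P
    using that fg[OF mon_closed[OF s' that]] inv(1) by (simp add: f1_def g1_def)
  have gf1: "g1 (f1 P) = P" if "P \<in> curve" for P
    using that gf inv(2)[OF locmor_closed[OF lf that]] by (simp add: f1_def g1_def)
  have fl: "f1 (pt flex) = pt flex" using u(2) s(3) by (simp add: f1_def)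
  have "\<exists>\<tau> e. \<tau> permutes {1..3} \<and> roots3 e \<and> (\<forall>P\<in>curve. f1 P = mon \<tau> e P)"
  proof (rule automorphism_fixing_flex_points[OF l1 fg1 gf1 fl])
    fix \<delta> assume \<delta>: "\<delta> ^ d = 1" and af: "\<And>x z. (x, z) \<in> A \<Longrightarrow> f1 (pt (aff x z)) = pt (aff (\<delta> * x) z)"
    define e where "e = (\<lambda>i::nat. if i = 1 then \<delta> else 1)"
    have "f1 P = mon id e P" if "P \<in> curve" for P
      using that
    proof (cases rule: curve_cases)
      case 1
      have "mact id e flex = flex" by (simp add: mact_def flex_def e_def)
      then show ?thesis using fl 1 flex_in_cone by (simp add: mon_pt)
    next
      case (2 x z)
      have "mact id e (aff x z) = aff (\<delta> * x) z" by (simp add: mact_def aff_def e_def)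
      then show ?thesis using 2 af aff_in_cone by (simp add: mon_pt)
    qed
    moreover have "roots3 e" using \<delta> by (simp add: roots3_def e_def)
    ultimately show ?thesis using permutes_id by blast
  next
    fix \<delta> assume \<delta>: "\<delta> ^ d = (-1) ^ (d - 1)" and af: "\<And>x z. (x, z) \<in> A \<Longrightarrow> f1 (pt (aff x z)) = pt (aff (\<delta> * x) (- z - 1))"
    have \<delta>0: "\<delta> \<noteq> 0" using \<delta> d4 by (auto simp: power_0_left)
    \<comment> \<open>The image (\<delta> * x, -(z + 1), -eps * z), divided by \<delta>, must come
      from (x, z, eps * (z + 1)) by exchanging the last two coordinates; this determines the
      factors.\<close>
    define e where "e = (\<lambda>i::nat. if i = 1 then 1 else if i = 2 then - 1 / (eps * \<delta>) else - eps / \<delta>)"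
    define \<tau> where "\<tau> = Transposition.transpose 2 (3::nat)"
    have \<tau>: "\<tau> permutes {1..3}" unfolding \<tau>_def by (intro permutes_swap_id) auto
    have \<tau>i: "\<tau> 1 = 1" "\<tau> (Suc 0) = Suc 0" "\<tau> 2 = 3" "\<tau> 3 = 2" by (simp_all add: \<tau>_def transpose_def)
    have "f1 P = mon \<tau> e P" if "P \<in> curve" for P
      using that
    proof (cases rule: curve_cases)
      case 1
      have "mact \<tau> e flex = sc (- 1 / \<delta>) flex" using \<delta>0 eps_nz by (simp add: mact_def flex_def e_def \<tau>i)
      moreover have "- 1 / \<delta> \<noteq> 0" using \<delta>0 by simp
      ultimately show ?thesis using fl 1 flex_in_cone pt_sc by (simp add: mon_pt)
    next
      case (2 x z)
      have "mact \<tau> e (aff x z) = sc (1 / \<delta>) (aff (\<delta> * x) (- z - 1))"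
        using \<delta>0 eps_nz by (simp add: mact_def aff_def e_def \<tau>i field_simps)
      moreover have "1 / \<delta> \<noteq> 0" using \<delta>0 by simp
      ultimately show ?thesis using 2 af aff_in_cone pt_sc by (simp add: mon_pt)
    qed
    moreover have "roots3 e"
    proof -
      \<comment> \<open>The signs match: (-1)^d compensates for \<delta>^d = (-1)^(d - 1) and eps^d
        = -1.\<close>
      have m: "(- 1) ^ d = - ((- 1) ^ (d - 1) :: 'a)"
        using d4 by (cases d) auto
      have p: "(- 1 / (eps * \<delta>)) ^ d = (-1) ^ d / (eps ^ d * \<delta> ^ d)" "(- eps / \<delta>) ^ d = (-1) ^ d * eps ^ d / \<delta> ^ d"
        by (simp_all only: power_divide power_mult_distrib power_minus[of eps])
      have "(- 1 / (eps * \<delta>)) ^ d = 1" "(- eps / \<delta>) ^ d = 1"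
        unfolding p \<delta> eps m by simp_all
      then show ?thesis by (auto simp: roots3_def e_def)
    qed
    ultimately show ?thesis using \<tau> by blast
  qed
  then obtain \<tau> e where t: "\<tau> permutes {1..3}" "roots3 e" "\<forall>P\<in>curve. f1 P = mon \<tau> e P" by blast
  define \<rho> where "\<rho> = \<tau> \<circ> \<sigma>'"
  define k where "k = (\<lambda>i. c' i * e (\<sigma>' i))"
  have "f = mon \<rho> k"
  proof (rule extensionalityI[OF f(1)])
    show "mon \<rho> k \<in> extensional curve" by (simp add: mon_def)
    fix P assume P: "P \<in> curve"
    have "f P = mon \<sigma>' c' (f1 P)" using inv(2)[OF locmor_closed[OF lf P]] by (simp add: f1_def)
    also have "\<dots> = mon \<sigma>' c' (mon \<tau> e P)" using t(3) P by simp
    also have "\<dots> = mon \<rho> k P" unfolding \<rho>_def k_def by (rule mon_comp[OF s'(1) t(1) s'(2) t(2) P])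
    finally show "f P = mon \<rho> k P" .
  qed
  moreover have "\<rho> permutes {1..3}" unfolding \<rho>_def by (rule permutes_compose[OF s'(1) t(1)])
  moreover have "roots3 k" unfolding k_def by (rule roots3_mult[OF s' t(2)])
  ultimately show ?thesis by blast
qed

end

section \<open>The group structure\<close>

lemma power_eq_1_coprime:
  fixes t :: "'a::field"
  assumes "t ^ r = 1" "t ^ e = 1" "coprime r e" "r \<noteq> 0"
  shows "t = 1"
proof -
  obtain x y where "r * x = e * y + gcd r e" using bezout_nat[OF assms(4)] by blast
  then have "r * x = e * y + 1" using assms(3) by simp
  then have "t ^ (r * x) = t ^ (e * y) * t" by simp
  then show ?thesis using assms(1,2) by (simp add: power_mult)
qed

text \<open>Write n = r * e with r prime and take a primitive e-th root \<eta>. A root y of Y^r =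
  \<eta> is primitive of order n unless y^e = 1. If r divides e this never happens; otherwise the
  quotient of two bad roots is an r-th and an e-th root of unity, hence 1, so among r \<ge> 2 roots
  a good one exists.\<close>

lemma primitive_root_exists:
  assumes "of_nat n \<noteq> (0::'a::alg_closed_field)"
  shows "\<exists>\<omega>::'a. \<forall>k. \<omega> ^ k = 1 \<longleftrightarrow> n dvd k"
  using assms
proof (induction n rule: less_induct)
  case (less n)
  show ?case
  proof (cases "n = 1")
    case True
    then show ?thesis by (intro exI[of _ 1]) simp
  next
    case False
    then obtain r where r: "prime r" "r dvd n" using prime_factor_nat by blast
    then obtain e where n: "n = r * e" by (auto elim: dvdE)
    have nz: "of_nat r \<noteq> (0::'a)" "of_nat e \<noteq> (0::'a)" using less.prems by (auto simp: n)
    then have "e > 0" by (cases e) auto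
    have r2: "r \<ge> 2" using r(1) by (rule prime_ge_2_nat)
    have "e < n" using \<open>e > 0\<close> r2 by (simp add: n)
    then obtain \<eta> :: 'a where \<eta>: "\<And>k. \<eta> ^ k = 1 \<longleftrightarrow> e dvd k" using less.IH nz by blast
    have \<eta>0: "\<eta> \<noteq> 0" using \<eta>[of e] \<open>e > 0\<close> by (auto simp: power_0_left)
    have "\<exists>y. y ^ r = \<eta> \<and> y ^ e \<noteq> 1"
    proof (rule ccontr)
      assume c: "\<not> ?thesis"
      have card: "card {y. y ^ r = \<eta>} = r" using \<eta>0 nz by (intro card_nth_roots)
      then have "{y. y ^ r = \<eta>} \<noteq> {}" using r2 by (metis card.empty not_numeral_le_zero)
      then obtain y where y: "y ^ r = \<eta>" by blast
      have "{y. y ^ r = \<eta>} \<noteq> {y}" using card r2 by (metis is_singletonI is_singleton_altdef not_less_eq_eq numeral_2_eq_2 order_refl One_nat_def)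
      then obtain y' where y': "y' ^ r = \<eta>" "y' \<noteq> y" using y by blast
      have ye: "y ^ e = 1" "y' ^ e = 1" using c y y'(1) by blast+
      have y'0: "y' \<noteq> 0" using y'(1) \<eta>0 r2 by (auto simp: power_0_left)
      show False
      proof (cases "r dvd e")
        case True
        then obtain f where f: "e = r * f" by (auto elim: dvdE)
        then have "\<eta> ^ f = 1" using ye(1) y by (simp add: power_mult)
        then have "e dvd f" using \<eta> by blast
        moreover have "f > 0" "f < e" using \<open>e > 0\<close> r2 by (auto simp: f)
        ultimately show False using dvd_imp_le by fastforce
      next
        case False
        then have "coprime r e" using r(1) by (simp add: prime_imp_coprime)
        moreover have "(y / y') ^ r = 1" "(y / y') ^ e = 1"
          using y y'(1) ye \<eta>0 by (simp_all add: power_divide)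
        ultimately have "y / y' = 1" using power_eq_1_coprime r2 by fastforce
        then show False using y'(2) y'0 by simp
      qed
    qed
    then obtain y where y: "y ^ r = \<eta>" "y ^ e \<noteq> 1" by blast
    have "n dvd k" if k: "y ^ k = 1" for k
    proof -
      have "\<eta> ^ k = (y ^ k) ^ r" unfolding y(1)[symmetric] by (simp add: mult.commute flip: power_mult)
      then have "\<eta> ^ k = 1" using k by simp
      then obtain l where l: "k = e * l" using \<eta> by (auto elim: dvdE)
      have "(y ^ e) ^ l = 1" using k by (simp add: l power_mult)
      moreover have "(y ^ e) ^ r = \<eta> ^ e" unfolding y(1)[symmetric] by (simp add: mult.commute flip: power_mult)
      then have "(y ^ e) ^ r = 1" using \<eta>[of e] by simp
      ultimately have "\<not> coprime r l" using y(2) power_eq_1_coprime r2 by fastforce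
      then have "r dvd l" using r(1) prime_imp_coprime by blast
      then show ?thesis unfolding n l by (metis dvd_refl mult.commute mult_dvd_mono)
    qed
    moreover have "y ^ k = 1" if "n dvd k" for k
    proof -
      obtain l where "k = r * e * l" using \<open>n dvd k\<close> unfolding n by (auto elim: dvdE)
      then have "y ^ k = \<eta> ^ (e * l)" using y(1) by (simp add: power_mult mult.assoc)
      then show ?thesis using \<eta> by simp
    qed
    ultimately show ?thesis by blast
  qed
qed

context fermat_curve
begin

text \<open>A monomial automorphism is determined by its action on the three points below.\<close>

definition flex_at :: "nat \<Rightarrow> 'a triple" where
  "flex_at j = (if j = 1 then (0, 1, eps) else if j = 2 then (1, 0, eps) else (1, eps, 0))"

lemma flex_at_cone: "flex_at j \<in> cone"
  using eps d4 by (auto simp: flex_at_def cone_def power_0_left)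

lemma cd_flex_at: "i \<in> {1..3} \<Longrightarrow> j \<in> {1..3} \<Longrightarrow> cd (flex_at j) i = 0 \<longleftrightarrow> i = j"
  using eps_nz by (auto simp: flex_at_def interval_3)

lemma mon_eqD:
  assumes eq: "mon \<sigma> c = mon \<tau> e" and \<sigma>: "\<sigma> permutes {1..3}" and \<tau>: "\<tau> permutes {1..3}"
    and c: "roots3 c" and e: "roots3 e"
  shows "\<sigma> = \<tau>" and "\<exists>k. \<forall>i\<in>{1..3}. e i = k * c i"
proof -
  have in3: "\<sigma> i \<in> {1..3}" "\<tau> i \<in> {1..3}" if "i \<in> {1..3}" for i
    using that permutes_in_image[OF \<sigma>, of i] permutes_in_image[OF \<tau>, of i] by simp_all
  have rel: "\<exists>k. \<forall>i\<in>{1..3}. e i * cd u (\<tau> i) = k * (c i * cd u (\<sigma> i))" if u: "u \<in> cone" for u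
  proof -
    have "pt (mact \<sigma> c u) = pt (mact \<tau> e u)" using eq mon_pt[OF u] by metis
    then obtain k where k: "mact \<tau> e u = sc k (mact \<sigma> c u)" using pt_eq_iff by blast
    have "e i * cd u (\<tau> i) = k * (c i * cd u (\<sigma> i))" if "i \<in> {1..3}" for i
      using arg_cong[OF k, of "\<lambda>v. cd v i"] that by (simp add: cd_mact)
    then show ?thesis by blast
  qed
  \<comment> \<open>The only vanishing coordinate of \<open>flex_at (\<sigma> i)\<close> has index
    \<sigma> i, so coordinate i of its image is 0; seen through \<tau>, the vanishing index is
    \<tau> i.\<close>
  have st: "\<sigma> i = \<tau> i" if i: "i \<in> {1..3}" for i
  proof -
    obtain k where "e i * cd (flex_at (\<sigma> i)) (\<tau> i) = k * (c i * cd (flex_at (\<sigma> i)) (\<sigma> i))"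
      using rel[OF flex_at_cone] i by blast
    then have "cd (flex_at (\<sigma> i)) (\<tau> i) = 0"
      using roots3_nz[OF e i] cd_flex_at[OF in3(1)[OF i] in3(1)[OF i]] by simp
    then show ?thesis using cd_flex_at[OF in3(2)[OF i] in3(1)[OF i]] by simp
  qed
  show "\<sigma> = \<tau>"
  proof
    fix i show "\<sigma> i = \<tau> i"
      using st[of i] \<sigma> \<tau> by (cases "i \<in> {1..3}") (auto simp: permutes_def)
  qed
  have ratio: "\<exists>k. \<forall>i\<in>{1..3}. i \<noteq> j \<longrightarrow> e i = k * c i" if j: "j \<in> {1..3}" for j
  proof -
    obtain k where k: "\<forall>i\<in>{1..3}. e i * cd (flex_at (\<sigma> j)) (\<tau> i) = k * (c i * cd (flex_at (\<sigma> j)) (\<sigma> i))"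
      using rel[OF flex_at_cone] by blast
    have "e i = k * c i" if i: "i \<in> {1..3}" "i \<noteq> j" for i
    proof -
      have "\<sigma> i \<noteq> \<sigma> j" using i(2) permutes_inj[OF \<sigma>] by (simp add: inj_eq)
      then have "cd (flex_at (\<sigma> j)) (\<sigma> i) \<noteq> 0"
        using cd_flex_at[OF in3(1)[OF i(1)] in3(1)[OF j]] by simp
      moreover have "e i * cd (flex_at (\<sigma> j)) (\<sigma> i) = k * (c i * cd (flex_at (\<sigma> j)) (\<sigma> i))"
        using k i(1) st[OF i(1)] by metis
      ultimately show ?thesis by simp
    qed
    then show ?thesis by blast
  qed
  \<comment> \<open>Each such point compares the two indices it does not kill; index 3 occurs in
    both comparisons, so the factors agree.\<close>
  obtain k where k: "e 2 = k * c 2" "e 3 = k * c 3" using ratio[of 1] by (auto simp: interval_3)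
  obtain l where l: "e 1 = l * c 1" "e 3 = l * c 3" using ratio[of 2] by (auto simp: interval_3)
  have "l = k" using k(2) l(2) roots3_nz[OF c, of 3] by simp
  then show "\<exists>k. \<forall>i\<in>{1..3}. e i = k * c i" using k l by (intro exI[of _ k]) (auto simp: interval_3)
qed

lemma mon_scale:
  assumes "k \<noteq> 0"
  shows "mon \<sigma> (\<lambda>i. k * c i) = mon \<sigma> c"
proof -
  have "mact \<sigma> (\<lambda>i. k * c i) u = sc k (mact \<sigma> c u)" for u by (simp add: mact_def mult.assoc)
  then show ?thesis using assms by (simp add: mon_def pt_sc)
qed

lemma carrier_Aut: "carrier (Aut curve) = {mon \<sigma> c |\<sigma> c. \<sigma> permutes {1..3} \<and> roots3 c}"
  using Aut_monomial mon_in_Aut by blast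

lemma mon_Bij: "\<sigma> permutes {1..3} \<Longrightarrow> roots3 c \<Longrightarrow> mon \<sigma> c \<in> Bij curve"
  using mon_in_Aut by (simp add: Aut_def)

lemma mult_Aut:
  assumes \<sigma>: "\<sigma> permutes {1..3}" and \<tau>: "\<tau> permutes {1..3}" and c: "roots3 c" and e: "roots3 e"
  shows "mon \<sigma> c \<otimes>\<^bsub>BijGroup curve\<^esub> mon \<tau> e = mon (\<tau> \<circ> \<sigma>) (\<lambda>i. c i * e (\<sigma> i))"
    and "mon \<sigma> c \<otimes>\<^bsub>Aut curve\<^esub> mon \<tau> e = mon (\<tau> \<circ> \<sigma>) (\<lambda>i. c i * e (\<sigma> i))"
proof -
  have "compose curve (mon \<sigma> c) (mon \<tau> e) = mon (\<tau> \<circ> \<sigma>) (\<lambda>i. c i * e (\<sigma> i))"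
  proof (rule extensionalityI[of _ curve])
    fix P assume "P \<in> curve"
    then show "compose curve (mon \<sigma> c) (mon \<tau> e) P = mon (\<tau> \<circ> \<sigma>) (\<lambda>i. c i * e (\<sigma> i)) P"
      using mon_comp[OF \<sigma> \<tau> c e] by (simp add: compose_eq)
  qed (simp_all add: mon_def)
  then show "mon \<sigma> c \<otimes>\<^bsub>BijGroup curve\<^esub> mon \<tau> e = mon (\<tau> \<circ> \<sigma>) (\<lambda>i. c i * e (\<sigma> i))"
    and "mon \<sigma> c \<otimes>\<^bsub>Aut curve\<^esub> mon \<tau> e = mon (\<tau> \<circ> \<sigma>) (\<lambda>i. c i * e (\<sigma> i))"
    using mon_Bij[OF \<sigma> c] mon_Bij[OF \<tau> e] by (simp_all add: Aut_def BijGroup_def)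
qed

lemma roots3_1: "roots3 (\<lambda>_. 1)"
  by (simp add: roots3_def)

lemma mon_one: "mon id (\<lambda>_. 1) = \<one>\<^bsub>BijGroup curve\<^esub>"
proof (rule extensionalityI[of _ curve])
  show "mon id (\<lambda>_. 1) P = \<one>\<^bsub>BijGroup curve\<^esub> P" if "P \<in> curve" for P
    using mon_id[OF that] that by (simp add: BijGroup_def)
qed (simp_all add: mon_def BijGroup_def)

lemma subgroup_Aut: "subgroup (carrier (Aut curve)) (BijGroup curve)"
proof
  show "carrier (Aut curve) \<subseteq> carrier (BijGroup curve)" by (auto simp: Aut_def BijGroup_def)
  show "\<one>\<^bsub>BijGroup curve\<^esub> \<in> carrier (Aut curve)"
    unfolding mon_one[symmetric] by (rule mon_in_Aut[OF permutes_id roots3_1])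
  fix f assume "f \<in> carrier (Aut curve)"
  then obtain \<sigma> c where f: "\<sigma> permutes {1..3}" "roots3 c" "f = mon \<sigma> c" unfolding carrier_Aut by blast
  {
    fix g assume "g \<in> carrier (Aut curve)"
    then obtain \<tau> e where g: "\<tau> permutes {1..3}" "roots3 e" "g = mon \<tau> e" unfolding carrier_Aut by blast
    show "f \<otimes>\<^bsub>BijGroup curve\<^esub> g \<in> carrier (Aut curve)"
      unfolding f g mult_Aut(1)[OF f(1) g(1) f(2) g(2)]
      by (rule mon_in_Aut[OF permutes_compose[OF f(1) g(1)] roots3_mult[OF f(1,2) g(2)]])
  }
  obtain \<sigma>' c' where s: "\<sigma>' permutes {1..3}" "roots3 c'"
    and inv: "\<And>P. P \<in> curve \<Longrightarrow> mon \<sigma>' c' (mon \<sigma> c P) = P"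
    using mon_inverse[OF f(1,2)] by metis
  have "mon \<sigma>' c' \<otimes>\<^bsub>BijGroup curve\<^esub> mon \<sigma> c = \<one>\<^bsub>BijGroup curve\<^esub>"
  proof (rule extensionalityI[of _ curve])
    show "(mon \<sigma>' c' \<otimes>\<^bsub>BijGroup curve\<^esub> mon \<sigma> c) P = \<one>\<^bsub>BijGroup curve\<^esub> P" if "P \<in> curve" for P
      using inv[OF that] that mon_Bij[OF f(1,2)] mon_Bij[OF s] by (simp add: BijGroup_def compose_eq)
  qed (use mon_Bij[OF f(1,2)] mon_Bij[OF s] in \<open>simp_all add: BijGroup_def\<close>)
  then have "inv\<^bsub>BijGroup curve\<^esub> f = mon \<sigma>' c'"
    unfolding f(3) using mon_Bij[OF f(1,2)] mon_Bij[OF s]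
    by (intro group.inv_equality[OF group_BijGroup]) (simp_all add: BijGroup_def)
  then show "inv\<^bsub>BijGroup curve\<^esub> f \<in> carrier (Aut curve)" using mon_in_Aut[OF s] by simp
qed

lemma group_Aut: "group (Aut curve)"
proof -
  have "Aut curve = (BijGroup curve)\<lparr>carrier := carrier (Aut curve)\<rparr>" by (simp add: Aut_def)
  then show ?thesis using subgroup.subgroup_is_group[OF subgroup_Aut group_BijGroup] by simp
qed

text \<open>The inverse permutation is taken because \<sigma> itself is reversed by composition, see
  \<open>mult_Aut\<close>.\<close>

definition coord_perm :: "('a point \<Rightarrow> 'a point) \<Rightarrow> nat \<Rightarrow> nat" where
  "coord_perm f = inv_into UNIV (SOME \<sigma>. \<sigma> permutes {1..3} \<and> (\<exists>c. roots3 c \<and> f = mon \<sigma> c))"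

lemma coord_perm_mon:
  assumes "\<sigma> permutes {1..3}" "roots3 c"
  shows "coord_perm (mon \<sigma> c) = inv_into UNIV \<sigma>"
proof -
  have "(SOME \<tau>. \<tau> permutes {1..3} \<and> (\<exists>e. roots3 e \<and> mon \<sigma> c = mon \<tau> e)) = \<sigma>"
    using assms mon_eqD(1) by (intro some_equality) metis+
  then show ?thesis by (simp add: coord_perm_def)
qed

lemma coord_perm_hom: "group_hom (Aut curve) (sym_group 3) coord_perm"
proof (intro group_hom.intro group_Aut sym_group_is_group group_hom_axioms.intro homI)
  fix f assume "f \<in> carrier (Aut curve)"
  then obtain \<sigma> c where f: "\<sigma> permutes {1..3}" "roots3 c" "f = mon \<sigma> c" unfolding carrier_Aut by blast
  show "coord_perm f \<in> carrier (sym_group 3)"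
    unfolding f(3) coord_perm_mon[OF f(1,2)] sym_group_carrier by (rule permutes_inv[OF f(1)])
  fix g assume "g \<in> carrier (Aut curve)"
  then obtain \<tau> e where g: "\<tau> permutes {1..3}" "roots3 e" "g = mon \<tau> e" unfolding carrier_Aut by blast
  show "coord_perm (f \<otimes>\<^bsub>Aut curve\<^esub> g) = coord_perm f \<otimes>\<^bsub>sym_group 3\<^esub> coord_perm g"
    unfolding f(3) g(3) mult_Aut(2)[OF f(1) g(1) f(2) g(2)] sym_group_mult
      coord_perm_mon[OF f(1,2)] coord_perm_mon[OF g(1,2)]
      coord_perm_mon[OF permutes_compose[OF f(1) g(1)] roots3_mult[OF f(1,2) g(2)]]
    by (rule o_inv_distrib[OF permutes_bij[OF g(1)] permutes_bij[OF f(1)]])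
qed

lemma coord_perm_surj: "coord_perm ` carrier (Aut curve) = carrier (sym_group 3)"
proof
  show "coord_perm ` carrier (Aut curve) \<subseteq> carrier (sym_group 3)"
    using group_hom.hom_closed[OF coord_perm_hom] by blast
  show "carrier (sym_group 3) \<subseteq> coord_perm ` carrier (Aut curve)"
  proof
    fix \<pi> assume "\<pi> \<in> carrier (sym_group 3)"
    then have p: "\<pi> permutes {1..3}" by (simp add: sym_group_carrier)
    then have "coord_perm (mon (inv_into UNIV \<pi>) (\<lambda>_. 1)) = inv_into UNIV (inv_into UNIV \<pi>)"
      by (rule coord_perm_mon[OF permutes_inv roots3_1])
    also have "\<dots> = \<pi>" by (rule permutes_inv_inv[OF p])
    finally show "\<pi> \<in> coord_perm ` carrier (Aut curve)"
      using mon_in_Aut[OF permutes_inv[OF p] roots3_1] by (metis imageI)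
  qed
qed

text \<open>The subgroup H. As a kernel it is normal, and its quotient is given by the homomorphism
  theorem.\<close>

definition diag :: "('a point \<Rightarrow> 'a point) set" where
  "diag = kernel (Aut curve) (sym_group 3) coord_perm"

lemma diag_eq: "diag = {mon id c |c. roots3 c}"
proof
  show "diag \<subseteq> {mon id c |c. roots3 c}"
  proof
    fix f assume f: "f \<in> diag"
    then have "f \<in> carrier (Aut curve)" by (simp add: diag_def kernel_def)
    then obtain \<sigma> c where s: "\<sigma> permutes {1..3}" "roots3 c" "f = mon \<sigma> c" unfolding carrier_Aut by blast
    have "inv_into UNIV \<sigma> = id"
      using f coord_perm_mon[OF s(1,2)] by (simp add: diag_def kernel_def s(3) sym_group_one)
    then have "\<sigma> = id" using permutes_inv_inv[OF s(1)] by (metis inv_id)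
    then show "f \<in> {mon id c |c. roots3 c}" using s by blast
  qed
  show "{mon id c |c. roots3 c} \<subseteq> diag"
    using mon_in_Aut[OF permutes_id] coord_perm_mon[OF permutes_id]
    by (auto simp: diag_def kernel_def sym_group_one)
qed

text \<open>Triples of d-th roots of unity up to a common factor: normalizing the third entry to 1
  leaves two free entries, and a primitive root makes the group of roots cyclic of order d.\<close>

lemma diag_iso: "(integer_mod_group d \<times>\<times> integer_mod_group d) \<cong> (Aut curve)\<lparr>carrier := diag\<rparr>"
proof -
  obtain \<omega> :: 'a where \<omega>: "\<And>k. \<omega> ^ k = 1 \<longleftrightarrow> d dvd k" using primitive_root_exists[OF d_nz] by blast
  have \<omega>0: "\<omega> \<noteq> 0" using \<omega>[of d] d4 by (auto simp: power_0_left)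
  have red: "\<omega> ^ (k mod d) = \<omega> ^ k" for k
  proof -
    have "\<omega> ^ k = (\<omega> ^ d) ^ (k div d) * \<omega> ^ (k mod d)"
      by (metis mult_div_mod_eq power_add power_mult)
    then show ?thesis using \<omega>[of d] by simp
  qed
  have inj: "k = l" if "k < d" "l < d" "\<omega> ^ k = \<omega> ^ l" for k l
  proof -
    have *: "k = l" if "k \<le> l" "l < d" "\<omega> ^ k = \<omega> ^ l" for k l
    proof -
      have "\<omega> ^ l = \<omega> ^ k * \<omega> ^ (l - k)" using that(1) by (simp flip: power_add)
      then have "\<omega> ^ (l - k) = 1" using that(3) \<omega>0 by simp
      then have "d dvd l - k" using \<omega> by blast
      then show "k = l" using that by (metis diff_is_0_eq dvd_imp_le le_antisym less_imp_diff_less not_less zero_less_iff_neq_zero)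
    qed
    show ?thesis using *[of k l] *[of l k] that by (metis nat_le_linear)
  qed
  have surj: "\<exists>k<d. t = \<omega> ^ k" if t: "t ^ d = 1" for t
  proof -
    have "(\<lambda>k. \<omega> ^ k) ` {..<d} \<subseteq> mu"
      using \<omega> by (auto simp: mu_def simp flip: power_mult)
    moreover have "card ((\<lambda>k. \<omega> ^ k) ` {..<d}) = d"
      using inj by (subst card_image) (auto simp: inj_on_def)
    ultimately have "(\<lambda>k. \<omega> ^ k) ` {..<d} = mu"
      using card_mu finite_mu by (intro card_subset_eq) auto
    then show ?thesis using t by (auto simp: mu_def)
  qed
  define c where "c = (\<lambda>ij. \<lambda>k::nat. if k = 1 then \<omega> ^ nat (fst ij) else if k = 2 then \<omega> ^ nat (snd ij) else 1)"
  define \<Psi> where "\<Psi> = (\<lambda>ij. mon id (c ij))"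
  have rc: "roots3 (c ij)" for ij
    using \<omega> by (auto simp: roots3_def c_def simp flip: power_mult)
  let ?Z = "integer_mod_group d \<times>\<times> integer_mod_group d"
  have Z: "ij \<in> carrier ?Z \<longleftrightarrow> 0 \<le> fst ij \<and> fst ij < int d \<and> 0 \<le> snd ij \<and> snd ij < int d" for ij
    using d4 by (cases ij) (auto simp: carrier_integer_mod_group)
  have "\<Psi> \<in> iso ?Z ((Aut curve)\<lparr>carrier := diag\<rparr>)"
  proof (rule isoI)
    show "\<Psi> \<in> hom ?Z ((Aut curve)\<lparr>carrier := diag\<rparr>)"
    proof (rule homI)
      show "\<Psi> ij \<in> carrier ((Aut curve)\<lparr>carrier := diag\<rparr>)" for ij
        using rc[of ij] by (auto simp: \<Psi>_def diag_eq)
      fix ij kl assume ij: "ij \<in> carrier ?Z" and kl: "kl \<in> carrier ?Z"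
      have mod: "\<omega> ^ nat ((x + y) mod int d) = \<omega> ^ nat x * \<omega> ^ nat y" if "0 \<le> x" "0 \<le> y" for x y
        using that red[of "nat x + nat y"] by (simp add: nat_mod_distrib nat_add_distrib power_add)
      have "\<Psi> ij \<otimes>\<^bsub>Aut curve\<^esub> \<Psi> kl = mon (id \<circ> id) (\<lambda>i. c ij i * c kl (id i))"
        unfolding \<Psi>_def by (rule mult_Aut(2)[OF permutes_id permutes_id rc rc])
      also have "\<dots> = \<Psi> (ij \<otimes>\<^bsub>?Z\<^esub> kl)"
        unfolding \<Psi>_def comp_id using ij kl Z
        by (intro mon_eqI) (auto simp: c_def mult_DirProd' mod)
      finally show "\<Psi> (ij \<otimes>\<^bsub>?Z\<^esub> kl) = \<Psi> ij \<otimes>\<^bsub>(Aut curve)\<lparr>carrier := diag\<rparr>\<^esub> \<Psi> kl" by simp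
    qed
    show "bij_betw \<Psi> (carrier ?Z) (carrier ((Aut curve)\<lparr>carrier := diag\<rparr>))"
    proof (rule bij_betwI')
      fix ij kl assume ij: "ij \<in> carrier ?Z" and kl: "kl \<in> carrier ?Z"
      have "ij = kl" if eq: "\<Psi> ij = \<Psi> kl"
      proof -
        obtain k where k: "\<forall>i\<in>{1..3}. c kl i = k * c ij i"
          using mon_eqD(2)[OF eq[unfolded \<Psi>_def] permutes_id permutes_id rc rc] by blast
        have "c kl 3 = k * c ij 3" using k by simp
        then have "k = 1" by (simp add: c_def)
        then have "c kl 1 = c ij 1" "c kl 2 = c ij 2" using k by (simp_all add: interval_3)
        then have "\<omega> ^ nat (fst kl) = \<omega> ^ nat (fst ij)" "\<omega> ^ nat (snd kl) = \<omega> ^ nat (snd ij)"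
          by (simp_all add: c_def)
        then have "nat (fst kl) = nat (fst ij)" "nat (snd kl) = nat (snd ij)"
          using ij kl unfolding Z by (auto intro!: inj)
        then show ?thesis using ij kl unfolding Z by (simp add: prod_eq_iff eq_nat_nat_iff)
      qed
      then show "\<Psi> ij = \<Psi> kl \<longleftrightarrow> ij = kl" by blast
    next
      show "\<Psi> ij \<in> carrier ((Aut curve)\<lparr>carrier := diag\<rparr>)" for ij
        using rc[of ij] by (auto simp: \<Psi>_def diag_eq)
    next
      fix f assume "f \<in> carrier ((Aut curve)\<lparr>carrier := diag\<rparr>)"
      then obtain e where e: "roots3 e" "f = mon id e" by (auto simp: diag_eq)
      have e3: "e 1 ^ d = 1" "e 2 ^ d = 1" "e 3 ^ d = 1" "e 3 \<noteq> 0"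
        using e(1) roots3_nz[OF e(1), of 3] by (auto simp: roots3_def)
      then have "(e 1 / e 3) ^ d = 1" "(e 2 / e 3) ^ d = 1" by (simp_all add: power_divide)
      then obtain k l where kl: "k < d" "e 1 / e 3 = \<omega> ^ k" "l < d" "e 2 / e 3 = \<omega> ^ l"
        using surj by metis
      \<comment> \<open>Scaling all entries by 1 / e 3 does not change the map on points.\<close>
      have "f = mon id (\<lambda>i. (1 / e 3) * e i)" unfolding e(2) using e3(4) by (subst mon_scale) auto
      also have "\<dots> = \<Psi> (int k, int l)"
        unfolding \<Psi>_def using kl e3(4) by (intro mon_eqI) (auto simp: c_def interval_3)
      finally show "\<exists>ij\<in>carrier ?Z. f = \<Psi> ij"
        using kl Z by (intro bexI[of _ "(int k, int l)"]) auto
    qed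
  qed
  then show ?thesis by (rule is_isoI)
qed

theorem Aut_structure:
  "group (Aut curve) \<and> Coset.order (Aut curve) = 6 * d ^ 2 \<and>
    (\<exists>H. H \<lhd> Aut curve \<and> comm_group ((Aut curve)\<lparr>carrier := H\<rparr>) \<and> card H = d ^ 2 \<and>
       (Aut curve)\<lparr>carrier := H\<rparr> \<cong> integer_mod_group d \<times>\<times> integer_mod_group d \<and>
       Aut curve Mod H \<cong> sym_group 3)"
proof -
  interpret G: group "Aut curve" by (rule group_Aut)
  interpret h: group_hom "Aut curve" "sym_group 3" coord_perm by (rule coord_perm_hom)
  let ?Z = "integer_mod_group d \<times>\<times> integer_mod_group d"
  have normal: "diag \<lhd> Aut curve" unfolding diag_def by (rule h.normal_kernel)
  then have sub: "subgroup diag (Aut curve)" by (rule normal_imp_subgroup)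
  have quot: "Aut curve Mod diag \<cong> sym_group 3"
    unfolding diag_def by (rule h.FactGroup_iso[OF coord_perm_surj])
  have cd: "card diag = d ^ 2"
    using iso_same_card[OF diag_iso] d4
    by (simp add: carrier_integer_mod_group card_cartesian_product power2_eq_square)
  have gH: "group ((Aut curve)\<lparr>carrier := diag\<rparr>)" by (rule subgroup.subgroup_is_group[OF sub group_Aut])
  have "comm_group ?Z"
    by (intro group.group_comm_groupI DirProd_group group_integer_mod_group)
       (auto simp: add.commute)
  then have comm: "comm_group ((Aut curve)\<lparr>carrier := diag\<rparr>)"
    by (rule comm_group.iso_imp_comm_group[OF _ diag_iso group.is_monoid[OF gH]])
  have iso: "(Aut curve)\<lparr>carrier := diag\<rparr> \<cong> ?Z"
    by (rule group.iso_sym[OF DirProd_group[OF group_integer_mod_group group_integer_mod_group] diag_iso])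
  have "card (rcosets\<^bsub>Aut curve\<^esub> diag) = 6"
    using iso_same_card[OF quot] by (simp add: FactGroup_def sym_group_card_carrier fact_numeral)
  then have "Coset.order (Aut curve) = 6 * d ^ 2"
    using G.lagrange[OF sub] cd by simp
  then show ?thesis using group_Aut normal comm cd iso quot by blast
qed

end

section \<open>The Chebyshev curve\<close>

text \<open>Here \<omega> is the equation of the line at infinity of the given affine curve. A form
  vanishing on the affine part, multiplied by \<omega>, vanishes on all of \<open>A\<close>; since
  \<open>FF\<close> is prime and does not divide \<omega>, the form itself vanishes there. The flex
  lies in the affine part.\<close>

lemma (in fermat_curve) zariski_closure_eq_curve:
  assumes F: "\<And>v. form n a v = (\<Sum>i\<in>{1..3}. cd (L v) i ^ d)"
    and D: "D \<subseteq> curve" and \<omega>: "linear_form \<omega>" and \<omega>D: "\<And>u. u \<in> cone \<Longrightarrow> \<omega> u \<noteq> 0 \<Longrightarrow> pt u \<in> D"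
    and \<omega>nz: "\<omega> flex \<noteq> 0" "(x0, z0) \<in> A" "\<omega> (aff x0 z0) \<noteq> 0"
  shows "zariski_closure D = curve"
proof
  show "zariski_closure D \<subseteq> curve"
  proof
    fix P assume P: "P \<in> zariski_closure D"
    then obtain v where v: "v \<noteq> (0, 0, 0)" "P = proj v" by (auto simp: zariski_closure_def P2_def)
    have "vanishes_at n a Q" if Q: "Q \<in> D" for Q
    proof -
      obtain u where "u \<in> cone" "Q = pt u" using Q D curve_pt by blast
      then show ?thesis by (simp add: pt_def vanishes_at_proj F cone_iff)
    qed
    then have "vanishes_at n a P" using P by (simp add: zariski_closure_def)
    then have "(\<Sum>i\<in>{1..3}. cd (L v) i ^ d) = 0" by (simp add: v(2) vanishes_at_proj F)
    then have "L v \<in> cone" using triple_nz_iff[THEN iffD1, OF L_nz[OF v(1)]] unfolding cone_iff by simp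
    then have "pt (L v) \<in> curve" using pt_in_curve by blast
    then show "P \<in> curve" by (simp add: pt_def v(2))
  qed
  show "curve \<subseteq> zariski_closure D"
  proof
    fix P assume P: "P \<in> curve"
    have "vanishes_at m b P" if b: "\<forall>Q\<in>D. vanishes_at m b Q" for m b
    proof -
      have fD: "form m b (Li u) = 0" if "pt u \<in> D" for u
        using b that vanishes_at_proj unfolding pt_def by blast
      obtain p1 where p1: "hpoly m (\<lambda>u. form m b (Li u)) p1"
        using homf_imp_hpoly[OF homf_form[OF lin_Li]] by blast
      obtain p2 where p2: "hpoly 1 \<omega> p2" using homf_imp_hpoly[OF homf_linear_form[OF \<omega>]] by blast
      have "bev x z (p1 * p2) = 0" if xz: "(x, z) \<in> A" for x z
      proof (cases "\<omega> (aff x z) = 0")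
        case True
        then show ?thesis using p2 by (simp add: hpoly_def)
      next
        case False
        have "form m b (Li (aff x z)) = 0" using xz False by (intro fD \<omega>D) (simp_all add: aff_in_cone)
        then show ?thesis using p1 by (simp add: hpoly_def)
      qed
      then have "FF dvd p1 * p2" using vanish_imp_dvd[of "{}" "p1 * p2"] by simp
      moreover have "\<not> FF dvd p2" using dvd_bev[OF _ \<omega>nz(2), of p2] \<omega>nz(3) p2 by (auto simp: hpoly_def)
      ultimately have p1v: "FF dvd p1" by (simp add: FF_dvd_mult)
      show ?thesis
        using P
      proof (cases rule: curve_cases)
        case 1
        then show ?thesis using fD[OF \<omega>D[OF flex_in_cone \<omega>nz(1)]] by (simp add: pt_def vanishes_at_proj)
      next
        case (2 x z)
        have "form m b (Li (aff x z)) = bev x z p1" using p1 by (simp add: hpoly_def)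
        also have "\<dots> = 0" using dvd_bev[OF p1v 2(1)] .
        finally show ?thesis using 2(2) by (simp add: pt_def vanishes_at_proj)
      qed
    qed
    then show "P \<in> zariski_closure D" using P curve_P2 unfolding zariski_closure_def by blast
  qed
qed

section \<open>The Chebyshev polynomial in characteristic p\<close>

lemma frobenius_power:
  fixes x y :: "'a::comm_ring_1"
  assumes "prime CHAR('a)" "q = CHAR('a) ^ r"
  shows "(x + y) ^ q = x ^ q + y ^ q" and "(x - y) ^ q = x ^ q - y ^ q"
proof -
  show s: "(x + y) ^ q = x ^ q + y ^ q" for x y :: 'a
    using assms by (rule freshmans_dream')
  show "(x - y) ^ q = x ^ q - y ^ q"
    using s[of "x - y" y] by simp
qed

text \<open>With \<open>x = t + 1/t\<close> one has \<open>t(x \<plusminus> 2) = (t \<plusminus> 1)^2\<close>, so that \<open>t^d (x \<plusminus> 2)^d = (t \<plusminus> 1)^(q+1)\<close>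
  can be expanded by the Frobenius map.\<close>

lemma chebyshev_identity:
  fixes t s :: "'a::idom"
  assumes ts: "t * s = 1" and frob: "(t + 1) ^ q = t ^ q + 1" "(t - 1) ^ q = t ^ q - 1"
    and d: "2 * d = q + 1"
  shows "(t + s + 2) ^ d + (t + s - 2) ^ d = 2 * (t ^ d + s ^ d)"
proof -
  have sq: "t * (t + s + 2) = (t + 1) ^ 2" "t * (t + s - 2) = (t - 1) ^ 2"
    using ts by (simp_all add: power2_eq_square algebra_simps)
  have plus: "t ^ d * (t + s + 2) ^ d = (t ^ q + 1) * (t + 1)"
  proof -
    have "t ^ d * (t + s + 2) ^ d = (t + 1) ^ (2 * d)"
      by (simp only: power_mult_distrib[symmetric] power_mult sq)
    then show ?thesis by (simp only: d power_add power_one_right frob)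
  qed
  have minus: "t ^ d * (t + s - 2) ^ d = (t ^ q - 1) * (t - 1)"
  proof -
    have "t ^ d * (t + s - 2) ^ d = (t - 1) ^ (2 * d)"
      by (simp only: power_mult_distrib[symmetric] power_mult sq)
    then show ?thesis by (simp only: d power_add power_one_right frob)
  qed
  have alg: "(a + 1) * (t + 1) + (a - 1) * (t - 1) = 2 * (a * t + 1)" for a
    by (simp add: algebra_simps)
  have "t ^ d * ((t + s + 2) ^ d + (t + s - 2) ^ d) = 2 * (t ^ q * t + 1)"
    by (simp only: distrib_left[of "t ^ d"] plus minus alg)
  also have "t ^ q * t = t ^ d * t ^ d"
  proof -
    have "t ^ (q + 1) = t ^ d * t ^ d" unfolding d[symmetric] by (simp only: mult_2 power_add)
    then show ?thesis by (simp only: power_add power_one_right)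
  qed
  also have "2 * (t ^ d * t ^ d + 1) = t ^ d * (2 * (t ^ d + s ^ d))"
  proof -
    have "t ^ d * s ^ d = 1" using ts by (simp flip: power_mult_distrib)
    then show ?thesis by (simp add: algebra_simps)
  qed
  finally show ?thesis using ts by (auto simp: power_0_left)
qed

text \<open>The right-hand side is monic and solves the defining equation by
  \<open>chebyshev_identity\<close>; that equation has a single solution.\<close>

lemma chebyshev_char:
  assumes p: "prime CHAR('k::field)" and q: "q = CHAR('k) ^ r" and d: "2 * d = q + 1" and two: "(2 :: 'k) \<noteq> 0"
  shows "(chebyshev d :: 'k poly) = smult (1 / 2) ([:2, 1:] ^ d + [:-2, 1:] ^ d)"
proof -
  let ?\<phi> = "smult (1 / 2) ([:2, 1:] ^ d + [:-2, 1:] ^ d) :: 'k poly"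
  have "d > 0" using d by simp
  have cf: "poly.coeff ?\<phi> i = 1 / 2 * (of_nat (d choose i) * 2 ^ (d - i) + of_nat (d choose i) * (-2) ^ (d - i))" for i
    by (simp add: coeff_linear_poly_power')
  have lead: "poly.coeff ?\<phi> d = 1" unfolding cf using two by simp
  have deg: "Polynomial.degree ?\<phi> = d"
  proof (intro antisym degree_le allI impI)
    show "poly.coeff ?\<phi> i = 0" if "d < i" for i
      unfolding cf using that by (simp add: binomial_eq_0)
    show "d \<le> Polynomial.degree ?\<phi>" by (rule le_degree) (simp only: lead one_neq_zero not_False_eq_True)
  qed
  let ?t = "fls_X :: 'k fls" and ?s = "fls_X_inv :: 'k fls"
  let ?x = "?t + ?s"
  interpret e: coef_hom "\<lambda>p. poly (map_poly fls_const p) ?x" by (rule fls_hom.coef_hom_poly)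
  interpret t: coef_hom "\<lambda>p. poly (map_poly fls_const p) ?t" by (rule fls_hom.coef_hom_poly)
  have ts: "?t * ?s = 1" by (simp add: fls_X_times_conv_shift)
  have c2: "fls_const (2 :: 'k) = 2" "fls_const (-2 :: 'k) = -2"
    using fls_hom.of_nat[of 2, where 'a = 'k] fls_hom.minus[of "2 :: 'k"] by simp_all
  have two': "(2 :: 'k fls) \<noteq> 0" using two fls_const_nonzero[of "2 :: 'k"] c2 by simp
  \<comment> \<open>The Frobenius identity is applied in k[X] and carried over by X \<mapsto>
    t.\<close>
  have frob: "(?t + 1) ^ q = ?t ^ q + 1" "(?t - 1) ^ q = ?t ^ q - 1"
  proof -
    have X: "poly (map_poly fls_const [:0, 1 :: 'k:]) ?t = ?t" by (simp add: map_poly_pCons)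
    have "([:0, 1:] + 1 :: 'k poly) ^ q = [:0, 1:] ^ q + 1 ^ q" "([:0, 1:] - 1 :: 'k poly) ^ q = [:0, 1:] ^ q - 1 ^ q"
      using frobenius_power[of q r "[:0, 1 :: 'k:]" 1] p q by simp_all
    from arg_cong[OF this(1), of "\<lambda>p. poly (map_poly fls_const p) ?t"] arg_cong[OF this(2), of "\<lambda>p. poly (map_poly fls_const p) ?t"]
    show "(?t + 1) ^ q = ?t ^ q + 1" "(?t - 1) ^ q = ?t ^ q - 1"
      unfolding t.add t.diff t.power t.one X by simp_all
  qed
  have ev: "poly (map_poly fls_const ?\<phi>) ?x = fls_const (1 / 2) * ((?x + 2) ^ d + (?x - 2) ^ d)"
  proof -
    have "?\<phi> = [:1 / 2:] * ([:2, 1:] ^ d + [:-2, 1:] ^ d)" by simp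
    then have "poly (map_poly fls_const ?\<phi>) ?x = poly (map_poly fls_const ([:1 / 2:] * ([:2, 1:] ^ d + [:-2, 1:] ^ d))) ?x"
      by simp
    also have "\<dots> = fls_const (1 / 2) * ((?x + 2) ^ d + (?x - 2) ^ d)"
    proof -
      have lin: "poly (map_poly fls_const [:a, 1:]) ?x = fls_const a + ?x"
        and const: "poly (map_poly fls_const [:a:]) ?x = fls_const a" for a :: 'k
        by (simp_all add: map_poly_pCons)
      have "2 + ?x = ?x + 2" "-2 + ?x = ?x - 2" by (rule add.commute, simp)
      then show ?thesis unfolding e.mult e.add e.power lin const c2 by (simp only:)
    qed
    finally show ?thesis .
  qed
  have "(?x + 2) ^ d + (?x - 2) ^ d = 2 * (?t ^ d + ?s ^ d)"
    by (rule chebyshev_identity[OF ts frob d])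
  moreover have "fls_const (1 / 2 :: 'k) * 2 = 1"
  proof -
    have "fls_const (1 / 2 :: 'k) * fls_const 2 = fls_const (1 / 2 * 2)" by (rule fls_hom.mult[symmetric])
    moreover have "(1 / 2 * 2 :: 'k) = 1" using two by simp
    ultimately show ?thesis by (simp only: c2 fls_const_1)
  qed
  ultimately have "poly (map_poly fls_const ?\<phi>) ?x = ?t ^ d + ?s ^ d"
    unfolding ev by (simp only: mult.assoc[symmetric] mult_1_left)
  then have "is_chebyshev d ?\<phi>" unfolding is_chebyshev_def deg by (simp only: lead simp_thms)
  then show ?thesis
    unfolding chebyshev_def by (rule the1_equality[OF chebyshev_ex1[OF \<open>d > 0\<close>]])
qed

text \<open>From 2d = q + 1 one gets 48 * (d choose 3) = (q + 1) * (q - 1) * (q - 3) = q * (q^2 - 3q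
  - 1) + 3. So p could only be 3; then d \<ge> 4 gives 9 | q, and divisibility of the binomial
  coefficient by 3 would give 9 | 3.\<close>

lemma choose_3_not_dvd:
  fixes p d r :: nat
  assumes p: "prime p" and d: "2 * d = p ^ r + 1" "d \<ge> 4"
  shows "\<not> p dvd (d choose 3)"
proof
  assume "p dvd (d choose 3)"
  have c: "6 * (d choose 3) = d * (d - 1) * (d - 2)"
  proof -
    have 3: "3 * (d choose 3) = d * ((d - 1) choose 2)"
    proof -
      have "Suc 2 * (d choose Suc 2) = d * ((d - 1) choose 2)" by (rule binomial_absorption)
      moreover have "Suc 2 = 3" by simp
      ultimately show ?thesis by (simp only:)
    qed
    have 2: "2 * ((d - 1) choose 2) = (d - 1) * (d - 2)"
    proof -
      have "Suc 1 * ((d - 1) choose Suc 1) = (d - 1) * ((d - 1 - 1) choose 1)" by (rule binomial_absorption)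
      moreover have "Suc 1 = 2" "d - 1 - 1 = d - 2" by simp_all
      ultimately show ?thesis by (simp only: choose_one)
    qed
    have "6 * (d choose 3) = 2 * (3 * (d choose 3))" by simp
    also have "\<dots> = d * (2 * ((d - 1) choose 2))" unfolding 3 by (rule mult.left_commute)
    also have "\<dots> = d * (d - 1) * (d - 2)" unfolding 2 by (rule mult.assoc[symmetric])
    finally show ?thesis .
  qed
  define q where "q = int (p ^ r)"
  have dq: "2 * int d = q + 1" using arg_cong[OF d(1), of int] by (simp add: q_def)
  have "6 * int (d choose 3) = int d * (int d - 1) * (int d - 2)"
  proof -
    have "int (d - 1) = int d - 1" "int (d - 2) = int d - 2" using d(2) by simp_all
    then show ?thesis using arg_cong[OF c, of int] by (simp only: of_nat_mult of_nat_numeral)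
  qed
  moreover have "(2 * int d) * (2 * int d - 2) * (2 * int d - 4) = 8 * (int d * (int d - 1) * (int d - 2))"
    by (simp add: algebra_simps)
  ultimately have "48 * int (d choose 3) = (2 * int d) * (2 * int d - 2) * (2 * int d - 4)"
    by linarith
  also have "\<dots> = q * (q ^ 2 - 3 * q - 1) + 3"
    unfolding dq by (simp add: algebra_simps power2_eq_square)
  finally have e: "3 = 48 * int (d choose 3) - q * (q ^ 2 - 3 * q - 1)" by simp
  have pc: "int p dvd int (d choose 3)" using \<open>p dvd (d choose 3)\<close> by simp
  have "p ^ r \<ge> 7" using d by simp
  then have "r \<noteq> 0" by (intro notI) simp
  then have pq: "int p dvd q" by (simp add: q_def)
  have "int p dvd 48 * int (d choose 3) - q * (q ^ 2 - 3 * q - 1)"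
    by (rule dvd_diff[OF dvd_mult[OF pc] dvd_mult2[OF pq]])
  then have "int p dvd 3" by (simp only: e[symmetric])
  then have "p dvd 3" by (metis int_dvd_int_iff of_nat_numeral)
  then have p3: "p = 3" using p primes_dvd_imp_eq[of p 3] by simp
  then have "r \<noteq> 1" using \<open>p ^ r \<ge> 7\<close> by auto
  then have "2 \<le> r" using \<open>r \<noteq> 0\<close> by simp
  then have "(3::nat) ^ 2 dvd 3 ^ r" by (rule le_imp_power_dvd)
  then have "int (3 ^ 2) dvd int (3 ^ r)" by (simp only: int_dvd_int_iff)
  then have q9: "(9 :: int) dvd q" unfolding q_def p3 by simp
  have c9: "(9 :: int) dvd 48 * int (d choose 3)"
  proof -
    obtain k where "int (d choose 3) = 3 * k" using pc p3 by (auto elim: dvdE)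
    then have "48 * int (d choose 3) = 9 * (16 * k)" by simp
    then show ?thesis by (rule dvdI)
  qed
  have "(9 :: int) dvd 48 * int (d choose 3) - q * (q ^ 2 - 3 * q - 1)"
    by (rule dvd_diff[OF c9 dvd_mult2[OF q9]])
  then have "(9 :: int) dvd 3" by (simp only: e[symmetric])
  then show False by simp
qed

theorem proposition3p3:
  fixes p q d :: nat
  assumes "prime p"
    and "\<exists>r\<ge>1. q = p ^ r"
    and "d \<ge> 4"
    and "2 * d = q + 1"
    and "CHAR('k::field) = p"
  defines "G \<equiv> Aut (chebyshev_curve TYPE('k) d)"
  shows "group G \<and> Coset.order G = 6 * d ^ 2 \<and>
    (\<exists>H. H \<lhd> G \<and>
       comm_group (G\<lparr>carrier := H\<rparr>) \<and>
       card H = d ^ 2 \<and>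
       G\<lparr>carrier := H\<rparr> \<cong> integer_mod_group d \<times>\<times> integer_mod_group d \<and>
       G Mod H \<cong> sym_group 3)"
proof -
  obtain r where r: "r \<ge> 1" "q = p ^ r" using assms(2) by blast
  have charK: "CHAR('k alg_closure) = p" using assms(5) by simp
  have pq: "p dvd q" using r by simp
  have p1: "\<not> p dvd 1" using assms(1) by auto
  have two_not: "\<not> p dvd 2"
  proof
    assume "p dvd 2"
    then have "p = 2" using assms(1) by (simp add: primes_dvd_imp_eq)
    then have "even (q + 1)" using assms(4) by (metis dvd_triv_left)
    then show False using pq \<open>p = 2\<close> by simp
  qed
  have nzK: "of_nat m \<noteq> (0 :: 'k alg_closure)" if "\<not> p dvd m" for m
    using that of_nat_eq_0_iff_char_dvd[of m, where 'a = "'k alg_closure"] unfolding charK by simp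
  have two: "(2 :: 'k alg_closure) \<noteq> 0" using nzK[OF two_not] by simp
  have twok: "(2 :: 'k) \<noteq> 0"
    using two_not of_nat_eq_0_iff_char_dvd[of 2, where 'a = 'k] assms(5) by simp
  have pd: "\<not> p dvd d"
  proof
    assume "p dvd d"
    then have "p dvd q + 1" using assms(4) by (metis dvd_mult)
    then show False using pq p1 dvd_add_right_iff by blast
  qed
  have pd1: "\<not> p dvd d - 1"
  proof
    assume "p dvd d - 1"
    have "2 * (d - 1) + 1 = q" using assms(3,4) by simp
    then have "p dvd 2 * (d - 1) + 1" using pq by simp
    then show False using \<open>p dvd d - 1\<close> p1 by (metis dvd_add_right_iff dvd_mult)
  qed
  obtain eps :: "'k alg_closure" where eps: "eps ^ d = -1"
    using nth_root_exists[of d "-1 :: 'k alg_closure"] assms(3) by auto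
  \<comment> \<open>Absorbs the coefficient in -2 * y^d = (\<kappa> * y)^d.\<close>
  obtain \<kappa> :: "'k alg_closure" where \<kappa>: "\<kappa> ^ d = -2"
    using nth_root_exists[of d "-2 :: 'k alg_closure"] assms(3) by auto
  have \<kappa>0: "\<kappa> \<noteq> 0" using \<kappa> two assms(3) by (auto simp: power_0_left)
  have four: "(4 :: 'k alg_closure) \<noteq> 0"
  proof -
    have "(4 :: 'k alg_closure) = 2 * 2" by simp
    then show ?thesis using two by (metis mult_eq_0_iff)
  qed
  \<comment> \<open>The homogenized equation (x + 2w)^d + (x - 2w)^d - 2y^d = 0 becomes the Fermat
    equation in these three linear forms.\<close>
  define L :: "'k alg_closure triple \<Rightarrow> 'k alg_closure triple" where
    "L = (\<lambda>(x, y, w). (\<kappa> * y, x + 2 * w, x - 2 * w))"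
  define Li :: "'k alg_closure triple \<Rightarrow> 'k alg_closure triple" where
    "Li = (\<lambda>(a, b, c). ((b + c) / 2, a / \<kappa>, (b - c) / 4))"
  interpret F: fermat_curve d eps L Li
  proof
    show "d \<ge> 4" "eps ^ d = -1" by fact+
    show "of_nat d \<noteq> (0 :: 'k alg_closure)" "of_nat (d - 1) \<noteq> (0 :: 'k alg_closure)" by (rule nzK[OF pd], rule nzK[OF pd1])
    show "of_nat (d choose 3) \<noteq> (0 :: 'k alg_closure)"
      using choose_3_not_dvd[OF assms(1)] assms(3,4) r(2) by (intro nzK) simp
    show "linear_map L" unfolding linear_map_def linear_form_def L_def
    proof (intro conjI)
      show "\<exists>a b c. \<forall>x y z. fst (case (x, y, z) of (x, y, w) \<Rightarrow> (\<kappa> * y, x + 2 * w, x - 2 * w)) = a * x + b * y + c * z"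
        by (rule exI[of _ 0], rule exI[of _ \<kappa>], rule exI[of _ 0]) simp
      show "\<exists>a b c. \<forall>x y z. fst (snd (case (x, y, z) of (x, y, w) \<Rightarrow> (\<kappa> * y, x + 2 * w, x - 2 * w))) = a * x + b * y + c * z"
        by (rule exI[of _ 1], rule exI[of _ 0], rule exI[of _ 2]) simp
      show "\<exists>a b c. \<forall>x y z. snd (snd (case (x, y, z) of (x, y, w) \<Rightarrow> (\<kappa> * y, x + 2 * w, x - 2 * w))) = a * x + b * y + c * z"
        by (rule exI[of _ 1], rule exI[of _ 0], rule exI[of _ "-2"]) simp
    qed
    show "linear_map Li" unfolding linear_map_def linear_form_def Li_def
    proof (intro conjI)
      show "\<exists>a b c. \<forall>x y z. fst (case (x, y, z) of (a, b, c) \<Rightarrow> ((b + c) / 2, a / \<kappa>, (b - c) / 4)) = a * x + b * y + c * z"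
        by (rule exI[of _ 0], rule exI[of _ "1 / 2"], rule exI[of _ "1 / 2"]) (simp add: add_divide_distrib)
      show "\<exists>a b c. \<forall>x y z. fst (snd (case (x, y, z) of (a, b, c) \<Rightarrow> ((b + c) / 2, a / \<kappa>, (b - c) / 4))) = a * x + b * y + c * z"
        by (rule exI[of _ "1 / \<kappa>"], rule exI[of _ 0], rule exI[of _ 0]) simp
      show "\<exists>a b c. \<forall>x y z. snd (snd (case (x, y, z) of (a, b, c) \<Rightarrow> ((b + c) / 2, a / \<kappa>, (b - c) / 4))) = a * x + b * y + c * z"
        by (rule exI[of _ 0], rule exI[of _ "1 / 4"], rule exI[of _ "- 1 / 4"]) (simp add: diff_divide_distrib)
    qed
    show "L (Li u) = u" for u
    proof (cases u)
      case (fields a b c)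
      have "2 * ((b - c) / 4) = (b - c) / 2"
        using two four by (simp add: field_simps)
      then have "(b + c) / 2 + 2 * ((b - c) / 4) = b" "(b + c) / 2 - 2 * ((b - c) / 4) = c"
        using two by (simp_all add: field_simps)
      then show ?thesis using \<kappa>0 by (simp add: fields L_def Li_def)
    qed
    show "Li (L v) = v" for v
      using two four \<kappa>0 by (cases v) (simp add: L_def Li_def field_simps)
  qed
  define \<phi> where "\<phi> = map_poly to_ac (chebyshev d :: 'k poly)"
  have \<phi>: "2 * poly \<phi> x = (x + 2) ^ d + (x - 2) ^ d" for x
  proof -
    have "coef_hom (to_ac :: 'k \<Rightarrow> 'k alg_closure)" by unfold_locales simp_all
    then interpret h: coef_hom "\<lambda>p. poly (map_poly (to_ac :: 'k \<Rightarrow> 'k alg_closure) p) x"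
      by (rule coef_hom.coef_hom_poly)
    have "(chebyshev d :: 'k poly) = [:1 / 2:] * ([:2, 1:] ^ d + [:-2, 1:] ^ d)"
      using chebyshev_char[of q r d, where 'k = 'k] assms(1,4,5) r(2) twok by simp
    then have "poly \<phi> x = poly (map_poly to_ac ([:1 / 2 :: 'k:] * ([:2, 1:] ^ d + [:-2, 1:] ^ d))) x"
      by (simp add: \<phi>_def)
    also have "\<dots> = 1 / 2 * ((x + 2) ^ d + (x - 2) ^ d)"
      unfolding h.mult h.add h.power by (simp add: map_poly_pCons add.commute)
    finally show ?thesis using two by (simp add: mult.commute)
  qed
  have cone_iff: "L (x, y, w) \<in> F.cone \<longleftrightarrow> (x + 2 * w) ^ d + (x - 2 * w) ^ d = 2 * y ^ d \<and> (x, y, w) \<noteq> (0, 0, 0)" for x y w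
  proof -
    have Lx: "L (x, y, w) = (\<kappa> * y, x + 2 * w, x - 2 * w)" by (simp add: L_def)
    have "L (x, y, w) \<noteq> (0, 0, 0) \<longleftrightarrow> (x, y, w) \<noteq> (0, 0, 0)"
      using F.L_nz[of "(x, y, w)"] linear_map_0[OF F.lin_L] by metis
    moreover have "(\<kappa> * y) ^ d + (x + 2 * w) ^ d + (x - 2 * w) ^ d = 0 \<longleftrightarrow> (x + 2 * w) ^ d + (x - 2 * w) ^ d = 2 * y ^ d"
      by (auto simp: power_mult_distrib \<kappa> algebra_simps)
    moreover have "L (x, y, w) \<in> F.cone \<longleftrightarrow>
        (\<kappa> * y) ^ d + (x + 2 * w) ^ d + (x - 2 * w) ^ d = 0 \<and> L (x, y, w) \<noteq> (0, 0, 0)"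
      unfolding Lx F.cone_def mem_Collect_eq prod.case by (rule refl)
    ultimately show ?thesis by (simp only:)
  qed
  have "chebyshev_curve TYPE('k) d = F.curve"
    unfolding chebyshev_curve_def \<phi>_def[symmetric]
  proof (rule F.zariski_closure_eq_curve)
    let ?D = "{proj (x, y, 1) |x y. y ^ d = poly \<phi> x}"
    \<comment> \<open>Binomial coefficients of (x + 2w)^d + (x - 2w)^d - 2y^d; the terms without y
      and the single term y^d do not overlap because d > 0.\<close>
    define a :: "nat \<Rightarrow> nat \<Rightarrow> 'k alg_closure" where
      "a = (\<lambda>i j. (if j = 0 then of_nat (d choose i) * (2 ^ (d - i) + (-2) ^ (d - i)) else 0) + (if i = 0 \<and> j = d then -2 else 0))"
    show "form d a v = (\<Sum>i\<in>{1..3}. cd (L v) i ^ d)" for v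
    proof -
      obtain x y w where v: "v = (x, y, w)" by (cases v)
      have "form d a v = (\<Sum>i\<le>d. \<Sum>j\<le>d - i. (if j = 0 then of_nat (d choose i) * (2 ^ (d - i) + (-2) ^ (d - i)) * x ^ i * w ^ (d - i) else 0)
          + (if j = d then (if i = 0 then -2 * y ^ d else 0) else 0))"
        unfolding v form_def prod.case
        by (intro sum.cong refl) (use assms(3) in \<open>auto simp: a_def\<close>)
      also have "\<dots> = (\<Sum>i\<le>d. of_nat (d choose i) * (2 ^ (d - i) + (-2) ^ (d - i)) * x ^ i * w ^ (d - i)
          + (if i = 0 then -2 * y ^ d else 0))"
        by (intro sum.cong refl) (simp add: sum.distrib)
      also have "\<dots> = (\<Sum>i\<le>d. of_nat (d choose i) * x ^ i * (2 * w) ^ (d - i)) + (\<Sum>i\<le>d. of_nat (d choose i) * x ^ i * (-2 * w) ^ (d - i)) + (-2 * y ^ d)"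
      proof -
        have t: "of_nat (d choose i) * (2 ^ (d - i) + (-2) ^ (d - i)) * x ^ i * w ^ (d - i) =
            of_nat (d choose i) * x ^ i * (2 * w) ^ (d - i) + of_nat (d choose i) * x ^ i * (-2 * w) ^ (d - i)" for i
          by (simp only: power_mult_distrib distrib_left distrib_right mult_ac)
        have "(\<Sum>i\<le>d. if i = 0 then -2 * y ^ d else 0) = -2 * y ^ d" by simp
        then show ?thesis by (simp only: t sum.distrib)
      qed
      also have "\<dots> = (x + 2 * w) ^ d + (x + (-2 * w)) ^ d + (-2 * y ^ d)"
        by (simp only: binomial_ring)
      also have "\<dots> = (\<Sum>i\<in>{1..3}. cd (L v) i ^ d)"
        by (simp add: v interval_3 L_def power_mult_distrib \<kappa>)
      finally show ?thesis .
    qed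
    show "?D \<subseteq> F.curve"
    proof safe
      fix x y assume "y ^ d = poly \<phi> x"
      then have "L (x, y, 1) \<in> F.cone" using \<phi>[of x] by (simp add: cone_iff)
      then have "F.pt (L (x, y, 1)) \<in> F.curve" using F.pt_in_curve by blast
      then show "proj (x, y, 1) \<in> F.curve" by (simp add: F.pt_def)
    qed
    \<comment> \<open>The homogenizing coordinate w of the Chebyshev curve, in Fermat
      coordinates.\<close>
    define \<omega> where "\<omega> = (\<lambda>u. snd (snd (Li u)))"
    show "linear_form \<omega>" using F.lin_Li by (simp add: linear_map_def \<omega>_def)
    show "F.pt u \<in> ?D" if u: "u \<in> F.cone" "\<omega> u \<noteq> 0" for u
    proof -
      obtain x y w where v: "Li u = (x, y, w)" by (cases "Li u")
      have w: "w \<noteq> 0" using u(2) by (simp add: \<omega>_def v)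
      have "proj (x, y, w) = proj (x / w, y / w, 1)"
        unfolding proj_eq_iff using w by (intro exI[of _ "1 / w"]) simp
      then have pu: "F.pt u = proj (x / w, y / w, 1)" by (simp add: F.pt_def v)
      then have "F.pt (L (x / w, y / w, 1)) = F.pt u" by (simp add: F.pt_def)
      then have "L (x / w, y / w, 1) \<in> F.cone" using u(1) F.pt_in_curve by metis
      then have "(y / w) ^ d = poly \<phi> (x / w)" using \<phi>[of "x / w"] two by (simp add: cone_iff)
      then show ?thesis unfolding pu by blast
    qed
    \<comment> \<open>At the flex \<omega> equals (1 - eps) / 4, and eps = 1 would mean 1 =
      -1.\<close>
    have "eps \<noteq> 1" using eps two by auto
    then show "\<omega> F.flex \<noteq> 0" using four by (simp add: \<omega>_def Li_def F.flex_def)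
    \<comment> \<open>At z = 0 the value of \<omega> is -eps / 4, which is visibly nonzero for any
      x.\<close>
    show "(SOME x. (x, 0) \<in> F.A, 0) \<in> F.A" by (rule someI_ex[OF F.fiber_exists])
    show "\<omega> (F.aff (SOME x. (x, 0) \<in> F.A) 0) \<noteq> 0"
      using four F.eps_nz by (simp add: \<omega>_def Li_def F.aff_def)
  qed
  then show ?thesis unfolding G_def using F.Aut_structure by simp
qed

end
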